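(* Assume that $n\ge2$. Then, for every $\lambda>2n-1$ the following holds. (1) There exists $a\in L^\infty(\mathrm{D}^{\mathrm{I}}_{n\times n})$ that satisfies $a(Z)=a\big((Z^*Z)^{\frac12}\big)$, for almost every $Z\in\mathrm{D}^{\mathrm{I}}_{n\times n}$, such that the unital Banach algebra generated by $T^{(\lambda)}_a$ is commutative and non-$C^*$. In particular, the unital $C^*$-algebra generated by $T^{(\lambda)}_a$ is not commutative. (2) There exists $a\in L^\infty(\mathrm{D}^{\mathrm{I}}_{n\times n})$ that satisfies $a(Z)=a\big((ZZ^* )^{\frac12}\big)$, for almost every $Z\in\mathrm{D}^{\mathrm{I}}_{n\times n}$, such that the unital Banach algebra generated by $T^{(\lambda)}_a$ is commutative and non-$C^*$. In particular, the unital $C^*$-algebra generated by $T^{(\lambda)}_a$ is not commutative.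
   Context: $\mathrm{D}^{\mathrm{I}}_{n\times n}=\{Z\in M_{n\times n}(\mathbb{C}): Z^*Z<I_n\}$. For $\lambda>2n-1$, $dv_\lambda(Z)=c_\lambda\det(I_n-ZZ^* )^{\lambda-2n}dv(Z)$, with $dv$ Lebesgue measure and $c_\lambda>0$ such that $v_\lambda(\mathrm{D}^{\mathrm{I}}_{n\times n})=1$. $\mathcal{A}^2_\lambda(\mathrm{D}^{\mathrm{I}}_{n\times n})$ is the weighted Bergman space of holomorphic functions in $L^2(\mathrm{D}^{\mathrm{I}}_{n\times n},v_\lambda)$, with orthogonal projection $B_\lambda$ from $L^2(\mathrm{D}^{\mathrm{I}}_{n\times n},v_\lambda)$. For $a\in L^\infty(\mathrm{D}^{\mathrm{I}}_{n\times n})$, $T^{(\lambda)}_a(f)=B_\lambda(af)$ on $\mathcal{A}^2_\lambda(\mathrm{D}^{\mathrm{I}}_{n\times n})$. In the conditions on $a$, the symbol $a$ is a measurable essentially bounded function defined at every point of $\mathrm{D}^{\mathrm{I}}_{n\times n}$. The unital Banach algebra generated by a set of bounded operators is the smallest norm-closed subalgebra of the bounded operators on $\mathcal{A}^2_\lambda(\mathrm{D}^{\mathrm{I}}_{n\times n})$ containing the set and the identity; it is non-$C^*$ if it is not closed under taking adjoints. *)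

theory Defs
  imports "HOL-Analysis.Analysis"
begin

section \<open>Matrices and the Cartan domain of type I\<close>

definition conj_transpose :: "complex^'n^'m \<Rightarrow> complex^'m^'n" where
  "conj_transpose A = (\<chi> i j. cnj (A $ j $ i))"

definition quad_form :: "complex^'n^'n \<Rightarrow> complex^'n \<Rightarrow> complex" where
  "quad_form A v = (\<Sum>i\<in>UNIV. cnj (v $ i) * (A *v v) $ i)"

definition pos_semidef :: "complex^'n^'n \<Rightarrow> bool" where
  "pos_semidef A \<longleftrightarrow> conj_transpose A = A \<and> (\<forall>v. 0 \<le> Re (quad_form A v))"

definition pos_def :: "complex^'n^'n \<Rightarrow> bool" where
  "pos_def A \<longleftrightarrow> conj_transpose A = A \<and> (\<forall>v. v \<noteq> 0 \<longrightarrow> 0 < Re (quad_form A v))"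

definition psd_sqrt :: "complex^'n^'n \<Rightarrow> complex^'n^'n" where
  "psd_sqrt A = (THE R. pos_semidef R \<and> R ** R = A)"

definition cartan_domain :: "(complex^'n^'n) set" where
  "cartan_domain = {Z. pos_def (mat 1 - conj_transpose Z ** Z)}"


section \<open>Weighted measures and function spaces\<close>

text \<open>The determinant of the positive definite matrix \<open>I - Z Z\<^sup>*\<close> is a positive real number,
  which justifies taking its real part.\<close>

definition weighted_volume :: "real \<Rightarrow> real \<Rightarrow> (complex^'n^'n) measure" where
  "weighted_volume c \<nu> = density (lebesgue_on cartan_domain)
     (\<lambda>Z. ennreal (c * Re (det (mat 1 - Z ** conj_transpose Z)) powr (\<nu> - 2 * real CARD('n))))"

definition bergman_measure :: "real \<Rightarrow> (complex^'n^'n) measure" where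
  "bergman_measure \<nu> = weighted_volume
     (THE c. 0 < c \<and>
        emeasure (weighted_volume c \<nu> :: (complex^'n^'n) measure) cartan_domain = 1) \<nu>"

definition L_infinity :: "(complex^'n^'n \<Rightarrow> complex) set" where
  "L_infinity = {a \<in> borel_measurable (lebesgue_on cartan_domain).
     \<exists>C. AE Z in lebesgue_on cartan_domain. norm (a Z) \<le> C}"

text \<open>Elements of \<open>L\<^sup>2\<close> are represented by functions; no quotient by almost everywhere
  equality is taken.\<close>

definition L2_space :: "real \<Rightarrow> (complex^'n^'n \<Rightarrow> complex) set" where
  "L2_space \<nu> = {f \<in> borel_measurable (bergman_measure \<nu>).
     integrable (bergman_measure \<nu>) (\<lambda>Z. (norm (f Z))\<^sup>2)}"

definition L2_inner ::
    "real \<Rightarrow> (complex^'n^'n \<Rightarrow> complex) \<Rightarrow> (complex^'n^'n \<Rightarrow> complex) \<Rightarrow> complex" where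
  "L2_inner \<nu> f g = (LINT Z|bergman_measure \<nu>. f Z * cnj (g Z))"

definition L2_norm :: "real \<Rightarrow> (complex^'n^'n \<Rightarrow> complex) \<Rightarrow> real" where
  "L2_norm \<nu> f = sqrt (LINT Z|bergman_measure \<nu>. (norm (f Z))\<^sup>2)"

text \<open>Holomorphy in the matrix entries: the real Frechet derivative exists and is complex linear.\<close>

definition matrix_holomorphic_on ::
    "(complex^'n^'n \<Rightarrow> complex) \<Rightarrow> (complex^'n^'n) set \<Rightarrow> bool" where
  "matrix_holomorphic_on f S \<longleftrightarrow> (\<forall>Z\<in>S. \<exists>f'. (f has_derivative f') (at Z) \<and>
     (\<forall>c V. f' (\<chi> i j. c * V $ i $ j) = c * f' V))"

text \<open>Functions on the domain are represented by total functions vanishing outside it, so that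
  equality in the Bergman space is equality of HOL functions.\<close>

definition bergman_space :: "real \<Rightarrow> (complex^'n^'n \<Rightarrow> complex) set" where
  "bergman_space \<nu> = {f \<in> L2_space \<nu>. matrix_holomorphic_on f cartan_domain \<and>
     (\<forall>Z. Z \<notin> cartan_domain \<longrightarrow> f Z = 0)}"

definition bergman_projection ::
    "real \<Rightarrow> (complex^'n^'n \<Rightarrow> complex) \<Rightarrow> (complex^'n^'n \<Rightarrow> complex)" where
  "bergman_projection \<nu> f = (THE h. h \<in> bergman_space \<nu> \<and>
     (\<forall>g\<in>bergman_space \<nu>. L2_inner \<nu> (\<lambda>Z. f Z - h Z) g = 0))"


section \<open>Bounded operators on the Bergman space\<close>

type_synonym 'n bergman_op = "(complex^'n^'n \<Rightarrow> complex) \<Rightarrow> (complex^'n^'n \<Rightarrow> complex)"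

text \<open>Operators are extensional functions on the Bergman space, so that equality of operators is
  equality of HOL functions.\<close>

definition bounded_ops :: "real \<Rightarrow> 'n::finite bergman_op set" where
  "bounded_ops \<nu> = {T \<in> bergman_space \<nu> \<rightarrow>\<^sub>E bergman_space \<nu>.
     (\<forall>f\<in>bergman_space \<nu>. \<forall>g\<in>bergman_space \<nu>. T (\<lambda>Z. f Z + g Z) = (\<lambda>Z. T f Z + T g Z)) \<and>
     (\<forall>c. \<forall>f\<in>bergman_space \<nu>. T (\<lambda>Z. c * f Z) = (\<lambda>Z. c * T f Z)) \<and>
     (\<exists>K. \<forall>f\<in>bergman_space \<nu>. L2_norm \<nu> (T f) \<le> K * L2_norm \<nu> f)}"

definition op_id :: "real \<Rightarrow> 'n::finite bergman_op" where
  "op_id \<nu> = (\<lambda>f\<in>bergman_space \<nu>. f)"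

definition op_add :: "real \<Rightarrow> 'n::finite bergman_op \<Rightarrow> 'n bergman_op \<Rightarrow> 'n bergman_op" where
  "op_add \<nu> S T = (\<lambda>f\<in>bergman_space \<nu>. \<lambda>Z. S f Z + T f Z)"

definition op_scale :: "real \<Rightarrow> complex \<Rightarrow> 'n::finite bergman_op \<Rightarrow> 'n bergman_op" where
  "op_scale \<nu> c T = (\<lambda>f\<in>bergman_space \<nu>. \<lambda>Z. c * T f Z)"

definition op_norm :: "real \<Rightarrow> 'n::finite bergman_op \<Rightarrow> real" where
  "op_norm \<nu> T = (SUP f\<in>{f \<in> bergman_space \<nu>. L2_norm \<nu> f \<le> 1}. L2_norm \<nu> (T f))"

definition is_adjoint :: "real \<Rightarrow> 'n::finite bergman_op \<Rightarrow> 'n bergman_op \<Rightarrow> bool" where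
  "is_adjoint \<nu> T S \<longleftrightarrow>
     (\<forall>f\<in>bergman_space \<nu>. \<forall>g\<in>bergman_space \<nu>. L2_inner \<nu> (T f) g = L2_inner \<nu> f (S g))"

definition toeplitz :: "real \<Rightarrow> (complex^'n^'n \<Rightarrow> complex) \<Rightarrow> 'n::finite bergman_op" where
  "toeplitz \<nu> a = (\<lambda>f\<in>bergman_space \<nu>. bergman_projection \<nu> (\<lambda>Z. a Z * f Z))"


section \<open>Generated operator algebras\<close>

definition unital_subalgebra :: "real \<Rightarrow> 'n::finite bergman_op set \<Rightarrow> bool" where
  "unital_subalgebra \<nu> \<A> \<longleftrightarrow> \<A> \<subseteq> bounded_ops \<nu> \<and> op_id \<nu> \<in> \<A> \<and>
     (\<forall>S\<in>\<A>. \<forall>T\<in>\<A>. op_add \<nu> S T \<in> \<A> \<and> compose (bergman_space \<nu>) S T \<in> \<A>) \<and>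
     (\<forall>c. \<forall>T\<in>\<A>. op_scale \<nu> c T \<in> \<A>)"

definition norm_closed :: "real \<Rightarrow> 'n::finite bergman_op set \<Rightarrow> bool" where
  "norm_closed \<nu> \<A> \<longleftrightarrow> (\<forall>X T. (\<forall>k::nat. X k \<in> \<A>) \<and> T \<in> bounded_ops \<nu> \<and>
     (\<lambda>k. op_norm \<nu> (op_add \<nu> (X k) (op_scale \<nu> (-1) T))) \<longlonglongrightarrow> 0 \<longrightarrow> T \<in> \<A>)"

definition adjoint_closed :: "real \<Rightarrow> 'n::finite bergman_op set \<Rightarrow> bool" where
  "adjoint_closed \<nu> \<A> \<longleftrightarrow>
     (\<forall>T\<in>\<A>. \<forall>S\<in>bounded_ops \<nu>. is_adjoint \<nu> T S \<longrightarrow> S \<in> \<A>)"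

definition commutative :: "real \<Rightarrow> 'n::finite bergman_op set \<Rightarrow> bool" where
  "commutative \<nu> \<A> \<longleftrightarrow>
     (\<forall>S\<in>\<A>. \<forall>T\<in>\<A>. compose (bergman_space \<nu>) S T = compose (bergman_space \<nu>) T S)"

definition banach_algebra_generated ::
    "real \<Rightarrow> 'n::finite bergman_op set \<Rightarrow> 'n bergman_op set" where
  "banach_algebra_generated \<nu> G = (\<lambda>\<A>. unital_subalgebra \<nu> \<A> \<and> norm_closed \<nu> \<A>) hull G"

definition cstar_algebra_generated ::
    "real \<Rightarrow> 'n::finite bergman_op set \<Rightarrow> 'n bergman_op set" where
  "cstar_algebra_generated \<nu> G =
     (\<lambda>\<A>. unital_subalgebra \<nu> \<A> \<and> norm_closed \<nu> \<A> \<and> adjoint_closed \<nu> \<A>) hull G"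

end

theory Submission
  imports Defs "HOL-Complex_Analysis.Cauchy_Integral_Formula"
begin

text \<open>
  Write \<open>T\<close> for the Toeplitz operator with symbol \<open>a\<close>. The unital Banach algebra generated by a single
  operator is always commutative, and the adjoint of \<open>T\<close> is the Toeplitz operator with symbol the
  conjugate of \<open>a\<close>. Both claims about \<open>a\<close> therefore reduce to finding a bounded symbol of the required
  form for which \<open>T\<close> is not normal (\<open>nonnormal_generates\<close>).

  For the first part take distinct indices \<open>p\<close>, \<open>q\<close> and let \<open>a(Z)\<close> be the \<open>(p,q)\<close> entry of
  \<open>Z\<^sup>* Z\<close>. Multiplying column \<open>q\<close> of \<open>Z\<close> by a phase \<open>w\<close> preserves the domain and its measure, fixes the
  coordinates \<open>f\<^sub>i(Z) = Z\<^sub>i\<^sub>p\<close>, and multiplies \<open>a\<close> by \<open>w\<close>. Thus \<open>cnj a * f\<^sub>i\<close> has weight \<open>-1\<close> under this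
  circle action. Holomorphic functions only contain nonnegative weights, because column \<open>q\<close> may also be
  multiplied by every \<open>w\<close> in the closed disc; hence the adjoint of \<open>T\<close> kills every \<open>f\<^sub>i\<close>
  (\<open>phase_action_orthogonal\<close>). On the other hand \<open>\<Sum>\<^sub>i \<langle>T f\<^sub>i, Z\<^sub>i\<^sub>q\<rangle>\<close> is the integral of \<open>|a|\<^sup>2\<close>, which is
  positive, so some \<open>T f\<^sub>i\<close> is nonzero and the two products of \<open>T\<close> with its adjoint differ at this \<open>f\<^sub>i\<close>
  (\<open>phase_symbol_nonnormal\<close>). The second part is the same argument with rows in place of columns. Since
  \<open>a\<close> is an entry of \<open>Z\<^sup>* Z\<close>, it has the same value at \<open>Z\<close> and at the positive square root of \<open>Z\<^sup>* Z\<close>.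

  Three analytic facts underlie this. The normalising constant exists because \<open>det (1 - Z Z\<^sup>*)\<close> to a power
  \<open>s > -1\<close> is integrable over the domain (\<open>weight_integral_finite\<close>); this is shown one row at a time,
  as the determinant is affine in \<open>t\<^sup>2\<close> when a single row is scaled by \<open>t\<close>. The square root of a
  positive semidefinite matrix exists and is unique (\<open>psd_sqrt_gram\<close>), by a monotone iteration that
  needs no eigenvalues. The Bergman projection exists (\<open>projection_exists\<close>), because point evaluations
  are locally bounded by the norm: a minimising sequence then converges locally uniformly, its limit is
  holomorphic, and Fatou's lemma shows that the limit is square integrable and attains the distance.
\<close>

section \<open>Linear maps and Lebesgue measure\<close>

lemma nn_integral_lborel_translate:
  fixes g :: "'a::euclidean_space \<Rightarrow> ennreal"
  assumes [measurable]: "g \<in> borel_measurable borel"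
  shows "(\<integral>\<^sup>+x. g (c + x) \<partial>lborel) = (\<integral>\<^sup>+x. g x \<partial>lborel)"
proof -
  have "(\<integral>\<^sup>+x. g x \<partial>lborel) = (\<integral>\<^sup>+x. g x \<partial>distr lborel borel ((+) c))"
    by (simp add: lborel_distr_plus)
  also have "\<dots> = (\<integral>\<^sup>+x. g (c + x) \<partial>lborel)"
    by (subst nn_integral_distr) auto
  finally show ?thesis by simp
qed

text \<open>
  The uniqueness argument for Haar measure: integrate \<open>1\<^sub>A(x) * g (T y + x)\<close> in both orders and use
  translation invariance in the inner integral. With the unit ball for \<open>A\<close> it compares the integrals of
  \<open>g\<close> and \<open>g \<circ> T\<close> on every Euclidean space without determinants.
\<close>

lemma nn_integral_lborel_linear_swap:
  fixes g :: "'a::euclidean_space \<Rightarrow> ennreal" and T :: "'a \<Rightarrow> 'a"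
  assumes g[measurable]: "g \<in> borel_measurable borel" and A[measurable]: "A \<in> sets borel"
    and T: "linear T" "bij T"
  shows "emeasure lborel A * (\<integral>\<^sup>+y. g (T y) \<partial>lborel)
       = emeasure lborel {y. - T y \<in> A} * (\<integral>\<^sup>+x. g x \<partial>lborel)"
proof -
  have cont: "continuous_on UNIV T"
    using T(1) by (rule linear_continuous_on_compose[OF continuous_on_id])
  have [measurable]: "T \<in> borel_measurable borel"
    using cont by (rule borel_measurable_continuous_onI)
  have surj: "\<exists>z. T z = x" for x
    using T(2) by (metis bij_pointE)
  have add: "T (x + y) = T x + T y" for x y
    using T(1) by (rule linear_add)
  have inner1: "(\<integral>\<^sup>+y. indicator A x * g (T y + x) \<partial>lborel) = indicator A x * (\<integral>\<^sup>+y. g (T y) \<partial>lborel)" for x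
  proof -
    obtain z where z: "T z = x" using surj by blast
    have "(\<integral>\<^sup>+y. g (T y + x) \<partial>lborel) = (\<integral>\<^sup>+y. g (T (z + y)) \<partial>lborel)"
      by (simp add: add z add.commute)
    also have "\<dots> = (\<integral>\<^sup>+y. g (T y) \<partial>lborel)"
      by (rule nn_integral_lborel_translate[where g="\<lambda>y. g (T y)"]) measurable
    finally show ?thesis by (simp add: nn_integral_cmult)
  qed
  have inner2: "(\<integral>\<^sup>+x. indicator A x * g (T y + x) \<partial>lborel) = (\<integral>\<^sup>+x. indicator A (x - T y) * g x \<partial>lborel)" for y
    using nn_integral_lborel_translate[where c="T y" and g="\<lambda>x. indicator A (x - T y) * g x"] by simp
  have inner3: "(\<integral>\<^sup>+y. indicator A (x - T y) * g x \<partial>lborel) = emeasure lborel {y. - T y \<in> A} * g x" for x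
  proof -
    obtain z where z: "T z = x" using surj by blast
    have neg: "T (- z) = - x"
      using z T(1) by (simp add: linear_neg)
    have "(\<integral>\<^sup>+y. indicator A (x - T y) \<partial>lborel) = (\<integral>\<^sup>+y. indicator {y. - T y \<in> A} (- z + y) \<partial>lborel)"
      by (intro nn_integral_cong) (simp only: indicator_def add neg mem_Collect_eq, simp)
    also have "\<dots> = (\<integral>\<^sup>+y. indicator {y. - T y \<in> A} y \<partial>lborel)"
      by (rule nn_integral_lborel_translate) measurable
    also have "\<dots> = emeasure lborel {y. - T y \<in> A}"
      by (rule nn_integral_indicator) simp
    finally show ?thesis by (simp add: nn_integral_multc)
  qed
  have "emeasure lborel A * (\<integral>\<^sup>+y. g (T y) \<partial>lborel)
      = (\<integral>\<^sup>+x. \<integral>\<^sup>+y. indicator A x * g (T y + x) \<partial>lborel \<partial>lborel)"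
    by (simp add: inner1 nn_integral_multc)
  also have "\<dots> = (\<integral>\<^sup>+y. \<integral>\<^sup>+x. indicator A x * g (T y + x) \<partial>lborel \<partial>lborel)"
    by (rule lborel_pair.Fubini'[symmetric]) measurable
  also have "\<dots> = (\<integral>\<^sup>+y. \<integral>\<^sup>+x. indicator A (x - T y) * g x \<partial>lborel \<partial>lborel)"
    by (simp add: inner2)
  also have "\<dots> = (\<integral>\<^sup>+x. \<integral>\<^sup>+y. indicator A (x - T y) * g x \<partial>lborel \<partial>lborel)"
    by (rule lborel_pair.Fubini') measurable
  also have "\<dots> = emeasure lborel {y. - T y \<in> A} * (\<integral>\<^sup>+x. g x \<partial>lborel)"
    by (simp add: inner3 nn_integral_cmult)
  finally show ?thesis .
qed

text \<open>The preimage of the unit ball under a contraction contains the unit ball.\<close>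

lemma nn_integral_lborel_contraction:
  fixes g :: "'a::euclidean_space \<Rightarrow> ennreal" and T :: "'a \<Rightarrow> 'a"
  assumes g: "g \<in> borel_measurable borel"
    and T: "linear T" "bij T" and contr: "\<And>x. norm (T x) \<le> norm x"
  shows "(\<integral>\<^sup>+x. g x \<partial>lborel) \<le> (\<integral>\<^sup>+x. g (T x) \<partial>lborel)"
proof -
  let ?B = "ball (0::'a) 1"
  have eq: "emeasure lborel ?B * (\<integral>\<^sup>+y. g (T y) \<partial>lborel)
       = emeasure lborel {y. - T y \<in> ?B} * (\<integral>\<^sup>+x. g x \<partial>lborel)"
    by (rule nn_integral_lborel_linear_swap[OF g _ T]) auto
  have cont: "continuous_on UNIV T"
    using T(1) by (rule linear_continuous_on_compose[OF continuous_on_id])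
  have "open {y. - T y \<in> ?B}"
    using open_vimage[OF open_ball[of 0 1] continuous_on_minus[OF cont]] by (simp add: vimage_def)
  then have le: "emeasure lborel ?B \<le> emeasure lborel {y. - T y \<in> ?B}"
    by (intro emeasure_mono) (auto intro: le_less_trans[OF contr])
  have fin: "emeasure lborel ?B < \<infinity>" by (rule emeasure_lborel_ball_finite)
  have pos: "emeasure lborel ?B \<noteq> 0" by (simp add: emeasure_ball less_imp_neq[OF unit_ball_vol_pos, symmetric])
  have "emeasure lborel ?B * (\<integral>\<^sup>+x. g x \<partial>lborel) \<le> emeasure lborel ?B * (\<integral>\<^sup>+y. g (T y) \<partial>lborel)"
    unfolding eq using le by (rule mult_right_mono) simp
  then show ?thesis
    using fin pos by (simp add: ennreal_mult_le_mult_iff)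
qed

lemma nn_integral_lborel_isometry:
  fixes g :: "'a::euclidean_space \<Rightarrow> ennreal" and T :: "'a \<Rightarrow> 'a"
  assumes g[measurable]: "g \<in> borel_measurable borel" and T: "orthogonal_transformation T"
  shows "(\<integral>\<^sup>+x. g (T x) \<partial>lborel) = (\<integral>\<^sup>+x. g x \<partial>lborel)"
proof (rule antisym)
  have le: "(\<integral>\<^sup>+x. f x \<partial>lborel) \<le> (\<integral>\<^sup>+x. f (S x) \<partial>lborel)"
    if "f \<in> borel_measurable borel" "orthogonal_transformation S" for f and S :: "'a \<Rightarrow> 'a"
    using that by (intro nn_integral_lborel_contraction)
      (auto simp: orthogonal_transformation_norm orthogonal_transformation_bij orthogonal_transformation_linear)
  show "(\<integral>\<^sup>+x. g x \<partial>lborel) \<le> (\<integral>\<^sup>+x. g (T x) \<partial>lborel)"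
    using assms by (rule le)
  have "continuous_on UNIV T"
    using T by (intro linear_continuous_on_compose[OF continuous_on_id] orthogonal_transformation_linear)
  then have [measurable]: "T \<in> borel_measurable borel"
    by (rule borel_measurable_continuous_onI)
  have TT: "T (inv T x) = x" for x
    using T by (simp add: orthogonal_transformation_surj surj_f_inv_f)
  have "(\<integral>\<^sup>+x. g (T x) \<partial>lborel) \<le> (\<integral>\<^sup>+x. g (T (inv T x)) \<partial>lborel)"
    by (rule le[where f="\<lambda>x. g (T x)", OF _ orthogonal_transformation_inv[OF T]]) measurable
  then show "(\<integral>\<^sup>+x. g (T x) \<partial>lborel) \<le> (\<integral>\<^sup>+x. g x \<partial>lborel)" by (simp add: TT)
qed

lemma distr_lborel_isometry:
  fixes T :: "'a::euclidean_space \<Rightarrow> 'a"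
  assumes T: "orthogonal_transformation T"
  shows "distr lborel borel T = lborel"
proof (rule measure_eqI)
  fix A assume "A \<in> sets (distr lborel borel T)"
  then have A[measurable]: "A \<in> sets borel" by simp
  have "continuous_on UNIV T"
    using T by (intro linear_continuous_on_compose[OF continuous_on_id] orthogonal_transformation_linear)
  then have [measurable]: "T \<in> borel_measurable borel"
    by (rule borel_measurable_continuous_onI)
  have "emeasure (distr lborel borel T) A = (\<integral>\<^sup>+x. indicator A x \<partial>distr lborel borel T)"
    by simp
  also have "\<dots> = (\<integral>\<^sup>+x. indicator A (T x) \<partial>lborel)"
    by (rule nn_integral_distr) auto
  also have "\<dots> = (\<integral>\<^sup>+x. indicator A x \<partial>lborel)"
    by (rule nn_integral_lborel_isometry[OF _ assms]) auto
  finally show "emeasure (distr lborel borel T) A = emeasure lborel A" by simp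
qed simp

text \<open>
  A function and its average over the orbits of a circle of isometries have the same integral. This is
  the source of both the mean value property on balls and the orthogonality of different weights.
\<close>

lemma circle_average_integral:
  fixes F G :: "'a::euclidean_space \<Rightarrow> complex" and R :: "real \<Rightarrow> 'a \<Rightarrow> 'a"
  assumes F: "integrable lborel F"
    and R: "\<And>t. orthogonal_transformation (R t)"
    and cont: "continuous_on UNIV (\<lambda>(t, x). R t x)"
    and G: "G \<in> borel_measurable borel"
    and avg: "\<And>x. ((\<lambda>t. F (R t x)) has_integral G x) {0..1}"
  shows "(\<integral>x. G x \<partial>lborel) = (\<integral>x. F x \<partial>lborel)"
proof -
  define I where "I = {0..1::real}"
  define H where "H = (\<lambda>t x. indicator I t *\<^sub>R F (R t x))"
  have I[measurable]: "I \<in> sets borel" by (simp add: I_def)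
  have Fm[measurable]: "F \<in> borel_measurable borel"
    using F by (auto dest: borel_measurable_integrable)
  have "(\<lambda>(t, x). R t x) \<in> borel_measurable borel"
    using cont by (rule borel_measurable_continuous_onI)
  then have Rm: "(\<lambda>(t, x). R t x) \<in> borel_measurable (borel \<Otimes>\<^sub>M borel)"
    by (simp add: borel_prod)
  then have Rm'[measurable]: "(\<lambda>p. R (fst p) (snd p)) \<in> borel_measurable (borel \<Otimes>\<^sub>M borel)"
    by (simp add: split_beta')
  have Rt[measurable]: "R t \<in> borel_measurable borel" for t
  proof -
    have "(\<lambda>x. R (fst (t, x)) (snd (t, x))) \<in> borel_measurable borel"
      by measurable
    then show ?thesis by simp
  qed
  have Hm: "case_prod H \<in> borel_measurable (lborel \<Otimes>\<^sub>M lborel)"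
    unfolding H_def split_beta' by measurable
  have intR: "integrable lborel (\<lambda>x. f (R t x))" "(\<integral>x. f (R t x) \<partial>lborel) = (\<integral>x. f x \<partial>lborel)"
    if f: "integrable lborel f" for f :: "'a \<Rightarrow> 'b::{banach, second_countable_topology}" and t
  proof -
    have [measurable]: "f \<in> borel_measurable borel"
      using f by (auto dest: borel_measurable_integrable)
    have "integrable (distr lborel borel (R t)) f"
      using f by (simp add: distr_lborel_isometry[OF R])
    then show "integrable lborel (\<lambda>x. f (R t x))"
      by (subst (asm) integrable_distr_eq) auto
    have "(\<integral>x. f x \<partial>lborel) = (\<integral>x. f x \<partial>distr lborel borel (R t))"
      by (simp add: distr_lborel_isometry[OF R])
    also have "\<dots> = (\<integral>x. f (R t x) \<partial>lborel)"
      by (rule integral_distr) auto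
    finally show "(\<integral>x. f (R t x) \<partial>lborel) = (\<integral>x. f x \<partial>lborel)" by simp
  qed
  have Iint: "integrable lborel (indicator I :: real \<Rightarrow> real)"
    unfolding I_def by simp
  have Imeas: "(\<integral>t. indicator I t \<partial>lborel) = (1 :: real)"
    unfolding I_def by simp
  have "integrable (lborel \<Otimes>\<^sub>M lborel) (case_prod H)"
  proof (rule lborel_pair.Fubini_integrable[OF Hm])
    have "(\<lambda>t. \<integral>x. norm (case_prod H (t, x)) \<partial>lborel) = (\<lambda>t. indicator I t * (\<integral>x. norm (F x) \<partial>lborel))"
      using intR(2)[OF integrable_norm[OF F]] by (simp add: H_def fun_eq_iff)
    with Iint show "integrable lborel (\<lambda>t. \<integral>x. norm (case_prod H (t, x)) \<partial>lborel)"
      by simp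
    show "AE t in lborel. integrable lborel (\<lambda>x. case_prod H (t, x))"
      using intR(1)[OF F] by (simp add: H_def)
  qed
  note Hint = this
  have "(\<integral>x. F x \<partial>lborel) = (\<integral>t. \<integral>x. H t x \<partial>lborel \<partial>lborel)"
    using Imeas by (simp add: H_def intR[OF F] Iint)
  also have "\<dots> = (\<integral>x. \<integral>t. H t x \<partial>lborel \<partial>lborel)"
    by (simp add: lborel_pair.integral_fst[OF Hint] lborel_pair.integral_snd[OF Hint])
  also have "\<dots> = (\<integral>x. G x \<partial>lborel)"
  proof (rule integral_cong_AE)
    show "(\<lambda>x. \<integral>t. H t x \<partial>lborel) \<in> borel_measurable lborel"
      using lborel_pair.integrable_snd[OF Hint] by (rule borel_measurable_integrable)
    show "AE x in lborel. (\<integral>t. H t x \<partial>lborel) = G x"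
      using lborel_pair.AE_integrable_snd[OF Hint]
    proof eventually_elim
      case (elim x)
      then have "((\<lambda>t. H t x) has_integral (\<integral>t. H t x \<partial>lborel)) UNIV"
        by (rule has_integral_integral_lborel)
      moreover have "((\<lambda>t. H t x) has_integral (G x)) UNIV"
        using avg[of x] has_integral_restrict_UNIV[of I "\<lambda>t. F (R t x)" "G x"]
        by (simp add: H_def I_def indicator_def of_bool_def if_distrib[of "\<lambda>u. u *\<^sub>R _"] cong: if_cong)
      ultimately show ?case by (rule has_integral_unique)
    qed
    show "(\<lambda>x. G x) \<in> borel_measurable lborel" using G by simp
  qed
  finally show ?thesis by simp
qed

section \<open>The Cartan domain and its determinant weight\<close>

definition cinner :: "complex^'n \<Rightarrow> complex^'n \<Rightarrow> complex" where
  "cinner x y = (\<Sum>i\<in>UNIV. cnj (x $ i) * y $ i)"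

lemma quad_form_cinner: "quad_form A v = cinner v (A *v v)"
  by (simp add: quad_form_def cinner_def)

lemma cinner_self: "cinner x x = complex_of_real ((norm x)\<^sup>2)"
proof -
  have "(norm x)\<^sup>2 = (\<Sum>i\<in>UNIV. (norm (x $ i))\<^sup>2)"
    by (simp add: norm_vec_def L2_set_def sum_nonneg)
  then show ?thesis
    by (simp add: cinner_def complex_norm_square mult.commute flip: of_real_power)
qed

lemma cinner_diff_right: "cinner x (y - z) = cinner x y - cinner x z"
  by (simp add: cinner_def algebra_simps sum_subtractf)

lemma cinner_matrix_left: "cinner (A *v x) y = cinner x (conj_transpose A *v y)"
  unfolding cinner_def matrix_vector_mult_def conj_transpose_def
  by (simp add: sum_distrib_left sum_distrib_right) (subst sum.swap, simp add: mult_ac)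

lemma conj_transpose_conj_transpose [simp]: "conj_transpose (conj_transpose A) = A"
  by (simp add: conj_transpose_def vec_eq_iff)

lemma conj_transpose_mult: "conj_transpose (A ** B) = conj_transpose B ** conj_transpose A"
  by (simp add: conj_transpose_def matrix_matrix_mult_def vec_eq_iff mult.commute)

lemma conj_transpose_diff: "conj_transpose (A - B) = conj_transpose A - conj_transpose B"
  by (simp add: conj_transpose_def vec_eq_iff)

lemma conj_transpose_mat_1 [simp]: "conj_transpose (mat 1) = mat 1"
  by (auto simp: conj_transpose_def vec_eq_iff mat_def)

lemma cartan_domain_iff:
  "Z \<in> cartan_domain \<longleftrightarrow> (\<forall>v. v \<noteq> 0 \<longrightarrow> norm (Z *v v) < norm v)"
proof -
  have "quad_form (mat 1 - conj_transpose Z ** Z) v = complex_of_real ((norm v)\<^sup>2 - (norm (Z *v v))\<^sup>2)" for v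
    by (simp add: quad_form_cinner matrix_vector_mult_diff_rdistrib cinner_diff_right cinner_self
        cinner_matrix_left[symmetric] matrix_vector_mul_assoc[symmetric])
  moreover have "conj_transpose (mat 1 - conj_transpose Z ** Z) = mat 1 - conj_transpose Z ** Z"
    by (simp add: conj_transpose_diff conj_transpose_mult)
  moreover have "(norm (Z *v v))\<^sup>2 < (norm v)\<^sup>2 \<longleftrightarrow> norm (Z *v v) < norm v" for v
    by (metis norm_ge_zero power2_less_imp_less power_strict_mono pos2)
  ultimately show ?thesis
    by (simp add: cartan_domain_def pos_def_def)
qed

lemma norm_matrix_vector_le:
  fixes A :: "complex^'n^'m"
  shows "norm (A *v x) \<le> norm A * norm x"
proof -
  have comp: "norm ((A *v x) $ i) \<le> norm (A $ i) * norm x" for i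
  proof -
    have "norm ((A *v x) $ i) \<le> (\<Sum>j\<in>UNIV. \<bar>norm (A $ i $ j)\<bar> * \<bar>norm (x $ j)\<bar>)"
      unfolding matrix_vector_mult_def
      by (simp add: norm_mult order_trans[OF norm_sum])
    also have "\<dots> \<le> norm (A $ i) * norm x"
      unfolding norm_vec_def by (rule L2_set_mult_ineq)
    finally show ?thesis .
  qed
  have "norm (A *v x) \<le> L2_set (\<lambda>i. norm (A $ i) * norm x) UNIV"
    unfolding norm_vec_def[of "A *v x"] by (rule L2_set_mono) (use comp in auto)
  also have "\<dots> = norm A * norm x"
    by (simp add: L2_set_left_distrib norm_vec_def[of A])
  finally show ?thesis .
qed

lemma norm_axis_one: "norm (axis j 1 :: complex^'n) = 1"
proof -
  have "L2_set (\<lambda>i. norm (axis j 1 $ i :: complex)) UNIV = L2_set (\<lambda>i. if i = j then 1 else 0) UNIV"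
    by (intro L2_set_cong) (auto simp: axis_def)
  also have "\<dots> = sqrt (\<Sum>i\<in>UNIV. if i = j then 1 else 0)"
    unfolding L2_set_def by (intro arg_cong[where f=sqrt] sum.cong) auto
  finally show ?thesis by (simp add: norm_vec_def)
qed

text \<open>Compactness of the unit sphere turns the pointwise strict inequality into a uniform one.\<close>

lemma cartan_domain_gap:
  assumes "Z \<in> cartan_domain"
  obtains r where "0 \<le> r" "r < 1" "\<And>v. norm (Z *v v) \<le> r * norm v"
proof -
  let ?S = "sphere (0::complex^'n) 1"
  have ne: "axis undefined 1 \<in> ?S" by (simp add: norm_axis_one)
  have "continuous_on ?S (\<lambda>v. norm (Z *v v))"
    by (intro continuous_on_norm linear_continuous_on matrix_vector_mul_bounded_linear)
  then obtain v where v: "v \<in> ?S" "\<And>u. u \<in> ?S \<Longrightarrow> norm (Z *v u) \<le> norm (Z *v v)"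
    using continuous_attains_sup[of ?S "\<lambda>v. norm (Z *v v)"] ne by (auto simp: compact_sphere)
  have "norm (Z *v u) \<le> norm (Z *v v) * norm u" for u
  proof (cases "u = 0")
    case False
    have "norm (Z *v (u /\<^sub>R norm u)) \<le> norm (Z *v v)"
      using False by (intro v(2)) auto
    moreover have "Z *v (u /\<^sub>R norm u) = (Z *v u) /\<^sub>R norm u"
      by (rule linear_cmul[OF matrix_vector_mul_linear])
    ultimately show ?thesis using False by (simp add: field_simps)
  qed simp
  moreover have "norm (Z *v v) < 1"
    using assms v(1) unfolding cartan_domain_iff by (metis mem_sphere_0 norm_zero zero_neq_one)
  ultimately show ?thesis by (intro that[of "norm (Z *v v)"]) auto
qed

lemma open_cartan_domain: "open (cartan_domain :: (complex^'n^'n) set)"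
  unfolding open_contains_ball
proof
  fix Z :: "complex^'n^'n" assume "Z \<in> cartan_domain"
  then obtain r where r: "0 \<le> r" "r < 1" "\<And>v. norm (Z *v v) \<le> r * norm v"
    by (rule cartan_domain_gap) blast
  have "W \<in> cartan_domain" if "W \<in> ball Z (1 - r)" for W
    unfolding cartan_domain_iff
  proof (intro allI impI)
    fix v :: "complex^'n" assume "v \<noteq> 0"
    have "norm (W *v v) \<le> norm (Z *v v) + norm ((W - Z) *v v)"
      by (metis add.commute diff_add_cancel matrix_vector_mult_add_rdistrib norm_triangle_ineq)
    also have "\<dots> \<le> r * norm v + norm (W - Z) * norm v"
      by (intro add_mono r norm_matrix_vector_le)
    also have "\<dots> < norm v"
      using that \<open>v \<noteq> 0\<close> by (simp add: dist_norm norm_minus_commute flip: distrib_right)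
    finally show "norm (W *v v) < norm v" .
  qed
  then show "\<exists>e>0. ball Z e \<subseteq> cartan_domain"
    using r(2) by (intro exI[of _ "1 - r"]) auto
qed

lemma cartan_domain_entry:
  fixes Z :: "complex^'n^'n"
  assumes "Z \<in> cartan_domain"
  shows "norm (Z $ i $ j) < 1"
proof -
  let ?e = "axis j 1 :: complex^'n"
  have "?e \<noteq> 0" by (simp add: axis_eq_0_iff)
  then have "norm (Z *v ?e) < norm ?e"
    using assms unfolding cartan_domain_iff by blast
  moreover have "norm ?e = 1" by (rule norm_axis_one)
  moreover have "norm (Z $ i $ j) \<le> norm (Z *v ?e)"
  proof -
    have "(Z *v ?e) $ i = (\<Sum>k\<in>UNIV. if k = j then Z $ i $ k else 0)"
      by (simp add: matrix_vector_mult_def axis_def if_distrib[of "\<lambda>x::complex. _ * x"] cong: if_cong)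
    then have "(Z *v ?e) $ i = Z $ i $ j" by (simp only: sum.delta finite UNIV_I if_True)
    then show ?thesis using Finite_Cartesian_Product.norm_nth_le[of "Z *v ?e" i] by metis
  qed
  ultimately show ?thesis by linarith
qed

definition row_scale :: "('n \<Rightarrow> complex) \<Rightarrow> complex^'n^'n \<Rightarrow> complex^'n^'n" where
  "row_scale u Z = (\<chi> k l. u k * Z $ k $ l)"

definition col_scale :: "('n \<Rightarrow> complex) \<Rightarrow> complex^'n^'n \<Rightarrow> complex^'n^'n" where
  "col_scale u Z = (\<chi> k l. u l * Z $ k $ l)"

lemma norm_vec_scale_le:
  fixes v :: "complex^'n"
  assumes "\<And>k. norm (u k) \<le> 1"
  shows "norm (\<chi> k. u k * v $ k) \<le> norm v"
  unfolding norm_vec_def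
  by (rule L2_set_mono) (use assms in \<open>auto simp: norm_mult mult_left_le_one_le\<close>)

lemma row_scale_cartan_domain:
  assumes "Z \<in> cartan_domain" "\<And>k. norm (u k) \<le> 1"
  shows "row_scale u Z \<in> cartan_domain"
proof -
  have "row_scale u Z *v v = (\<chi> k. u k * (Z *v v) $ k)" for v
    by (simp add: row_scale_def matrix_vector_mult_def vec_eq_iff sum_distrib_left mult.assoc)
  then show ?thesis
    using assms(1) le_less_trans[OF norm_vec_scale_le[of u, OF assms(2)]] by (auto simp: cartan_domain_iff)
qed

lemma col_scale_cartan_domain:
  fixes Z :: "complex^'n^'n"
  assumes "Z \<in> cartan_domain" "\<And>k. norm (u k) \<le> 1"
  shows "col_scale u Z \<in> cartan_domain"
  unfolding cartan_domain_iff
proof (intro allI impI)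
  fix v :: "complex^'n" assume v: "v \<noteq> 0"
  let ?w = "\<chi> l. u l * v $ l"
  have eq: "col_scale u Z *v v = Z *v ?w"
    by (simp add: col_scale_def matrix_vector_mult_def vec_eq_iff mult_ac)
  have le: "norm ?w \<le> norm v" using assms(2) by (rule norm_vec_scale_le)
  show "norm (col_scale u Z *v v) < norm v"
  proof (cases "?w = 0")
    case False
    then have "norm (Z *v ?w) < norm ?w" using assms(1) by (auto simp: cartan_domain_iff)
    with le show ?thesis by (simp add: eq)
  qed (use v eq in simp)
qed

lemma zero_in_cartan_domain: "0 \<in> cartan_domain"
  by (simp add: cartan_domain_iff)

lemma norm_row_scale:
  assumes "\<And>k. norm (u k) = 1" shows "norm (row_scale u Z) = norm Z"
  unfolding norm_vec_def row_scale_def by (simp add: norm_mult assms)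

lemma norm_col_scale:
  assumes "\<And>k. norm (u k) = 1" shows "norm (col_scale u Z) = norm Z"
  unfolding norm_vec_def col_scale_def by (simp add: norm_mult assms)

lemma linear_row_scale: "linear (row_scale u)"
  by (rule linearI) (simp_all add: row_scale_def vec_eq_iff algebra_simps)

lemma linear_col_scale: "linear (col_scale u)"
  by (rule linearI) (simp_all add: col_scale_def vec_eq_iff algebra_simps)

lemma orthogonal_row_scale:
  "(\<And>k. norm (u k) = 1) \<Longrightarrow> orthogonal_transformation (row_scale u)"
  by (simp add: orthogonal_transformation linear_row_scale norm_row_scale)

lemma orthogonal_col_scale:
  "(\<And>k. norm (u k) = 1) \<Longrightarrow> orthogonal_transformation (col_scale u)"
  by (simp add: orthogonal_transformation linear_col_scale norm_col_scale)

definition weight :: "complex^'n^'n \<Rightarrow> real" where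
  "weight Z = Re (det (mat 1 - Z ** conj_transpose Z))"

lemma continuous_weight: "continuous_on UNIV weight"
  unfolding weight_def det_def matrix_matrix_mult_def conj_transpose_def mat_def
  by (intro continuous_intros)

lemma det_conj_transpose: "det (conj_transpose A) = cnj (det A)"
proof -
  have "det (conj_transpose A) = det (transpose (\<chi> i j. cnj (A $ i $ j)))"
    by (simp add: conj_transpose_def transpose_def)
  also have "\<dots> = det (\<chi> i j. cnj (A $ i $ j))" by (rule det_transpose)
  also have "\<dots> = cnj (det A)" by (simp add: det_def)
  finally show ?thesis .
qed

text \<open>
  If \<open>v = Z Z\<^sup>* v\<close> with \<open>v \<noteq> 0\<close>, then \<open>w = Z\<^sup>* v\<close> satisfies \<open>|w|\<^sup>2 = \<langle>v, Z Z\<^sup>* v\<rangle> = |v|\<^sup>2\<close>, whereas \<open>v = Z w\<close> must be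
  shorter than \<open>w\<close>.
\<close>

lemma det_ne_0_cartan_domain:
  assumes "Z \<in> cartan_domain"
  shows "det (mat 1 - Z ** conj_transpose Z) \<noteq> 0"
proof -
  have "v = 0" if "(mat 1 - Z ** conj_transpose Z) *v v = 0" for v
  proof (rule ccontr)
    assume "v \<noteq> 0"
    define w where "w = conj_transpose Z *v v"
    have v: "v = Z *v w"
      using that by (simp add: w_def matrix_vector_mult_diff_rdistrib matrix_vector_mul_assoc)
    have "complex_of_real ((norm w)\<^sup>2) = cinner v v"
      unfolding cinner_self[symmetric] using v by (simp add: w_def cinner_matrix_left)
    then have "(norm w)\<^sup>2 = (norm v)\<^sup>2"
      by (simp add: cinner_self flip: of_real_power)
    then have "norm w = norm v" by simp
    moreover have "norm v < norm w"
    proof -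
      have "w \<noteq> 0" using \<open>v \<noteq> 0\<close> v by auto
      then show ?thesis using assms v by (auto simp: cartan_domain_iff)
    qed
    ultimately show False by simp
  qed
  then have "inj ((*v) (mat 1 - Z ** conj_transpose Z))"
    by (simp add: vec.inj_iff_eq_0 del: matrix_vector_mult_diff_rdistrib)
  then show ?thesis
    by (simp add: invertible_det_nz[symmetric] invertible_left_inverse matrix_left_invertible_injective)
qed

text \<open>
  The determinant is real, since its matrix is Hermitian, and it does not vanish along the segment from
  \<open>0\<close>, where it is \<open>1\<close>, to \<open>Z\<close>.
\<close>

lemma weight_pos:
  assumes "Z \<in> cartan_domain"
  shows "weight Z > 0"
proof (rule ccontr)
  assume neg: "\<not> weight Z > 0"
  let ?Z = "\<lambda>t. row_scale (\<lambda>_. complex_of_real t) Z"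
  have mem: "?Z t \<in> cartan_domain" if "0 \<le> t" "t \<le> 1" for t
    using assms that by (intro row_scale_cartan_domain) auto
  have Im: "Im (det (mat 1 - W ** conj_transpose W)) = 0" for W :: "complex^'n^'n"
  proof -
    have "conj_transpose (mat 1 - W ** conj_transpose W) = mat 1 - W ** conj_transpose W"
      by (simp add: conj_transpose_diff conj_transpose_mult)
    then have "cnj (det (mat 1 - W ** conj_transpose W)) = det (mat 1 - W ** conj_transpose W)"
      by (metis det_conj_transpose)
    then show ?thesis by (simp add: complex_eq_iff)
  qed
  have "continuous_on {0..1} (\<lambda>t. weight (?Z t))"
    unfolding row_scale_def
    by (intro continuous_on_compose2[OF continuous_weight] continuous_intros) auto
  moreover have "weight (?Z 0) = 1"
  proof -
    have "?Z 0 = 0" by (simp add: row_scale_def vec_eq_iff)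
    then have "mat 1 - ?Z 0 ** conj_transpose (?Z 0) = mat 1"
      by (simp add: vec_eq_iff matrix_matrix_mult_def)
    then show ?thesis by (simp add: weight_def)
  qed
  moreover have "weight (?Z 1) \<le> 0"
    using neg by (simp add: row_scale_def)
  ultimately obtain t where t: "0 \<le> t" "t \<le> 1" "weight (?Z t) = 0"
    using IVT2'[of "\<lambda>t. weight (?Z t)" 1 0 0] by auto
  with Im[of "?Z t"] have "det (mat 1 - ?Z t ** conj_transpose (?Z t)) = 0"
    by (simp add: weight_def complex_eq_iff)
  with det_ne_0_cartan_domain[OF mem] t show False by blast
qed

lemma gram_row_scale:
  "(mat 1 - row_scale u Z ** conj_transpose (row_scale u Z)) $ k $ l
   = (if k = l then 1 else 0) - u k * cnj (u l) * (Z ** conj_transpose Z) $ k $ l"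
  by (simp add: row_scale_def matrix_matrix_mult_def conj_transpose_def mat_def sum_distrib_left mult_ac)

lemma weight_row_scale:
  fixes Z :: "complex^'n^'n"
  assumes "\<And>k. norm (u k) = 1"
  shows "weight (row_scale u Z) = weight Z"
proof -
  have 1: "u k * cnj (u k) = 1" for k
    using assms[of k] by (simp add: complex_norm_square[symmetric])
  let ?M = "mat 1 - Z ** conj_transpose Z"
  have M: "(mat 1 - row_scale u Z ** conj_transpose (row_scale u Z)) $ k $ l = u k * cnj (u l) * ?M $ k $ l" for k l
    unfolding gram_row_scale using 1[of k] by (auto simp: mat_def algebra_simps)
  have "det (mat 1 - row_scale u Z ** conj_transpose (row_scale u Z)) = det ?M"
    unfolding det_def
  proof (rule sum.cong[OF refl])
    fix p assume "p \<in> {p. p permutes (UNIV::'n set)}"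
    then have p: "p permutes UNIV" by simp
    have "(\<Prod>k\<in>UNIV. u k * cnj (u (p k)) * ?M $ k $ p k)
        = (\<Prod>k\<in>UNIV. u k) * (\<Prod>k\<in>UNIV. cnj (u (p k))) * (\<Prod>k\<in>UNIV. ?M $ k $ p k)"
      by (simp add: prod.distrib)
    also have "(\<Prod>k\<in>UNIV. cnj (u (p k))) = (\<Prod>k\<in>UNIV. cnj (u k))"
      by (rule prod.permute[OF p, symmetric, unfolded o_def])
    also have "(\<Prod>k\<in>UNIV. u k) * (\<Prod>k\<in>UNIV. cnj (u k)) = 1"
      by (simp add: prod.distrib[symmetric] 1 del: prod.distrib)
    finally show "of_int (sign p) * (\<Prod>k\<in>UNIV. (mat 1 - row_scale u Z ** conj_transpose (row_scale u Z)) $ k $ p k)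
        = of_int (sign p) * (\<Prod>k\<in>UNIV. ?M $ k $ p k)"
      by (simp only: M mult_1)
  qed
  then show ?thesis by (simp add: weight_def)
qed

lemma weight_col_scale:
  fixes Z :: "complex^'n^'n"
  assumes "\<And>k. norm (u k) = 1"
  shows "weight (col_scale u Z) = weight Z"
proof -
  have 1: "u k * cnj (u k) = 1" for k
    using assms[of k] by (simp add: complex_norm_square[symmetric])
  have gauge: "u m * z * (cnj (u m) * w) = z * w" for m z w
  proof -
    have "u m * z * (cnj (u m) * w) = (u m * cnj (u m)) * (z * w)" by (simp only: mult_ac)
    then show ?thesis by (simp only: 1 mult_1)
  qed
  then have "col_scale u Z ** conj_transpose (col_scale u Z) = Z ** conj_transpose Z"
    by (simp add: col_scale_def matrix_matrix_mult_def conj_transpose_def vec_eq_iff gauge)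
  then show ?thesis by (simp add: weight_def)
qed

text \<open>
  In the Leibniz expansion of \<open>det (1 - Z Z\<^sup>*)\<close> a scaling factor \<open>t\<close> of row \<open>i\<close> of \<open>Z\<close> enters each summand as
  \<open>t\<^sup>2\<close>: either through the diagonal entry \<open>(i,i)\<close>, or once through row \<open>i\<close> and once through column \<open>i\<close>. Hence
  the determinant is affine in \<open>t\<^sup>2\<close> and is determined by its values at \<open>t = 0\<close> and \<open>t = 1\<close>.
\<close>

lemma weight_row_interpolate:
  fixes Z :: "complex^'n^'n" and d :: "'n \<Rightarrow> real" and i :: 'n
  defines "w \<equiv> \<lambda>t. weight (row_scale (\<lambda>k. complex_of_real ((d(i := t)) k)) Z)"
  shows "w t = (1 - t\<^sup>2) * w 0 + t\<^sup>2 * w 1"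
proof -
  define W where "W = Z ** conj_transpose Z"
  define f where "f = (\<lambda>t p k. (if k = p k then 1 else 0)
      - complex_of_real ((d(i := t)) k) * complex_of_real ((d(i := t)) (p k)) * W $ k $ p k)"
  define D where "D = (\<lambda>t. \<Sum>p | p permutes (UNIV :: 'n set). of_int (sign p) * (\<Prod>k\<in>UNIV. f t p k))"
  have w: "w t = Re (D t)" for t
    unfolding w_def weight_def det_def D_def gram_row_scale f_def W_def by simp
  have perm_summand: "(\<Prod>k\<in>UNIV. f t p k)
     = (1 - complex_of_real t ^ 2) * (\<Prod>k\<in>UNIV. f 0 p k) + complex_of_real t ^ 2 * (\<Prod>k\<in>UNIV. f 1 p k)"
    if p: "p permutes UNIV" for p
  proof (cases "p i = i")
    case True
    then have pk: "p k \<noteq> i" if "k \<noteq> i" for k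
      using p that by (metis permutes_inverses(2))
    have pr: "(\<Prod>k\<in>UNIV. f s p k) = f s p i * (\<Prod>k\<in>UNIV - {i}. f 0 p k)" for s
      by (subst prod.remove[of _ i]) (auto simp: f_def pk intro!: prod.cong)
    have fi: "f s p i = 1 - complex_of_real s ^ 2 * W $ i $ i" for s
      using True by (simp add: f_def power2_eq_square)
    show ?thesis unfolding pr fi by (simp add: algebra_simps)
  next
    case False
    define j where "j = inv p i"
    have j: "p j = i" "j \<noteq> i"
      using False p by (auto simp: j_def permutes_inverses) (metis permutes_inverses(1))
    have pk: "p k \<noteq> i" if "k \<noteq> j" for k
      using p that j by (metis permutes_inverses(2))
    have pr: "(\<Prod>k\<in>UNIV. f s p k) = f s p i * (f s p j * (\<Prod>k\<in>UNIV - {i} - {j}. f 0 p k))" for s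
      using j by (subst prod.remove[of _ i], simp, simp, subst prod.remove[of _ j])
         (auto simp: f_def pk intro!: prod.cong)
    have fi: "f s p i = - complex_of_real s * (complex_of_real (d (p i)) * W $ i $ p i)"
      and fj: "f s p j = - complex_of_real s * (complex_of_real (d j) * W $ j $ i)" for s
      using j False by (auto simp: f_def)
    show ?thesis unfolding pr fi fj by (simp add: algebra_simps power2_eq_square)
  qed
  have regroup: "s * ((1 - x) * a + x * b) = (1 - x) * (s * a) + x * (s * b)" for s x a b :: complex
    by (simp add: algebra_simps)
  have "D t = (1 - complex_of_real t ^ 2) * D 0 + complex_of_real t ^ 2 * D 1"
  proof -
    have "D t = (\<Sum>p | p permutes (UNIV :: 'n set). (1 - complex_of_real t ^ 2) * (of_int (sign p) * (\<Prod>k\<in>UNIV. f 0 p k))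
        + complex_of_real t ^ 2 * (of_int (sign p) * (\<Prod>k\<in>UNIV. f 1 p k)))"
      unfolding D_def
    proof (rule sum.cong[OF refl])
      fix p assume "p \<in> {p. p permutes (UNIV :: 'n set)}"
      then have p: "p permutes UNIV" by simp
      show "of_int (sign p) * (\<Prod>k\<in>UNIV. f t p k) = (1 - complex_of_real t ^ 2) * (of_int (sign p) * (\<Prod>k\<in>UNIV. f 0 p k))
        + complex_of_real t ^ 2 * (of_int (sign p) * (\<Prod>k\<in>UNIV. f 1 p k))"
        by (rule trans[OF arg_cong[where f="(*) (of_int (sign p))", OF perm_summand[OF p]] regroup])
    qed
    also have "\<dots> = (1 - complex_of_real t ^ 2) * D 0 + complex_of_real t ^ 2 * D 1"
      unfolding D_def sum_distrib_left by (rule sum.distrib)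
    finally show ?thesis .
  qed
  then have "Re (D t) = (1 - t\<^sup>2) * Re (D 0) + t\<^sup>2 * Re (D 1)"
  proof -
    have "1 - complex_of_real t ^ 2 = complex_of_real (1 - t\<^sup>2)" "complex_of_real t ^ 2 = complex_of_real (t\<^sup>2)"
      by simp_all
    moreover have "Re (complex_of_real x * z) = x * Re z" for x z by simp
    ultimately show ?thesis by (simp only: plus_complex.sel \<open>D t = _\<close>)
  qed
  then show ?thesis by (simp only: w)
qed

section \<open>Square roots of positive semidefinite matrices\<close>

lemma Re_cinner: "Re (cinner x y) = x \<bullet> y"
  by (simp add: cinner_def inner_vec_def inner_complex_def)

lemma inner_matrix_left: "(A *v x) \<bullet> y = x \<bullet> (conj_transpose A *v y)"
  by (simp add: cinner_matrix_left flip: Re_cinner)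

lemma pos_semidef_iff: "pos_semidef A \<longleftrightarrow> conj_transpose A = A \<and> (\<forall>v. 0 \<le> v \<bullet> (A *v v))"
  by (simp add: pos_semidef_def quad_form_cinner Re_cinner)

lemma hermitian_polarization:
  assumes "conj_transpose A = A"
  shows "u \<bullet> (A *v v) = ((u + v) \<bullet> (A *v (u + v)) - (u - v) \<bullet> (A *v (u - v))) / 4"
proof -
  have "v \<bullet> (A *v u) = u \<bullet> (A *v v)"
    using inner_matrix_left[of A v u] assms by (simp add: inner_commute)
  then show ?thesis
    by (simp add: matrix_vector_right_distrib matrix_vector_mult_diff_distrib inner_simps)
qed

lemma hermitian_form_zero:
  assumes "conj_transpose A = A" "\<And>v. v \<bullet> (A *v v) = 0"
  shows "A = 0"
proof -
  have "u \<bullet> (A *v v) = 0" for u v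
    using hermitian_polarization[OF assms(1), of u v] assms(2) by simp
  then have "A *v v = 0" for v
    by (metis inner_eq_zero_iff)
  then show ?thesis by (simp add: matrix_eq)
qed

lemma
  fixes A B :: "complex^'n^'n"
  shows scaleR_matrix_mult_left: "(r *\<^sub>R A) ** B = r *\<^sub>R (A ** B)"
  and scaleR_matrix_mult_right: "A ** (r *\<^sub>R B) = r *\<^sub>R (A ** B)"
  and conj_transpose_scaleR: "conj_transpose (r *\<^sub>R A) = r *\<^sub>R conj_transpose A"
  and conj_transpose_add: "conj_transpose (A + B) = conj_transpose A + conj_transpose B"
  by (simp_all add: matrix_matrix_mult_def conj_transpose_def vec_eq_iff scaleR_sum_right)

lemma
  fixes A B C :: "complex^'n^'n"
  shows matrix_mult_add_left: "(A + B) ** C = A ** C + B ** C"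
    and matrix_mult_diff_left: "(A - B) ** C = A ** C - B ** C"
    and matrix_mult_add_right: "C ** (A + B) = C ** A + C ** B"
    and matrix_mult_diff_right: "C ** (A - B) = C ** A - C ** B"
    and scaleR_matrix_vector_mult: "(r *\<^sub>R A) *v x = r *\<^sub>R (A *v x)"
  by (simp_all add: matrix_matrix_mult_def matrix_vector_mult_def vec_eq_iff algebra_simps
      sum.distrib sum_subtractf scaleR_sum_right)

text \<open>
  Polynomials in \<open>X\<close> with nonnegative coefficients. For positive semidefinite \<open>X\<close> they are positive
  semidefinite, and they commute with everything that commutes with \<open>X\<close>; these two properties stand in for
  the spectral theorem.
\<close>

inductive_set positive_polynomials :: "complex^'n^'n \<Rightarrow> (complex^'n^'n) set" for X where
  one: "mat 1 \<in> positive_polynomials X"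
| mult: "A \<in> positive_polynomials X \<Longrightarrow> X ** A \<in> positive_polynomials X"
| add: "A \<in> positive_polynomials X \<Longrightarrow> B \<in> positive_polynomials X \<Longrightarrow> A + B \<in> positive_polynomials X"
| scale: "0 \<le> r \<Longrightarrow> A \<in> positive_polynomials X \<Longrightarrow> r *\<^sub>R A \<in> positive_polynomials X"

lemma positive_polynomials_mult:
  "A \<in> positive_polynomials X \<Longrightarrow> B \<in> positive_polynomials X \<Longrightarrow> A ** B \<in> positive_polynomials X"
  by (induction A rule: positive_polynomials.induct)
     (auto simp: matrix_mul_assoc[symmetric] matrix_mult_add_left scaleR_matrix_mult_left
       intro: positive_polynomials.intros)

lemma positive_polynomials_commute:
  assumes "C ** X = X ** C"
  shows "A \<in> positive_polynomials X \<Longrightarrow> C ** A = A ** C"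
proof (induction A rule: positive_polynomials.induct)
  case (mult A)
  have "C ** (X ** A) = (C ** X) ** A" by (rule matrix_mul_assoc)
  also have "\<dots> = X ** (C ** A)" unfolding assms by (rule matrix_mul_assoc[symmetric])
  also have "\<dots> = (X ** A) ** C" unfolding mult.IH by (rule matrix_mul_assoc)
  finally show ?case .
next
  case (add A B)
  then show ?case by (simp only: matrix_mult_add_left matrix_mult_add_right)
next
  case (scale r A)
  then show ?case by (simp only: scaleR_matrix_mult_left scaleR_matrix_mult_right)
qed simp

lemma positive_polynomials_hermitian:
  assumes "conj_transpose X = X"
  shows "A \<in> positive_polynomials X \<Longrightarrow> conj_transpose A = A"
proof (induction A rule: positive_polynomials.induct)
  case (mult A)
  have "A ** X = X ** A"
    using positive_polynomials_commute[OF refl mult.hyps] by (rule sym)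
  then show ?case
    by (simp only: conj_transpose_mult assms mult.IH)
qed (simp_all add: conj_transpose_add conj_transpose_scaleR)

text \<open>
  The induction also carries the claim for \<open>X A\<close>, because \<open>X (X A) = X A X\<close> reduces its step to \<open>A\<close> itself.
\<close>

lemma positive_polynomials_psd:
  assumes X: "pos_semidef X" and A: "A \<in> positive_polynomials X"
  shows "0 \<le> v \<bullet> (A *v v)"
proof -
  have herm: "conj_transpose X = X" and pos: "0 \<le> v \<bullet> (X *v v)" for v
    using X by (auto simp: pos_semidef_iff)
  from A have "\<forall>v. 0 \<le> v \<bullet> (A *v v) \<and> 0 \<le> v \<bullet> ((X ** A) *v v)"
  proof (induction A rule: positive_polynomials.induct)
    case (mult A)
    have "X ** (X ** A) = X ** (A ** X)"
      using positive_polynomials_commute[OF refl mult.hyps] by simp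
    then have "v \<bullet> ((X ** (X ** A)) *v v) = (X *v v) \<bullet> (A *v (X *v v))" for v
      by (simp add: inner_matrix_left herm matrix_vector_mul_assoc)
    with mult.IH show ?case by simp
  next
    case (add A B)
    then show ?case by (simp add: matrix_mult_add_right matrix_vector_mult_add_rdistrib inner_add_right)
  next
    case (scale r A)
    then show ?case by (simp add: scaleR_matrix_mult_right scaleR_matrix_vector_mult)
  qed (simp_all add: pos)
  then show ?thesis by blast
qed

text \<open>
  With \<open>R = 1 - Y\<close> the equation \<open>R\<^sup>2 = 1 - X\<close> becomes \<open>Y = (X + Y\<^sup>2) / 2\<close>. Iterating the right-hand side from \<open>0\<close>
  gives an increasing sequence of positive polynomials in \<open>X\<close>.
\<close>

fun sqrt_iterate :: "complex^'n^'n \<Rightarrow> nat \<Rightarrow> complex^'n^'n" where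
  "sqrt_iterate X 0 = 0"
| "sqrt_iterate X (Suc k) = (1/2) *\<^sub>R (X + sqrt_iterate X k ** sqrt_iterate X k)"

lemma sqrt_iterate_positive:
  "sqrt_iterate X k \<in> positive_polynomials X"
  "sqrt_iterate X (Suc k) - sqrt_iterate X k \<in> positive_polynomials X"
proof -
  have X: "X \<in> positive_polynomials X"
    using positive_polynomials.mult[OF positive_polynomials.one, of X] by simp
  have zero: "0 \<in> positive_polynomials X"
    using positive_polynomials.scale[OF order_refl X] by simp
  show Y: "sqrt_iterate X k \<in> positive_polynomials X" for k
    by (induction k) (auto intro!: zero X positive_polynomials.intros(3,4) positive_polynomials_mult)
  show "sqrt_iterate X (Suc k) - sqrt_iterate X k \<in> positive_polynomials X"
  proof (induction k)
    case 0
    then show ?case using positive_polynomials.scale[OF _ X, of "1/2"] by simp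
  next
    case (Suc k)
    let ?a = "sqrt_iterate X k" and ?b = "sqrt_iterate X (Suc k)"
    have com: "?a ** ?b = ?b ** ?a"
    proof (rule positive_polynomials_commute[OF _ Y])
      show "?a ** X = X ** ?a"
        using positive_polynomials_commute[OF refl Y, of k] by simp
    qed
    have "(?b - ?a) ** (?b + ?a) = ?b ** ?b - ?a ** ?a"
      by (simp only: matrix_mult_add_right matrix_mult_diff_left com) (simp add: algebra_simps)
    moreover have "sqrt_iterate X (Suc (Suc k)) - ?b = (1/2) *\<^sub>R (?b ** ?b - ?a ** ?a)"
      unfolding sqrt_iterate.simps(2)[of X "Suc k"] sqrt_iterate.simps(2)[of X k, THEN arg_cong[where f="\<lambda>z. _ - z"]]
      by (simp only: scaleR_diff_right[symmetric]) (simp only: add_diff_cancel_left)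
    moreover have "(?b - ?a) ** (?b + ?a) \<in> positive_polynomials X"
      by (intro positive_polynomials_mult Suc positive_polynomials.add Y)
    ultimately show ?case
      by (metis positive_polynomials.scale zero_le_divide_1_iff zero_le_numeral)
  qed
qed

text \<open>
  For \<open>0 \<le> X \<le> 1\<close> the matrix \<open>X - X\<^sup>2 = X (1 - X) X + (1 - X) X (1 - X)\<close> is positive semidefinite, so that
  \<open>|X v|\<^sup>2 = \<langle>v, X\<^sup>2 v\<rangle> \<le> \<langle>v, X v\<rangle> \<le> |v|\<^sup>2\<close>.
\<close>

lemma psd_contraction_norm:
  assumes X: "pos_semidef X" and X1: "pos_semidef (mat 1 - X)"
  shows "norm (X *v v) \<le> norm v"
proof -
  have herm: "conj_transpose X = X" using X by (simp add: pos_semidef_iff)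
  define w where "w = v - X *v v"
  have 1: "0 \<le> (X *v v) \<bullet> ((X *v v) - X *v (X *v v))"
    using X1 by (auto simp: pos_semidef_iff matrix_vector_mult_diff_rdistrib)
  have 2: "0 \<le> w \<bullet> (X *v w)" using X by (auto simp: pos_semidef_iff)
  have 3: "0 \<le> v \<bullet> (v - X *v v)"
    using X1 by (auto simp: pos_semidef_iff matrix_vector_mult_diff_rdistrib)
  have a: "v \<bullet> (X *v (X *v v)) = (X *v v) \<bullet> (X *v v)"
    using inner_matrix_left[of X v "X *v v"] by (simp add: herm)
  have b: "v \<bullet> (X *v (X *v (X *v v))) = (X *v v) \<bullet> (X *v (X *v v))"
    using inner_matrix_left[of X v "X *v (X *v v)"] by (simp add: herm)
  have c: "(X *v v) \<bullet> v = v \<bullet> (X *v v)" by (rule inner_commute)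
  from 2 have "0 \<le> v \<bullet> (X *v v) - 2 * ((X *v v) \<bullet> (X *v v)) + (X *v v) \<bullet> (X *v (X *v v))"
    by (simp add: w_def inner_simps matrix_vector_mult_diff_distrib a b c)
  with 1 3 have "(X *v v) \<bullet> (X *v v) \<le> v \<bullet> v"
    by (simp add: inner_simps)
  then show ?thesis by (simp add: norm_le)
qed

lemma tendsto_matrix_mult:
  fixes A B :: "nat \<Rightarrow> complex^'n^'n"
  assumes "A \<longlonglongrightarrow> a" "B \<longlonglongrightarrow> b"
  shows "(\<lambda>k. A k ** B k) \<longlonglongrightarrow> a ** b"
  unfolding matrix_matrix_mult_def
  by (intro tendsto_intros assms)

lemma tendsto_matrix_vector_mult:
  fixes A :: "nat \<Rightarrow> complex^'n^'n"
  assumes "A \<longlonglongrightarrow> a"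
  shows "(\<lambda>k. A k *v v) \<longlonglongrightarrow> a *v v"
  unfolding matrix_vector_mult_def
  by (intro tendsto_intros assms)

text \<open>
  The quadratic forms of the iterates increase and stay below that of the identity; by polarization the
  entries converge. Commutation with \<open>C\<close> passes to the limit and is what uniqueness will need.
\<close>

lemma psd_sqrt_exists_commuting:
  fixes X :: "complex^'n^'n"
  assumes X: "pos_semidef X" and X1: "pos_semidef (mat 1 - X)"
  shows "\<exists>R. pos_semidef R \<and> R ** R = mat 1 - X \<and> (\<forall>C. C ** X = X ** C \<longrightarrow> C ** R = R ** C)"
proof -
  let ?Y = "sqrt_iterate X"
  have herm: "conj_transpose X = X" using X by (simp add: pos_semidef_iff)
  have Yherm: "conj_transpose (?Y k) = ?Y k" for k
    by (rule positive_polynomials_hermitian[OF herm sqrt_iterate_positive(1)])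
  have Ynorm: "norm (?Y k *v v) \<le> norm v" for k v
  proof (induction k arbitrary: v)
    case (Suc k)
    have "norm (?Y (Suc k) *v v) \<le> (norm (X *v v) + norm (?Y k *v (?Y k *v v))) / 2"
      by (simp add: scaleR_matrix_vector_mult matrix_vector_mult_add_rdistrib
          matrix_vector_mul_assoc[symmetric] norm_triangle_ineq del: scaleR_half_double)
    moreover have "norm (?Y k *v (?Y k *v v)) \<le> norm v"
      by (rule order_trans[OF Suc Suc])
    moreover have "(a + b) / 2 \<le> c" if "a \<le> c" "b \<le> c" for a b c :: real
      using that by simp
    ultimately show ?case
      by (meson order_trans psd_contraction_norm[OF X X1])
  qed simp
  have form: "convergent (\<lambda>k. v \<bullet> (?Y k *v v))" for v
  proof (rule Bseq_mono_convergent)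
    show "Bseq (\<lambda>k. v \<bullet> (?Y k *v v))"
    proof (rule BseqI'[of _ "norm v * norm v"])
      fix k
      have "norm (v \<bullet> (?Y k *v v)) \<le> norm v * norm (?Y k *v v)" by (rule Cauchy_Schwarz_ineq2[folded real_norm_def])
      also have "\<dots> \<le> norm v * norm v" by (intro mult_left_mono Ynorm norm_ge_zero)
      finally show "norm (v \<bullet> (?Y k *v v)) \<le> norm v * norm v" .
    qed
    have "v \<bullet> (?Y k *v v) \<le> v \<bullet> (?Y (Suc k) *v v)" for k
      using positive_polynomials_psd[OF X sqrt_iterate_positive(2), of v k]
      by (simp only: matrix_vector_mult_diff_rdistrib inner_diff_right)
    then have "mono (\<lambda>k. v \<bullet> (?Y k *v v))"
      by (rule monoI[OF lift_Suc_mono_le[of "\<lambda>k. v \<bullet> (?Y k *v v)"]])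
    then show "\<forall>m n. m \<le> n \<longrightarrow> v \<bullet> (?Y m *v v) \<le> v \<bullet> (?Y n *v v)"
      unfolding mono_def .
  qed
  have bilin: "convergent (\<lambda>k. u \<bullet> (?Y k *v v))" for u v
  proof -
    obtain a b where "(\<lambda>k. (u + v) \<bullet> (?Y k *v (u + v))) \<longlonglongrightarrow> a" "(\<lambda>k. (u - v) \<bullet> (?Y k *v (u - v))) \<longlonglongrightarrow> b"
      using form[of "u + v"] form[of "u - v"] unfolding convergent_def by blast
    then have "(\<lambda>k. ((u + v) \<bullet> (?Y k *v (u + v)) - (u - v) \<bullet> (?Y k *v (u - v))) / 4) \<longlonglongrightarrow> (a - b) / 4"
      by (intro tendsto_intros) auto
    moreover have "(\<lambda>k. u \<bullet> (?Y k *v v)) = (\<lambda>k. ((u + v) \<bullet> (?Y k *v (u + v)) - (u - v) \<bullet> (?Y k *v (u - v))) / 4)"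
      by (rule ext) (rule hermitian_polarization[OF Yherm])
    ultimately have "(\<lambda>k. u \<bullet> (?Y k *v v)) \<longlonglongrightarrow> (a - b) / 4" by (simp only:)
    then show ?thesis by (rule convergentI)
  qed
  have entry: "?Y k $ i $ j = Complex (axis i 1 \<bullet> (?Y k *v axis j 1)) (axis i \<i> \<bullet> (?Y k *v axis j 1))" for k i j
  proof -
    have "(?Y k *v axis j 1) $ i = ?Y k $ i $ j"
      by (simp add: matrix_vector_mult_def axis_def if_distrib[of "\<lambda>x::complex. _ * x"] cong: if_cong)
    moreover have "axis i z \<bullet> w = z \<bullet> w $ i" for z :: complex and w :: "complex^'n"
      by (simp add: inner_axis')
    ultimately show ?thesis by (simp add: inner_complex_def complex_eq_iff)
  qed
  have "\<exists>l. (\<lambda>k. ?Y k $ i $ j) \<longlonglongrightarrow> l" for i j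
  proof -
    obtain a b where "(\<lambda>k. axis i 1 \<bullet> (?Y k *v axis j 1)) \<longlonglongrightarrow> a" "(\<lambda>k. axis i \<i> \<bullet> (?Y k *v axis j 1)) \<longlonglongrightarrow> b"
      using bilin[of "axis i 1" "axis j 1"] bilin[of "axis i \<i>" "axis j 1"]
      unfolding convergent_def by blast
    then show ?thesis
      unfolding entry by (intro exI[of _ "Complex a b"] tendsto_Complex)
  qed
  then have "\<forall>i. \<forall>j. \<exists>l. (\<lambda>k. ?Y k $ i $ j) \<longlonglongrightarrow> l" by (intro allI)
  then obtain l where l: "\<And>i j. (\<lambda>k. ?Y k $ i $ j) \<longlonglongrightarrow> l i j"
    unfolding choice_iff by (elim exE) (rule that, blast)
  define L where "L = (\<chi> i j. l i j)"
  have YL: "?Y \<longlonglongrightarrow> L"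
    unfolding L_def by (intro vec_tendstoI) (simp add: l)
  have "(\<lambda>k. ?Y (Suc k)) \<longlonglongrightarrow> (1/2) *\<^sub>R (X + L ** L)"
    unfolding sqrt_iterate.simps by (intro tendsto_intros tendsto_matrix_mult YL)
  then have fixL: "L = (1/2) *\<^sub>R (X + L ** L)"
    using LIMSEQ_Suc[OF YL] by (rule LIMSEQ_unique[rotated])
  have fixL2: "L + L = X + L ** L"
  proof -
    have "(2::real) *\<^sub>R L = 2 *\<^sub>R ((1/2) *\<^sub>R (X + L ** L))"
      using fixL by (rule arg_cong)
    then show ?thesis by (simp add: scaleR_2)
  qed
  have Lherm: "conj_transpose L = L"
  proof -
    have "(\<lambda>k. conj_transpose (?Y k)) \<longlonglongrightarrow> conj_transpose L"
      unfolding conj_transpose_def by (intro tendsto_intros YL)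
    then show ?thesis unfolding Yherm using YL by (rule LIMSEQ_unique)
  qed
  have Lnorm: "norm (L *v v) \<le> norm v" for v
    by (rule LIMSEQ_le_const2[OF tendsto_norm[OF tendsto_matrix_vector_mult[OF YL]]]) (use Ynorm in blast)
  show ?thesis
  proof (intro exI[of _ "mat 1 - L"] conjI allI impI)
    have "v \<bullet> (L *v v) \<le> v \<bullet> v" for v
    proof -
      have "v \<bullet> (L *v v) \<le> norm v * norm (L *v v)" by (rule norm_cauchy_schwarz)
      also have "\<dots> \<le> norm v * norm v" by (intro mult_left_mono Lnorm norm_ge_zero)
      finally show ?thesis by (simp add: power2_norm_eq_inner[symmetric] power2_eq_square)
    qed
    then show "pos_semidef (mat 1 - L)"
      by (simp add: pos_semidef_iff conj_transpose_diff Lherm matrix_vector_mult_diff_rdistrib inner_diff_right)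
    have "(mat 1 - L) ** (mat 1 - L) = mat 1 - (L + L) + L ** L"
      by (simp add: matrix_mult_diff_right matrix_mult_diff_left)
    then show "(mat 1 - L) ** (mat 1 - L) = mat 1 - X"
      unfolding fixL2 by simp
    fix C assume C: "C ** X = X ** C"
    have "(\<lambda>k. C ** ?Y k) \<longlonglongrightarrow> C ** L" "(\<lambda>k. ?Y k ** C) \<longlonglongrightarrow> L ** C"
      by (intro tendsto_matrix_mult YL tendsto_const)+
    then have "C ** L = L ** C"
      unfolding positive_polynomials_commute[OF C sqrt_iterate_positive(1)] by (rule LIMSEQ_unique)
    then show "C ** (mat 1 - L) = (mat 1 - L) ** C"
      by (simp add: matrix_mult_diff_right matrix_mult_diff_left)
  qed
qed

text \<open>
  For uniqueness let \<open>S\<close> be a second root. It commutes with its square, hence with \<open>R\<close>, so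
  \<open>(R + S) E = 0\<close> for \<open>E = R - S\<close>. Then \<open>E R E\<close> and \<open>E S E\<close> are positive semidefinite with sum \<open>0\<close>, both
  forms vanish, and so does \<open>E\<^sup>3\<close>; a nilpotent Hermitian matrix is \<open>0\<close>.
\<close>

lemma psd_sqrt_gram:
  fixes W :: "complex^'n^'n"
  assumes W: "\<And>v. norm (W *v v) \<le> norm v"
  shows "pos_semidef (psd_sqrt (conj_transpose W ** W))"
    and "psd_sqrt (conj_transpose W ** W) ** psd_sqrt (conj_transpose W ** W) = conj_transpose W ** W"
proof -
  let ?A = "conj_transpose W ** W"
  have form: "v \<bullet> (?A *v v) = (W *v v) \<bullet> (W *v v)" for v
    by (simp add: inner_matrix_left matrix_vector_mul_assoc)
  have "pos_semidef (mat 1 - ?A)"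
    using W by (simp add: pos_semidef_iff conj_transpose_diff conj_transpose_mult
        matrix_vector_mult_diff_rdistrib inner_diff_right form norm_le)
  then have "\<exists>R. pos_semidef R \<and> R ** R = mat 1 - (mat 1 - ?A)
      \<and> (\<forall>C. C ** (mat 1 - ?A) = (mat 1 - ?A) ** C \<longrightarrow> C ** R = R ** C)"
  proof (rule psd_sqrt_exists_commuting)
    show "pos_semidef (mat 1 - (mat 1 - ?A))"
      by (simp add: pos_semidef_iff conj_transpose_mult form)
  qed
  then obtain R where R': "pos_semidef R \<and> R ** R = mat 1 - (mat 1 - ?A)
      \<and> (\<forall>C. C ** (mat 1 - ?A) = (mat 1 - ?A) ** C \<longrightarrow> C ** R = R ** C)"
    by (rule exE)
  have R: "pos_semidef R" "R ** R = ?A"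
    using R'[THEN conjunct1] R'[THEN conjunct2, THEN conjunct1] by simp_all
  have Rcom: "C ** R = R ** C" if "C ** (mat 1 - ?A) = (mat 1 - ?A) ** C" for C
    using R'[THEN conjunct2, THEN conjunct2, rule_format, OF that] .
  have uniq: "S = R" if S: "pos_semidef S" "S ** S = ?A" for S
  proof -
    have "S ** (S ** S) = (S ** S) ** S" by (simp only: matrix_mul_assoc)
    then have com: "S ** R = R ** S"
      unfolding S(2)
    proof -
      assume "S ** ?A = ?A ** S"
      then have "S ** (mat 1 - ?A) = (mat 1 - ?A) ** S"
        by (simp only: matrix_mult_diff_right matrix_mult_diff_left matrix_mul_lid matrix_mul_rid)
      then show ?thesis by (rule Rcom)
    qed
    define E where "E = R - S"
    have Eherm: "conj_transpose E = E"
      using R(1) S(1) by (simp add: E_def conj_transpose_diff pos_semidef_iff)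
    have RS0: "(R + S) *v (E *v v) = 0" for v
    proof -
      have "(R + S) ** E = 0"
        by (simp only: E_def matrix_mult_add_left matrix_mult_diff_right com R(2) S(2)) simp
      then show ?thesis by (simp add: matrix_vector_mul_assoc)
    qed
    have E3: "v \<bullet> ((E ** (E ** E)) *v v) = 0" for v
    proof -
      let ?w = "E *v v"
      have "0 \<le> ?w \<bullet> (R *v ?w)" "0 \<le> ?w \<bullet> (S *v ?w)"
        using R(1) S(1) by (auto simp: pos_semidef_iff)
      moreover have "?w \<bullet> (R *v ?w) + ?w \<bullet> (S *v ?w) = ?w \<bullet> ((R + S) *v ?w)"
        by (simp only: inner_add_right matrix_vector_mult_add_rdistrib)
      moreover have "?w \<bullet> (E *v ?w) = ?w \<bullet> (R *v ?w) - ?w \<bullet> (S *v ?w)"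
        unfolding E_def[THEN arg_cong[where f="\<lambda>M. _ \<bullet> (M *v _)"]]
        by (simp only: matrix_vector_mult_diff_rdistrib inner_diff_right)
      ultimately have "?w \<bullet> (E *v ?w) = 0"
        by (simp add: RS0)
      then show ?thesis
        by (simp add: inner_matrix_left Eherm matrix_vector_mul_assoc)
    qed
    have E0: "E ** (E ** E) = 0"
      by (rule hermitian_form_zero[OF _ E3])
       (simp add: conj_transpose_mult Eherm matrix_mul_assoc)
    have "E *v v = 0" for v
    proof -
      have "(E *v (E *v v)) \<bullet> (E *v (E *v v)) = v \<bullet> (E *v ((E ** (E ** E)) *v v))"
        by (simp only: inner_matrix_left Eherm) (simp only: matrix_vector_mul_assoc)
      then have "E *v (E *v v) = 0" by (simp add: E0)
      moreover have "(E *v v) \<bullet> (E *v v) = v \<bullet> (E *v (E *v v))"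
        by (simp add: inner_matrix_left Eherm)
      ultimately show ?thesis by simp
    qed
    then have "E = 0" by (simp add: matrix_eq)
    then show ?thesis by (simp add: E_def)
  qed
  have eq: "psd_sqrt ?A = R"
    unfolding psd_sqrt_def by (rule the_equality) (use R(1,2) uniq in blast)+
  show "pos_semidef (psd_sqrt ?A)" "psd_sqrt ?A ** psd_sqrt ?A = ?A"
    unfolding eq by (rule R)+
qed

section \<open>Integrability of powers of the weight\<close>

definition row_mask :: "'n set \<Rightarrow> 'n \<Rightarrow> complex" where
  "row_mask S k = (if k \<in> S then 1 else 0)"

text \<open>
  Only the rows in \<open>S\<close> are subject to the domain condition. The other rows range over a box of size \<open>2\<close>: a row
  that satisfies the condition after scaling by some \<open>t \<ge> 1/2\<close> has entries bounded by \<open>2\<close>.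
\<close>

definition masked_domain :: "'n set \<Rightarrow> (complex^'n^'n) set" where
  "masked_domain S = {Z. row_scale (row_mask S) Z \<in> cartan_domain \<and> (\<forall>j. j \<notin> S \<longrightarrow> (\<forall>k. norm (Z $ j $ k) \<le> 2))}"

definition masked_integral :: "real \<Rightarrow> ('n::finite) set \<Rightarrow> ennreal" where
  "masked_integral s S = (\<integral>\<^sup>+Z. indicator (masked_domain S) Z *
      ennreal (weight (row_scale (row_mask S) (Z :: complex^'n^'n)) powr s) \<partial>lborel)"

lemma continuous_row_scale: "continuous_on A (row_scale u :: complex^'n^'n \<Rightarrow> _)"
  unfolding row_scale_def by (intro continuous_intros)

lemma measurable_masked [measurable]:
  "masked_domain S \<in> sets (borel :: (complex^'n^'n) measure)"
  "(\<lambda>Z. weight (row_scale u Z)) \<in> borel_measurable (borel :: (complex^'n^'n) measure)"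
proof -
  have "open {Z :: complex^'n^'n. row_scale (row_mask S) Z \<in> cartan_domain}"
    using open_vimage[OF open_cartan_domain continuous_row_scale] by (simp add: vimage_def)
  moreover have "closed {Z :: complex^'n^'n. \<forall>j. j \<notin> S \<longrightarrow> (\<forall>k. norm (Z $ j $ k) \<le> 2)}"
    by (intro closed_Collect_all closed_Collect_imp open_Collect_const closed_Collect_le continuous_intros)
  moreover have "masked_domain S = {Z :: complex^'n^'n. row_scale (row_mask S) Z \<in> cartan_domain} \<inter>
      {Z. \<forall>j. j \<notin> S \<longrightarrow> (\<forall>k. norm (Z $ j $ k) \<le> 2)}"
    by (auto simp: masked_domain_def)
  ultimately show "masked_domain S \<in> sets (borel :: (complex^'n^'n) measure)"
    by (auto intro: borel_open borel_closed)
  show "(\<lambda>Z. weight (row_scale u Z)) \<in> borel_measurable (borel :: (complex^'n^'n) measure)"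
    by (intro borel_measurable_continuous_onI continuous_on_compose2[OF continuous_weight continuous_row_scale]) auto
qed

lemma nn_integral_powr_unit:
  assumes "-1 < (s::real)"
  shows "(\<integral>\<^sup>+x. ennreal (indicator {0..1} x * x powr s) \<partial>lborel) = ennreal (1 / (s + 1))"
proof (rule nn_integral_has_integral_lborel)
  have "((\<lambda>x. x powr s) has_integral 1 powr (s + 1) / (s + 1)) {0..1}"
    using assms by (intro has_integral_powr_from_0) auto
  then have "((\<lambda>x. if x \<in> {0..1} then x powr s else 0) has_integral 1 / (s + 1)) UNIV"
    by (simp only: has_integral_restrict_UNIV powr_one_eq_one)
  moreover have "(\<lambda>x. if x \<in> {0..1} then x powr s else 0) = (\<lambda>x. indicator {0..1} x * x powr s)"
    by (auto simp: indicator_def)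
  ultimately show "((\<lambda>x. indicator {0..1} x * x powr s) has_integral 1 / (s + 1)) UNIV"
    by simp
qed auto

text \<open>
  The bound does not depend on \<open>q\<close>, which will be a function of the matrix. For \<open>q > 1/2\<close> it comes from
  \<open>1 - t\<^sup>2 q \<ge> 1 - t * sqrt q\<close>, a linear function of \<open>t\<close> whose power \<open>s > -1\<close> is integrable up to its zero.
\<close>

lemma nn_integral_quadratic_powr_bound:
  fixes s q :: real
  assumes s: "-1 < s" "s < 0"
  shows "(\<integral>\<^sup>+t. indicator {1/2..1::real} t * ennreal (if 0 < 1 - t\<^sup>2 * q then (1 - t\<^sup>2 * q) powr s else 0) \<partial>lborel)
     \<le> ennreal ((1/2) powr s + 2 / (s + 1))"
proof (cases "q \<le> 1/2")
  case True
  have "(\<integral>\<^sup>+t. indicator {1/2..1::real} t * ennreal (if 0 < 1 - t\<^sup>2 * q then (1 - t\<^sup>2 * q) powr s else 0) \<partial>lborel)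
     \<le> (\<integral>\<^sup>+t. ennreal ((1/2) powr s) * indicator {1/2..1::real} t \<partial>lborel)"
  proof (intro nn_integral_mono)
    fix t :: real
    show "indicator {1/2..1::real} t * ennreal (if 0 < 1 - t\<^sup>2 * q then (1 - t\<^sup>2 * q) powr s else 0)
       \<le> ennreal ((1/2) powr s) * indicator {1/2..1::real} t"
    proof (cases "t \<in> {1/2..1}")
      case t: True
      have "t\<^sup>2 \<le> 1" using t by (simp add: power_le_one)
      then have "t\<^sup>2 * q \<le> 1/2"
        using True mult_left_le_one_le[of q "t\<^sup>2"] mult_nonneg_nonpos[of "t\<^sup>2" q] by (cases "q \<ge> 0") auto
      then have "(1 - t\<^sup>2 * q) powr s \<le> (1/2) powr s"
        using s by (intro powr_mono2') auto
      then show ?thesis using t by (auto intro: ennreal_leI)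
    qed simp
  qed
  also have "\<dots> = ennreal ((1/2) powr s) * ennreal (1/2)"
  proof -
    have "emeasure lborel {1/2..1::real} = ennreal (1/2)"
      by (subst emeasure_lborel_Icc) auto
    then show ?thesis by (simp only: nn_integral_cmult_indicator sets_lborel atLeastAtMost_borel)
  qed
  also have "\<dots> = ennreal ((1/2) powr s * (1/2))"
    by (rule ennreal_mult[symmetric]) auto
  also have "\<dots> \<le> ennreal ((1/2) powr s + 2 / (s + 1))"
  proof (rule ennreal_leI)
    have "0 \<le> 2 / (s + 1)" "0 \<le> (1/2::real) powr s" using s by auto
    then show "(1/2) powr s * (1/2) \<le> (1/2) powr s + 2 / (s + 1)" by linarith
  qed
  finally show ?thesis .
next
  case False
  define r where "r = sqrt q"
  have r: "r > 0" "r\<^sup>2 = q" "1 / r \<le> 2"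
  proof -
    show "r > 0" "r\<^sup>2 = q" using False by (auto simp: r_def)
    have "(1/2)\<^sup>2 \<le> q" using False by (simp add: power2_eq_square)
    then have "1/2 \<le> r" unfolding r_def by (rule real_le_rsqrt)
    then show "1 / r \<le> 2" by (simp add: field_simps)
  qed
  let ?h = "\<lambda>x::real. ennreal (indicator {0..1} x * x powr s)"
  have "(\<integral>\<^sup>+t. indicator {1/2..1::real} t * ennreal (if 0 < 1 - t\<^sup>2 * q then (1 - t\<^sup>2 * q) powr s else 0) \<partial>lborel)
     \<le> (\<integral>\<^sup>+t. ?h (1 + (- r) * t) \<partial>lborel)"
  proof (intro nn_integral_mono)
    fix t :: real
    show "indicator {1/2..1::real} t * ennreal (if 0 < 1 - t\<^sup>2 * q then (1 - t\<^sup>2 * q) powr s else 0) \<le> ?h (1 + (- r) * t)"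
    proof (cases "t \<in> {1/2..1} \<and> 0 < 1 - t\<^sup>2 * q")
      case t: True
      have fac: "1 - t\<^sup>2 * q = (1 - r * t) * (1 + r * t)"
        by (simp add: r(2)[symmetric] power2_eq_square algebra_simps)
      have rt: "0 < r * t" using t r by auto
      with t fac have pos: "0 < 1 - r * t"
        by (metis add_pos_pos zero_less_mult_pos2 zero_less_one)
      have "1 - r * t \<le> 1 - t\<^sup>2 * q"
        unfolding fac using pos rt by simp
      then have "(1 - t\<^sup>2 * q) powr s \<le> (1 - r * t) powr s"
        using s pos by (intro powr_mono2') auto
      then show ?thesis using t pos rt by (auto intro: ennreal_leI)
    qed auto
  qed
  also have "\<dots> = ennreal (1 / r) * (\<integral>\<^sup>+x. ?h x \<partial>lborel)"
  proof -
    have "(\<integral>\<^sup>+x. ?h x \<partial>lborel) = ennreal \<bar>- r\<bar> * (\<integral>\<^sup>+t. ?h (1 + (- r) * t) \<partial>lborel)"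
      using r by (intro nn_integral_real_affine) auto
    then have "ennreal (1 / r) * (\<integral>\<^sup>+x. ?h x \<partial>lborel) = (ennreal (1 / r) * ennreal r) * (\<integral>\<^sup>+t. ?h (1 + (- r) * t) \<partial>lborel)"
      using r by (simp add: mult.assoc)
    also have "ennreal (1 / r) * ennreal r = 1"
      using r by (simp flip: ennreal_mult)
    finally show ?thesis by simp
  qed
  also have "\<dots> = ennreal (1 / r * (1 / (s + 1)))"
    unfolding nn_integral_powr_unit[OF s(1)] using r s by (intro ennreal_mult[symmetric]) auto
  also have "\<dots> \<le> ennreal ((1/2) powr s + 2 / (s + 1))"
  proof (rule ennreal_leI)
    have "1 / r * (1 / (s + 1)) \<le> 2 * (1 / (s + 1))"
      using r s by (intro mult_right_mono) auto
    then have "1 / r * (1 / (s + 1)) \<le> 2 / (s + 1)" by simp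
    then show "1 / r * (1 / (s + 1)) \<le> (1/2) powr s + 2 / (s + 1)"
      by (rule order_trans) simp
  qed
  finally show ?thesis .
qed

lemma row_scale_row_scale: "row_scale u (row_scale v Z) = row_scale (\<lambda>k. u k * v k) Z"
  by (simp add: row_scale_def vec_eq_iff mult.assoc)

lemma weight_masked_interpolate:
  fixes Z :: "complex^'n^'n"
  assumes "i \<notin> S"
  shows "weight (row_scale (row_mask (insert i S)) (row_scale (\<lambda>k. if k = i then complex_of_real t else 1) Z))
    = (1 - t\<^sup>2) * weight (row_scale (row_mask S) Z) + t\<^sup>2 * weight (row_scale (row_mask (insert i S)) Z)"
proof -
  define d :: "'n \<Rightarrow> real" where "d = (\<lambda>k. if k \<in> S then 1 else 0)"
  have "(\<lambda>k. row_mask (insert i S) k * (if k = i then complex_of_real t else 1)) = (\<lambda>k. complex_of_real ((d(i := t)) k))"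
    "row_mask S = (\<lambda>k. complex_of_real ((d(i := 0)) k))"
    "row_mask (insert i S) = (\<lambda>k. complex_of_real ((d(i := 1)) k))"
    using assms by (auto simp: row_mask_def d_def)
  then show ?thesis
    using weight_row_interpolate[of d i t Z] by (simp only: row_scale_row_scale)
qed

text \<open>
  Scaling row \<open>i\<close> by \<open>t \<le> 1\<close> is a contraction, so the integral is at most the one of the integrand scaled by
  any such \<open>t\<close>. Averaging over \<open>t \<in> [1/2, 1]\<close> and interchanging the integrals leaves, for each matrix, the
  one-dimensional integral of \<open>(p\<^sub>S (1 - t\<^sup>2 q))\<^sup>s\<close>, which is bounded by a constant times \<open>p\<^sub>S\<^sup>s\<close>.
\<close>

lemma masked_integral_insert:
  fixes S :: "'n::finite set"
  assumes i: "i \<notin> S" and s: "-1 < s" "s < 0"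
  shows "masked_integral s (insert i S) \<le> ennreal (2 * ((1/2) powr s + 2 / (s + 1))) * masked_integral s S"
proof -
  let ?S = "insert i S"
  define E :: "real \<Rightarrow> complex^'n^'n \<Rightarrow> complex^'n^'n"
    where "E = (\<lambda>t. row_scale (\<lambda>k. if k = i then complex_of_real t else 1))"
  define p where "p = (\<lambda>S (Z :: complex^'n^'n). weight (row_scale (row_mask S) Z))"
  define g where "g = (\<lambda>Z :: complex^'n^'n. indicator (masked_domain ?S) Z * ennreal (p ?S Z powr s))"
  define q where "q = (\<lambda>Z. 1 - p ?S Z / p S Z)"
  let ?C = "(1/2) powr s + 2 / (s + 1)"
  have C: "?C \<ge> 0" using s by simp
  have [measurable]: "p S \<in> borel_measurable borel" for S
    unfolding p_def by measurable
  have g[measurable]: "g \<in> borel_measurable borel"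
    unfolding g_def by measurable
  have [measurable]: "q \<in> borel_measurable borel"
    unfolding q_def by measurable
  have "continuous_on UNIV (\<lambda>x. E (fst x) (snd x))"
  proof -
    have "continuous_on UNIV (\<lambda>x :: real \<times> (complex^'n^'n). if k = i then complex_of_real (fst x) else 1)" for k
      by (cases "k = i") (auto intro!: continuous_intros)
    then show ?thesis
      unfolding E_def row_scale_def by (intro continuous_intros)
  qed
  then have "(\<lambda>x. E (fst x) (snd x)) \<in> borel_measurable borel"
    by (rule borel_measurable_continuous_onI)
  then have Em[measurable]: "(\<lambda>x. E (fst x) (snd x)) \<in> borel_measurable (borel \<Otimes>\<^sub>M borel)"
    by (simp add: borel_prod)
  have contr: "(\<integral>\<^sup>+Z. g Z \<partial>lborel) \<le> (\<integral>\<^sup>+Z. g (E t Z) \<partial>lborel)" if t: "t \<in> {1/2..1}" for t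
  proof (rule nn_integral_lborel_contraction[OF g])
    show "linear (E t)" unfolding E_def by (rule linear_row_scale)
    have "E t (E (1/t) Z) = Z" "E (1/t) (E t Z) = Z" for Z
      using t by (auto simp: E_def row_scale_row_scale, auto simp: row_scale_def vec_eq_iff)
    then show "bij (E t)" by (intro o_bij[of "E (1/t)"]) auto
    show "norm (E t Z) \<le> norm Z" for Z
      unfolding E_def row_scale_def norm_vec_def
      by (intro L2_set_mono L2_set_nonneg) (use t in \<open>auto simp: norm_mult intro!: mult_left_le_one_le\<close>)
  qed
  have point: "g (E t Z) \<le> indicator (masked_domain S) Z * ennreal (p S Z powr s)
        * ennreal (if 0 < 1 - t\<^sup>2 * q Z then (1 - t\<^sup>2 * q Z) powr s else 0)"
    if t: "t \<in> {1/2..1}" for t Z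
  proof (cases "E t Z \<in> masked_domain ?S")
    case True
    have D: "row_scale (row_mask ?S) (E t Z) \<in> cartan_domain"
      using True by (simp add: masked_domain_def)
    have "row_scale (row_mask S) Z = row_scale (row_mask S) (row_scale (row_mask ?S) (E t Z))"
      using i by (auto simp: E_def row_scale_row_scale row_scale_def row_mask_def vec_eq_iff)
    then have DS: "row_scale (row_mask S) Z \<in> cartan_domain"
      using row_scale_cartan_domain[OF D, of "row_mask S"] by (simp add: row_mask_def)
    have mem: "Z \<in> masked_domain S"
      unfolding masked_domain_def
    proof (intro CollectI conjI DS allI impI)
      fix j k assume "j \<notin> S"
      show "norm (Z $ j $ k) \<le> 2"
      proof (cases "j = i")
        case True
        have "norm (row_scale (row_mask ?S) (E t Z) $ i $ k) < 1"
          using D by (rule cartan_domain_entry)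
        then have "t * norm (Z $ i $ k) < 1"
          using t by (simp add: E_def row_scale_def row_mask_def norm_mult)
        moreover have "1/2 * norm (Z $ i $ k) \<le> t * norm (Z $ i $ k)"
          using t by (intro mult_right_mono) auto
        ultimately show ?thesis using True by simp
      next
        case False
        then have "E t Z $ j $ k = Z $ j $ k" by (simp add: E_def row_scale_def)
        moreover have "norm (E t Z $ j $ k) \<le> 2"
          using True False \<open>j \<notin> S\<close> by (auto simp: masked_domain_def)
        ultimately show ?thesis by simp
      qed
    qed
    have pos: "p S Z > 0" "p ?S (E t Z) > 0"
      using weight_pos[OF DS] weight_pos[OF D] by (auto simp: p_def)
    have "p ?S (E t Z) = (1 - t\<^sup>2) * p S Z + t\<^sup>2 * p ?S Z"
      unfolding p_def E_def by (rule weight_masked_interpolate[OF i])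
    also have "\<dots> = p S Z * (1 - t\<^sup>2 * q Z)"
      using pos(1) by (simp add: q_def field_simps)
    finally have eq: "p ?S (E t Z) = p S Z * (1 - t\<^sup>2 * q Z)" .
    then have pos': "0 < 1 - t\<^sup>2 * q Z"
      using pos by (metis zero_less_mult_pos)
    have "g (E t Z) = ennreal (p S Z powr s * (1 - t\<^sup>2 * q Z) powr s)"
      using True pos pos' by (simp add: g_def eq powr_mult)
    then show ?thesis using mem pos' by (simp add: ennreal_mult)
  qed (simp add: g_def)
  have "ennreal (1/2) * (\<integral>\<^sup>+Z. g Z \<partial>lborel) = (\<integral>\<^sup>+t. indicator {1/2..1::real} t * (\<integral>\<^sup>+Z. g Z \<partial>lborel) \<partial>lborel)"
    by (simp add: nn_integral_multc)
  also have "\<dots> \<le> (\<integral>\<^sup>+t. indicator {1/2..1::real} t * (\<integral>\<^sup>+Z. g (E t Z) \<partial>lborel) \<partial>lborel)"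
    by (intro nn_integral_mono) (auto simp: indicator_def intro: contr)
  also have "\<dots> = (\<integral>\<^sup>+t. \<integral>\<^sup>+Z. indicator {1/2..1::real} t * g (E t Z) \<partial>lborel \<partial>lborel)"
  proof (intro nn_integral_cong nn_integral_cmult[symmetric])
    fix t
    have "(\<lambda>Z. g (E (fst (t, Z)) (snd (t, Z)))) \<in> borel_measurable borel" by measurable
    then show "(\<lambda>Z. g (E t Z)) \<in> borel_measurable lborel" by simp
  qed
  also have "\<dots> = (\<integral>\<^sup>+Z. \<integral>\<^sup>+t. indicator {1/2..1::real} t * g (E t Z) \<partial>lborel \<partial>lborel)"
    by (rule lborel_pair.Fubini'[symmetric]) (simp add: split_beta', measurable)
  also have "\<dots> \<le> (\<integral>\<^sup>+Z. indicator (masked_domain S) Z * ennreal (p S Z powr s) * ennreal ?C \<partial>lborel)"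
  proof (intro nn_integral_mono)
    fix Z :: "complex^'n^'n"
    let ?k = "\<lambda>t. ennreal (if 0 < 1 - t\<^sup>2 * q Z then (1 - t\<^sup>2 * q Z) powr s else 0)"
    have "(\<integral>\<^sup>+t. indicator {1/2..1::real} t * g (E t Z) \<partial>lborel)
       \<le> (\<integral>\<^sup>+t. (indicator (masked_domain S) Z * ennreal (p S Z powr s)) * (indicator {1/2..1::real} t * ?k t) \<partial>lborel)"
    proof (intro nn_integral_mono)
      fix t :: real
      show "indicator {1/2..1::real} t * g (E t Z)
        \<le> (indicator (masked_domain S) Z * ennreal (p S Z powr s)) * (indicator {1/2..1::real} t * ?k t)"
      proof (cases "t \<in> {1/2..1}")
        case True
        then show ?thesis using point[of t Z] by (simp only: indicator_simps(1) mult_1)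
      next
        case False
        then show ?thesis by (simp only: indicator_simps(2) mult_zero_left mult_zero_right order_refl not_False_eq_True)
      qed
    qed
    also have "\<dots> = indicator (masked_domain S) Z * ennreal (p S Z powr s) * (\<integral>\<^sup>+t. indicator {1/2..1::real} t * ?k t \<partial>lborel)"
      by (rule nn_integral_cmult) measurable
    also have "\<dots> \<le> indicator (masked_domain S) Z * ennreal (p S Z powr s) * ennreal ?C"
      by (intro mult_left_mono nn_integral_quadratic_powr_bound s) simp
    finally show "(\<integral>\<^sup>+t. indicator {1/2..1::real} t * g (E t Z) \<partial>lborel)
      \<le> indicator (masked_domain S) Z * ennreal (p S Z powr s) * ennreal ?C" .
  qed
  also have "\<dots> = ennreal ?C * masked_integral s S"
    by (simp add: nn_integral_multc masked_integral_def p_def mult.commute)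
  finally have half: "ennreal (1/2) * masked_integral s ?S \<le> ennreal ?C * masked_integral s S"
    by (simp add: masked_integral_def g_def p_def)
  have "masked_integral s ?S = ennreal 2 * (ennreal (1/2) * masked_integral s ?S)"
    by (simp add: mult.assoc[symmetric] ennreal_mult[symmetric] del: ennreal_half ennreal_numeral)
  also have "\<dots> \<le> ennreal 2 * (ennreal ?C * masked_integral s S)"
    by (intro mult_left_mono half) simp
  also have "\<dots> = ennreal (2 * ?C) * masked_integral s S"
    using C by (simp only: ennreal_mult[of 2 ?C] mult.assoc)
  finally show ?thesis .
qed

lemma norm_matrix_le_entries:
  fixes Z :: "complex^'n^'n"
  assumes "\<And>j k. norm (Z $ j $ k) \<le> b"
  shows "norm Z \<le> real CARD('n) * (real CARD('n) * b)"
proof -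
  have row: "norm (Z $ j) \<le> real CARD('n) * b" for j
  proof -
    have "norm (Z $ j) \<le> (\<Sum>k\<in>UNIV. norm (Z $ j $ k))"
      unfolding norm_vec_def[of "Z $ j"] by (rule L2_set_le_sum) simp
    also have "\<dots> \<le> real CARD('n) * b" by (rule sum_bounded_above) (rule assms)
    finally show ?thesis .
  qed
  have "norm Z \<le> (\<Sum>j\<in>UNIV. norm (Z $ j))"
    unfolding norm_vec_def[of Z] by (rule L2_set_le_sum) simp
  also have "\<dots> \<le> real CARD('n) * (real CARD('n) * b)" by (rule sum_bounded_above) (rule row)
  finally show ?thesis .
qed

lemma masked_integral_finite:
  fixes S :: "'n::finite set"
  assumes s: "-1 < s" "s < 0"
  shows "masked_integral s S < \<infinity>"
  using finite[of S]
proof (induction S rule: finite_induct)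
  case empty
  let ?B = "cball (0 :: complex^'n^'n) (real CARD('n) * (real CARD('n) * 2))"
  have "row_scale (row_mask {}) Z = 0" for Z :: "complex^'n^'n"
    by (simp add: row_scale_def row_mask_def vec_eq_iff)
  moreover have "weight (0 :: complex^'n^'n) = 1"
  proof -
    have "mat 1 - (0 :: complex^'n^'n) ** conj_transpose 0 = mat 1"
      by (simp add: vec_eq_iff matrix_matrix_mult_def)
    then show ?thesis by (simp add: weight_def)
  qed
  ultimately have "masked_integral s ({} :: 'n set) = (\<integral>\<^sup>+Z. indicator (masked_domain {}) (Z :: complex^'n^'n) \<partial>lborel)"
    by (simp add: masked_integral_def)
  also have "\<dots> = emeasure lborel (masked_domain {} :: (complex^'n^'n) set)"
    by (rule nn_integral_indicator) simp
  also have "\<dots> \<le> emeasure lborel ?B"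
    by (intro emeasure_mono) (auto simp: masked_domain_def dist_norm intro!: norm_matrix_le_entries)
  also have "\<dots> < \<infinity>" by (rule emeasure_lborel_cball_finite)
  finally show ?case .
next
  case (insert i S)
  then show ?case
    by (intro le_less_trans[OF masked_integral_insert[OF insert.hyps(2) s]]) (simp add: ennreal_mult_less_top)
qed

lemma cartan_domain_bounded: "cartan_domain \<subseteq> cball (0 :: complex^'n^'n) (real CARD('n) * real CARD('n))"
  using norm_matrix_le_entries[where b=1 and 'n='n] cartan_domain_entry by (force intro: less_imp_le)

text \<open>
  For negative exponents all rows are inserted one after the other, starting from the volume of a box.
  Otherwise the integrand is bounded on a bounded domain.
\<close>

lemma weight_integral_finite:
  assumes s: "-1 < s"
  shows "(\<integral>\<^sup>+Z. indicator cartan_domain (Z :: complex^'n^'n) * ennreal (weight Z powr s) \<partial>lborel) < \<infinity>"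
proof (cases "s < 0")
  case True
  have "row_scale (row_mask UNIV) Z = Z" for Z :: "complex^'n^'n"
    by (simp add: row_scale_def row_mask_def)
  then have "masked_integral s (UNIV :: 'n set) = (\<integral>\<^sup>+Z. indicator cartan_domain (Z :: complex^'n^'n) * ennreal (weight Z powr s) \<partial>lborel)"
    by (simp add: masked_integral_def masked_domain_def)
  then show ?thesis using masked_integral_finite[OF s True, of "UNIV :: 'n set"] by simp
next
  case False
  let ?B = "cball (0 :: complex^'n^'n) (real CARD('n) * real CARD('n))"
  have "bounded (weight ` ?B)"
    by (intro compact_imp_bounded compact_continuous_image continuous_on_subset[OF continuous_weight]) auto
  then obtain M where M: "\<And>Z. Z \<in> ?B \<Longrightarrow> norm (weight Z) \<le> M"
    unfolding bounded_iff by blast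
  have "(\<integral>\<^sup>+Z. indicator cartan_domain (Z :: complex^'n^'n) * ennreal (weight Z powr s) \<partial>lborel)
     \<le> (\<integral>\<^sup>+Z. ennreal (M powr s) * indicator ?B Z \<partial>lborel)"
  proof (intro nn_integral_mono)
    fix Z :: "complex^'n^'n"
    show "indicator cartan_domain Z * ennreal (weight Z powr s) \<le> ennreal (M powr s) * indicator ?B Z"
    proof (cases "Z \<in> cartan_domain")
      case True
      then have "Z \<in> ?B" using cartan_domain_bounded by blast
      moreover have "weight Z powr s \<le> M powr s"
        using False M[OF \<open>Z \<in> ?B\<close>] weight_pos[OF True] by (intro powr_mono2) auto
      ultimately show ?thesis using True by (simp add: ennreal_leI del: mem_cball)
    qed simp
  qed
  also have "\<dots> < \<infinity>"
    using emeasure_lborel_cball_finite[of "0 :: complex^'n^'n" "real CARD('n) * real CARD('n)"]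
    by (subst nn_integral_cmult_indicator) (simp_all add: ennreal_mult_less_top)
  finally show ?thesis .
qed

lemma weight_integral_nonzero:
  "(\<integral>\<^sup>+Z. indicator cartan_domain (Z :: complex^'n^'n) * ennreal (weight Z powr s) \<partial>lborel) \<noteq> 0"
proof
  have [measurable]: "weight \<in> borel_measurable (borel :: (complex^'n^'n) measure)"
    using continuous_weight by (rule borel_measurable_continuous_onI)
  have [measurable]: "cartan_domain \<in> sets (borel :: (complex^'n^'n) measure)"
    using open_cartan_domain by (rule borel_open)
  assume "(\<integral>\<^sup>+Z. indicator cartan_domain (Z :: complex^'n^'n) * ennreal (weight Z powr s) \<partial>lborel) = 0"
  then have "AE Z in lborel. indicator cartan_domain (Z :: complex^'n^'n) * ennreal (weight Z powr s) = 0"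
    by (subst (asm) nn_integral_0_iff_AE) auto
  then have "AE Z in lborel. (Z :: complex^'n^'n) \<notin> cartan_domain"
    by eventually_elim (metis ennreal_eq_0_iff indicator_simps(1) less_irrefl mult_1 not_le powr_gt_zero weight_pos)
  then have "emeasure lborel (cartan_domain :: (complex^'n^'n) set) = 0"
    by (subst (asm) AE_iff_measurable[of "cartan_domain :: (complex^'n^'n) set"]) auto
  moreover obtain e where e: "e > 0" "ball 0 e \<subseteq> (cartan_domain :: (complex^'n^'n) set)"
    using open_cartan_domain zero_in_cartan_domain open_contains_ball by blast
  moreover have "emeasure lborel (ball 0 e :: (complex^'n^'n) set) \<le> emeasure lborel (cartan_domain :: (complex^'n^'n) set)"
    using e by (intro emeasure_mono) auto
  moreover have "emeasure lborel (ball 0 e :: (complex^'n^'n) set) \<noteq> 0"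
    using e by (simp add: emeasure_ball less_imp_neq[OF unit_ball_vol_pos, symmetric])
  ultimately show False by simp
qed

section \<open>The normalised measure and its square-integrable functions\<close>

lemma borel_measurable_weight [measurable]: "weight \<in> borel_measurable (borel :: (complex^'n^'n) measure)"
  using continuous_weight by (rule borel_measurable_continuous_onI)

lemma borel_cartan_domain [measurable]: "cartan_domain \<in> sets (borel :: (complex^'n^'n) measure)"
  using open_cartan_domain by (rule borel_open)

lemma weighted_volume_weight:
  "(weighted_volume c \<nu> :: (complex^'n^'n) measure) = density (lebesgue_on cartan_domain)
     (\<lambda>Z. ennreal (c * weight Z powr (\<nu> - 2 * real CARD('n))))"
  by (simp add: weighted_volume_def weight_def)

lemma borel_imp_lebesgue_on:
  "f \<in> borel_measurable borel \<Longrightarrow> f \<in> borel_measurable (lebesgue_on A)"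
  by (rule measurable_restrict_space1) (rule measurable_completion, simp)

lemma emeasure_weighted_volume:
  assumes "0 \<le> c"
  shows "emeasure (weighted_volume c \<nu> :: (complex^'n^'n) measure) cartan_domain
    = ennreal c * (\<integral>\<^sup>+Z. indicator cartan_domain (Z :: complex^'n^'n) *
        ennreal (weight Z powr (\<nu> - 2 * real CARD('n))) \<partial>lborel)"
proof -
  let ?s = "\<nu> - 2 * real CARD('n)"
  let ?D = "cartan_domain :: (complex^'n^'n) set"
  have D: "?D \<inter> space lebesgue \<in> sets lebesgue" by simp
  have "emeasure (weighted_volume c \<nu> :: (complex^'n^'n) measure) ?D
    = (\<integral>\<^sup>+Z. ennreal (c * weight Z powr ?s) * indicator ?D Z \<partial>lebesgue_on ?D)"
    unfolding weighted_volume_weight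
    by (rule emeasure_density) (auto intro!: borel_imp_lebesgue_on simp: sets_restrict_space_iff)
  also have "\<dots> = (\<integral>\<^sup>+Z. ennreal (c * weight Z powr ?s) * indicator ?D Z * indicator ?D Z \<partial>lebesgue)"
    by (rule nn_integral_restrict_space[OF D])
  also have "\<dots> = (\<integral>\<^sup>+Z. ennreal (c * weight Z powr ?s) * indicator ?D Z * indicator ?D Z \<partial>lborel)"
    by (rule nn_integral_completion)
  also have "\<dots> = (\<integral>\<^sup>+Z. ennreal c * (indicator ?D Z * ennreal (weight Z powr ?s)) \<partial>lborel)"
    using assms by (intro nn_integral_cong) (auto simp: indicator_def ennreal_mult)
  also have "\<dots> = ennreal c * (\<integral>\<^sup>+Z. indicator ?D Z * ennreal (weight Z powr ?s) \<partial>lborel)"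
    by (rule nn_integral_cmult) simp
  finally show ?thesis .
qed

text \<open>
  The normalised measure is given by a definite description of its constant. The locale records the
  constant and the measure that this description denotes.
\<close>

locale bergman =
  fixes \<nu> c :: real and M :: "(complex^'n::finite^'n) measure"
  assumes c_pos: "0 < c" and M_eq: "M = weighted_volume c \<nu>"
    and bergman_measure_eq: "bergman_measure \<nu> = M"
    and prob: "emeasure M cartan_domain = 1"

lemma bergman_exists:
  assumes "\<nu> > 2 * real CARD('n::finite) - 1"
  shows "\<exists>c. bergman \<nu> c (bergman_measure \<nu> :: (complex^'n^'n) measure)"
proof -
  define N where "N = (\<integral>\<^sup>+Z. indicator cartan_domain (Z :: complex^'n^'n) *
        ennreal (weight Z powr (\<nu> - 2 * real CARD('n))) \<partial>lborel)"
  have fin: "N < \<infinity>" unfolding N_def using assms by (intro weight_integral_finite) simp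
  have nz: "N \<noteq> 0" unfolding N_def by (rule weight_integral_nonzero)
  define r where "r = enn2real N"
  have N: "N = ennreal r" using fin by (simp add: r_def)
  have r: "r > 0" using fin nz unfolding r_def enn2real_positive_iff by (auto simp: zero_less_iff_neq_zero)
  have em: "emeasure (weighted_volume c \<nu> :: (complex^'n^'n) measure) cartan_domain = ennreal (c * r)" if "0 < c" for c
    using that r unfolding emeasure_weighted_volume[OF less_imp_le[OF that]] N_def[symmetric] N
    by (simp add: ennreal_mult)
  have iff: "0 < c \<and> emeasure (weighted_volume c \<nu> :: (complex^'n^'n) measure) cartan_domain = 1 \<longleftrightarrow> c = 1 / r" for c
  proof -
    have "0 < c \<Longrightarrow> (ennreal (c * r) = 1) = (c = 1 / r)"
      using r by (simp add: field_simps flip: ennreal_1)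
    then show ?thesis using em[of c] r by auto
  qed
  then have "(THE c. 0 < c \<and> emeasure (weighted_volume c \<nu> :: (complex^'n^'n) measure) cartan_domain = 1) = 1 / r"
    by simp
  then have "(bergman_measure \<nu> :: (complex^'n^'n) measure) = weighted_volume (1 / r) \<nu>"
    by (simp add: bergman_measure_def)
  then have "bergman \<nu> (1 / r) (bergman_measure \<nu> :: (complex^'n^'n) measure)"
    using iff[of "1 / r"] r by (simp add: bergman_def)
  then show ?thesis by blast
qed

context bergman
begin

definition dens :: "complex^'n^'n \<Rightarrow> real" where
  "dens Z = c * weight Z powr (\<nu> - 2 * real CARD('n))"

lemma M_density: "M = density (lebesgue_on cartan_domain) (\<lambda>Z. ennreal (dens Z))"
  by (simp add: M_eq weighted_volume_weight dens_def)

lemma borel_dens [measurable]: "dens \<in> borel_measurable borel"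
  unfolding dens_def by measurable

lemma dens_nonneg: "0 \<le> dens Z"
  using c_pos by (simp add: dens_def)

lemma dens_pos: "Z \<in> cartan_domain \<Longrightarrow> 0 < dens Z"
  using c_pos weight_pos[of Z] by (simp add: dens_def)

lemma space_M: "space M = cartan_domain"
  by (simp add: M_density)

lemma sets_M: "sets M = sets (lebesgue_on cartan_domain)"
  unfolding M_density by (rule sets_density)

lemma finite_measure_M: "finite_measure M"
  by (rule finite_measureI) (simp add: space_M prob)

lemma borel_imp_M: "f \<in> borel_measurable borel \<Longrightarrow> f \<in> borel_measurable M"
  unfolding measurable_cong_sets[OF sets_M refl] by (rule borel_imp_lebesgue_on)

lemma AE_M_iff: "(AE Z in M. P Z) \<longleftrightarrow> (AE Z in lebesgue_on cartan_domain. P Z)"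
proof -
  have "(\<lambda>Z. ennreal (dens Z)) \<in> borel_measurable (lebesgue_on cartan_domain)"
    by (intro borel_imp_lebesgue_on) measurable
  then have "(AE Z in M. P Z) \<longleftrightarrow> (AE Z in lebesgue_on cartan_domain. 0 < ennreal (dens Z) \<longrightarrow> P Z)"
    unfolding M_density by (rule AE_density)
  also have "\<dots> \<longleftrightarrow> (AE Z in lebesgue_on cartan_domain. P Z)"
    by (intro AE_cong) (simp add: dens_pos)
  finally show ?thesis .
qed

lemma AE_M_domain: "(\<And>Z. Z \<in> cartan_domain \<Longrightarrow> P Z) \<Longrightarrow> AE Z in M. P Z"
  by (rule AE_I2) (simp add: space_M)

lemma
  fixes f :: "complex^'n^'n \<Rightarrow> complex"
  assumes f[measurable]: "f \<in> borel_measurable borel"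
  shows integrable_M: "integrable M f \<longleftrightarrow> integrable lborel (\<lambda>Z. (indicator cartan_domain Z * dens Z) *\<^sub>R f Z)"
    and integral_M: "(\<integral>Z. f Z \<partial>M) = (\<integral>Z. (indicator cartan_domain Z * dens Z) *\<^sub>R f Z \<partial>lborel)"
proof -
  have D: "cartan_domain \<inter> space lebesgue \<in> sets (lebesgue :: (complex^'n^'n) measure)" by simp
  have m: "f \<in> borel_measurable (lebesgue_on cartan_domain)" "dens \<in> borel_measurable (lebesgue_on cartan_domain)"
    by (intro borel_imp_lebesgue_on; measurable)+
  have nn: "AE Z in lebesgue_on cartan_domain. 0 \<le> dens Z" by (simp add: dens_nonneg)
  have m2: "(\<lambda>Z. indicator cartan_domain Z *\<^sub>R dens Z *\<^sub>R f Z) \<in> lborel \<rightarrow>\<^sub>M borel"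
    by measurable
  have "integrable M f \<longleftrightarrow> integrable (lebesgue_on cartan_domain) (\<lambda>Z. dens Z *\<^sub>R f Z)"
    unfolding M_density by (rule integrable_density[OF m nn])
  also have "\<dots> \<longleftrightarrow> integrable lebesgue (\<lambda>Z. indicator cartan_domain Z *\<^sub>R dens Z *\<^sub>R f Z)"
    by (rule integrable_restrict_space[OF D])
  also have "\<dots> \<longleftrightarrow> integrable lborel (\<lambda>Z. indicator cartan_domain Z *\<^sub>R dens Z *\<^sub>R f Z)"
    by (rule integrable_completion[OF m2])
  finally show "integrable M f \<longleftrightarrow> integrable lborel (\<lambda>Z. (indicator cartan_domain Z * dens Z) *\<^sub>R f Z)"
    by simp
  have "(\<integral>Z. f Z \<partial>M) = (\<integral>Z. dens Z *\<^sub>R f Z \<partial>lebesgue_on cartan_domain)"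
    unfolding M_density by (rule integral_density[OF m nn])
  also have "\<dots> = (\<integral>Z. indicator cartan_domain Z *\<^sub>R dens Z *\<^sub>R f Z \<partial>lebesgue)"
    by (rule integral_restrict_space[OF D])
  also have "\<dots> = (\<integral>Z. indicator cartan_domain Z *\<^sub>R dens Z *\<^sub>R f Z \<partial>lborel)"
    by (rule integral_completion[OF m2])
  finally show "(\<integral>Z. f Z \<partial>M) = (\<integral>Z. (indicator cartan_domain Z * dens Z) *\<^sub>R f Z \<partial>lborel)"
    by simp
qed

lemma dens_bounded_below:
  assumes "compact K" "K \<subseteq> cartan_domain"
  obtains \<delta> where "\<delta> > 0" "\<And>Z. Z \<in> K \<Longrightarrow> \<delta> \<le> dens Z"
proof (cases "K = {}")
  case True
  then show ?thesis using that[of 1] by simp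
next
  case False
  have "continuous_on K dens"
    unfolding dens_def using assms(2) weight_pos
    by (intro continuous_intros continuous_on_subset[OF continuous_weight]) force+
  then obtain W where "W \<in> K" "\<And>Z. Z \<in> K \<Longrightarrow> dens W \<le> dens Z"
    using continuous_attains_inf[OF assms(1) False] by metis
  then show ?thesis using that[of "dens W"] dens_pos assms(2) by blast
qed

abbreviation L2 :: "(complex^'n^'n \<Rightarrow> complex) set" where "L2 \<equiv> L2_space \<nu>"
abbreviation ip :: "(complex^'n^'n \<Rightarrow> complex) \<Rightarrow> (complex^'n^'n \<Rightarrow> complex) \<Rightarrow> complex" where "ip \<equiv> L2_inner \<nu>"
abbreviation nrm :: "(complex^'n^'n \<Rightarrow> complex) \<Rightarrow> real" where "nrm \<equiv> L2_norm \<nu>"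

lemma L2_iff: "f \<in> L2 \<longleftrightarrow> f \<in> borel_measurable M \<and> integrable M (\<lambda>Z. (norm (f Z))\<^sup>2)"
  unfolding L2_space_def bergman_measure_eq by blast

lemma L2_inner_M: "ip f g = (\<integral>Z. f Z * cnj (g Z) \<partial>M)"
  unfolding L2_inner_def bergman_measure_eq ..

lemma L2_norm_M: "nrm f = sqrt (\<integral>Z. (norm (f Z))\<^sup>2 \<partial>M)"
  unfolding L2_norm_def bergman_measure_eq ..

lemma L2_measurable: "f \<in> L2 \<Longrightarrow> f \<in> borel_measurable M"
  by (simp add: L2_iff)

lemma L2_integrable_mult:
  assumes "f \<in> L2" "g \<in> L2"
  shows "integrable M (\<lambda>Z. f Z * cnj (g Z))"
proof (rule Bochner_Integration.integrable_bound)
  show "integrable M (\<lambda>Z. (norm (f Z))\<^sup>2 + (norm (g Z))\<^sup>2)"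
    using assms by (intro Bochner_Integration.integrable_add) (auto simp: L2_iff)
  have [measurable]: "f \<in> borel_measurable M" "g \<in> borel_measurable M"
    using assms by (auto simp: L2_iff)
  have cm: "cnj \<in> borel_measurable borel"
    by (intro borel_measurable_continuous_onI continuous_intros)
  show "(\<lambda>Z. f Z * cnj (g Z)) \<in> borel_measurable M"
    using measurable_compose[OF L2_measurable[OF assms(2)] cm] by measurable
  show "AE Z in M. norm (f Z * cnj (g Z)) \<le> norm ((norm (f Z))\<^sup>2 + (norm (g Z))\<^sup>2)"
  proof (rule AE_I2)
    fix Z
    have "2 * (norm (f Z) * norm (g Z)) \<le> (norm (f Z))\<^sup>2 + (norm (g Z))\<^sup>2"
      using sum_squares_bound[of "norm (f Z)" "norm (g Z)"] by (simp add: mult.assoc)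
    moreover have "0 \<le> norm (f Z) * norm (g Z)" by (intro mult_nonneg_nonneg norm_ge_zero)
    ultimately have "norm (f Z) * norm (g Z) \<le> (norm (f Z))\<^sup>2 + (norm (g Z))\<^sup>2" by linarith
    then show "norm (f Z * cnj (g Z)) \<le> norm ((norm (f Z))\<^sup>2 + (norm (g Z))\<^sup>2)"
      by (simp add: norm_mult)
  qed
qed

lemma L2_bound:
  assumes "g \<in> L2" "f \<in> borel_measurable M"
    and "\<And>Z. Z \<in> cartan_domain \<Longrightarrow> norm (f Z) \<le> C * norm (g Z)"
  shows "f \<in> L2"
  unfolding L2_iff
proof
  show "integrable M (\<lambda>Z. (norm (f Z))\<^sup>2)"
  proof (rule Bochner_Integration.integrable_bound)
    show "integrable M (\<lambda>Z. C\<^sup>2 * (norm (g Z))\<^sup>2)" using assms(1) by (simp add: L2_iff)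
    show "(\<lambda>Z. (norm (f Z))\<^sup>2) \<in> borel_measurable M" using assms(2) by measurable
    show "AE Z in M. norm ((norm (f Z))\<^sup>2) \<le> norm (C\<^sup>2 * (norm (g Z))\<^sup>2)"
      by (rule AE_M_domain) (simp add: power_mult_distrib[symmetric] power_mono assms(3))
  qed
qed (rule assms)

lemma L2_add:
  assumes "f \<in> L2" "g \<in> L2"
  shows "(\<lambda>Z. f Z + g Z) \<in> L2"
  unfolding L2_iff
proof
  have [measurable]: "f \<in> borel_measurable M" "g \<in> borel_measurable M"
    using assms by (auto simp: L2_iff)
  show m: "(\<lambda>Z. f Z + g Z) \<in> borel_measurable M" by measurable
  show "integrable M (\<lambda>Z. (norm (f Z + g Z))\<^sup>2)"
  proof (rule Bochner_Integration.integrable_bound)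
    show "integrable M (\<lambda>Z. 2 * (norm (f Z))\<^sup>2 + 2 * (norm (g Z))\<^sup>2)"
      using assms by (intro Bochner_Integration.integrable_add integrable_mult_right) (auto simp: L2_iff)
    show "(\<lambda>Z. (norm (f Z + g Z))\<^sup>2) \<in> borel_measurable M" by measurable
    show "AE Z in M. norm ((norm (f Z + g Z))\<^sup>2) \<le> norm (2 * (norm (f Z))\<^sup>2 + 2 * (norm (g Z))\<^sup>2)"
    proof (rule AE_I2)
      fix Z
      have "(norm (f Z + g Z))\<^sup>2 \<le> (norm (f Z) + norm (g Z))\<^sup>2"
        by (intro power_mono norm_triangle_ineq norm_ge_zero)
      also have "\<dots> \<le> 2 * (norm (f Z))\<^sup>2 + 2 * (norm (g Z))\<^sup>2"
        using sum_squares_bound[of "norm (f Z)" "norm (g Z)"] by (simp add: power2_sum)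
      finally show "norm ((norm (f Z + g Z))\<^sup>2) \<le> norm (2 * (norm (f Z))\<^sup>2 + 2 * (norm (g Z))\<^sup>2)"
        by simp
    qed
  qed
qed

lemma L2_mult_bounded:
  assumes "f \<in> L2" "a \<in> borel_measurable M" "\<And>Z. Z \<in> cartan_domain \<Longrightarrow> norm (a Z) \<le> C"
  shows "(\<lambda>Z. a Z * f Z) \<in> L2"
proof (rule L2_bound[OF assms(1)])
  show "(\<lambda>Z. a Z * f Z) \<in> borel_measurable M"
    using assms(2) L2_measurable[OF assms(1)] by measurable
  show "norm (a Z * f Z) \<le> C * norm (f Z)" if "Z \<in> cartan_domain" for Z
    using assms(3)[OF that] by (simp add: norm_mult mult_right_mono)
qed

lemma L2_scale: "f \<in> L2 \<Longrightarrow> (\<lambda>Z. k * f Z) \<in> L2"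
  by (rule L2_mult_bounded[where C="norm k"]) auto

lemma L2_diff:
  assumes "f \<in> L2" "g \<in> L2"
  shows "(\<lambda>Z. f Z - g Z) \<in> L2"
  using L2_add[OF assms(1) L2_scale[OF assms(2), of "-1"]] by simp

lemma L2_norm_nonneg: "0 \<le> nrm f"
  by (simp add: L2_norm_M)

lemma L2_norm_square: "(nrm f)\<^sup>2 = (\<integral>Z. (norm (f Z))\<^sup>2 \<partial>M)"
  by (simp add: L2_norm_M)

lemma L2_inner_self: "ip f f = complex_of_real ((nrm f)\<^sup>2)"
  by (simp add: L2_inner_M L2_norm_square complex_norm_square[symmetric] del: of_real_power)

lemma L2_inner_cnj: "ip g f = cnj (ip f g)"
  unfolding L2_inner_M Bochner_Integration.integral_cnj[symmetric] by (simp add: mult.commute)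

lemma
  assumes "f \<in> L2" "g \<in> L2" "h \<in> L2"
  shows L2_inner_add_left: "ip (\<lambda>Z. f Z + g Z) h = ip f h + ip g h"
    and L2_inner_diff_left: "ip (\<lambda>Z. f Z - g Z) h = ip f h - ip g h"
    and L2_inner_diff_right: "ip h (\<lambda>Z. f Z - g Z) = ip h f - ip h g"
  using assms by (simp_all add: L2_inner_M algebra_simps L2_integrable_mult)

lemma L2_inner_scale_left: "ip (\<lambda>Z. k * f Z) g = k * ip f g"
  by (simp add: L2_inner_M mult.assoc)

lemma L2_inner_scale_right: "ip f (\<lambda>Z. k * g Z) = cnj k * ip f g"
  by (simp add: L2_inner_M mult.left_commute)

lemma L2_norm_scale: "nrm (\<lambda>Z. k * f Z) = norm k * nrm f"
  by (simp add: L2_norm_M norm_mult power_mult_distrib real_sqrt_mult)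

lemma L2_norm_diff_scale_square:
  assumes f: "f \<in> L2" and g: "g \<in> L2"
  shows "(nrm (\<lambda>Z. f Z - k * g Z))\<^sup>2
     = (nrm f)\<^sup>2 - 2 * Re (cnj k * ip f g) + (norm k)\<^sup>2 * (nrm g)\<^sup>2"
proof -
  note kg = L2_scale[OF g, of k]
  let ?h = "\<lambda>Z. f Z - k * g Z"
  have "ip ?h ?h = ip f f - cnj k * ip f g - k * ip g f + k * cnj k * ip g g"
    by (simp add: L2_inner_diff_left[OF f kg L2_diff[OF f kg]] L2_inner_diff_right[OF f kg f]
        L2_inner_diff_right[OF f kg kg] L2_inner_scale_left L2_inner_scale_right algebra_simps)
  also have "k * ip g f = cnj (cnj k * ip f g)"
    by (simp add: L2_inner_cnj[of g f])
  also have "k * cnj k = complex_of_real ((norm k)\<^sup>2)" by (rule complex_norm_square[symmetric])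
  finally have "complex_of_real ((nrm ?h)\<^sup>2) = complex_of_real ((nrm f)\<^sup>2)
      - (cnj k * ip f g + cnj (cnj k * ip f g)) + complex_of_real ((norm k)\<^sup>2) * complex_of_real ((nrm g)\<^sup>2)"
    unfolding L2_inner_self by (simp only: diff_diff_eq)
  also have "\<dots> = complex_of_real ((nrm f)\<^sup>2 - 2 * Re (cnj k * ip f g) + (norm k)\<^sup>2 * (nrm g)\<^sup>2)"
    unfolding complex_add_cnj by simp
  finally show ?thesis by (simp only: of_real_eq_iff)
qed

lemma L2_Cauchy_Schwarz:
  assumes f: "f \<in> L2" and g: "g \<in> L2"
  shows "norm (ip f g) \<le> nrm f * nrm g"
proof -
  define h where "h = ip f g"
  define a where "a = (nrm f)\<^sup>2"
  define b where "b = (nrm g)\<^sup>2"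
  have ab: "0 \<le> a" "0 \<le> b" by (auto simp: a_def b_def)
  have ineq: "0 \<le> a - 2 * t * (norm h)\<^sup>2 + t\<^sup>2 * (norm h)\<^sup>2 * b" for t :: real
  proof -
    have "Re (cnj (complex_of_real t * h) * h) = t * (norm h)\<^sup>2"
    proof -
      have "Re (cnj (complex_of_real t * h) * h) = t * ((Re h)\<^sup>2 + (Im h)\<^sup>2)"
        by (simp add: power2_eq_square algebra_simps)
      then show ?thesis by (simp only: cmod_power2)
    qed
    moreover have "(norm (complex_of_real t * h))\<^sup>2 = t\<^sup>2 * (norm h)\<^sup>2"
      by (simp add: norm_mult power_mult_distrib)
    ultimately have "(nrm (\<lambda>Z. f Z - (complex_of_real t * h) * g Z))\<^sup>2 = a - 2 * t * (norm h)\<^sup>2 + t\<^sup>2 * (norm h)\<^sup>2 * b"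
      using L2_norm_diff_scale_square[OF f g, of "complex_of_real t * h"]
      by (simp only: h_def[symmetric] a_def[symmetric] b_def[symmetric] mult.assoc)
    then show ?thesis by (metis zero_le_power2)
  qed
  have "(norm h)\<^sup>2 \<le> a * b"
  proof (cases "b = 0")
    case True
    have "norm h = 0"
    proof (rule ccontr)
      assume "norm h \<noteq> 0"
      then have "0 < (norm h)\<^sup>2" by simp
      then have "2 * ((a + 1) / (norm h)\<^sup>2) * (norm h)\<^sup>2 = 2 * (a + 1)" by simp
      with ineq[of "(a + 1) / (norm h)\<^sup>2"] True have "0 \<le> a - 2 * (a + 1)" by simp
      with ab show False by simp
    qed
    then show ?thesis using True by simp
  next
    case False
    then have "0 < b" using ab by simp
    with ineq[of "1 / b"] show ?thesis by (simp add: field_simps power2_eq_square)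
  qed
  then have "(norm h)\<^sup>2 \<le> (nrm f * nrm g)\<^sup>2"
    by (simp add: a_def b_def power_mult_distrib)
  then show ?thesis
    unfolding h_def by (rule power2_le_imp_le) (simp add: L2_norm_nonneg)
qed

lemma L2_norm_triangle:
  assumes f: "f \<in> L2" and g: "g \<in> L2"
  shows "nrm (\<lambda>Z. f Z + g Z) \<le> nrm f + nrm g"
proof (rule power2_le_imp_le)
  have "(nrm (\<lambda>Z. f Z + g Z))\<^sup>2 = (nrm f)\<^sup>2 + 2 * Re (ip f g) + (nrm g)\<^sup>2"
    using L2_norm_diff_scale_square[OF f g, of "-1"] by simp
  also have "\<dots> \<le> (nrm f)\<^sup>2 + 2 * (nrm f * nrm g) + (nrm g)\<^sup>2"
    using complex_Re_le_cmod[of "ip f g"] L2_Cauchy_Schwarz[OF f g] by simp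
  finally show "(nrm (\<lambda>Z. f Z + g Z))\<^sup>2 \<le> (nrm f + nrm g)\<^sup>2"
    by (simp add: power2_sum)
qed (simp add: L2_norm_nonneg)

end

section \<open>Holomorphic functions of a matrix variable\<close>

definition cscale :: "complex \<Rightarrow> complex^'n^'n \<Rightarrow> complex^'n^'n" where
  "cscale w V = (\<chi> i j. w * V $ i $ j)"

lemma cscale_row_scale: "cscale w = row_scale (\<lambda>_. w)"
  by (simp add: cscale_def row_scale_def fun_eq_iff)

lemma norm_cscale: "norm (cscale w V) = norm w * norm V"
proof -
  have "norm (cscale w V $ i) = norm w * norm (V $ i)" for i
    by (simp add: cscale_def norm_vec_def norm_mult L2_set_right_distrib)
  then show ?thesis
    unfolding norm_vec_def[of "cscale w V"] norm_vec_def[of V] by (simp add: L2_set_right_distrib)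
qed

lemma bounded_linear_cscale_left: "bounded_linear (\<lambda>w. cscale w V)"
  by (rule bounded_linear_intro[where K="norm V"])
     (simp_all add: cscale_def vec_eq_iff norm_cscale[unfolded cscale_def] algebra_simps)

lemma cscale_0 [simp]: "cscale 0 V = 0"
  by (simp add: cscale_def vec_eq_iff)

lemma continuous_cscale: "continuous_on A (\<lambda>w. Z + cscale w V)"
  by (intro continuous_intros bounded_linear.continuous_on[OF bounded_linear_cscale_left])

lemma matrix_holomorphic_slice:
  assumes "matrix_holomorphic_on f S"
  shows "(\<lambda>w. f (Z + cscale w V)) holomorphic_on {w. Z + cscale w V \<in> S}"
proof (rule holomorphic_onI)
  fix w assume "w \<in> {w. Z + cscale w V \<in> S}"
  then have "Z + cscale w V \<in> S" by simp
  then obtain f' where f': "(f has_derivative f') (at (Z + cscale w V))"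
    and lin: "\<And>c U. f' (cscale c U) = c * f' U"
    using assms unfolding matrix_holomorphic_on_def cscale_def by blast
  have commute: "(\<lambda>h. h * f' V) = (*) (f' V)"
    by (simp add: fun_eq_iff mult.commute)
  have aff: "((\<lambda>w. Z + cscale w V) has_derivative (\<lambda>h. cscale h V)) (at w)"
    using has_derivative_add[OF has_derivative_const bounded_linear_imp_has_derivative[OF bounded_linear_cscale_left]]
    by simp
  have "((\<lambda>w. f (Z + cscale w V)) has_derivative (\<lambda>h. f' (cscale h V))) (at w)"
    by (rule has_derivative_compose[OF aff f'])
  then have "((\<lambda>w. f (Z + cscale w V)) has_field_derivative (f' V)) (at w)"
    unfolding has_field_derivative_def lin commute .
  then show "(\<lambda>w. f (Z + cscale w V)) field_differentiable at w within {w. Z + cscale w V \<in> S}"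
    using field_differentiable_at_within field_differentiable_def by blast
qed

lemma matrix_holomorphic_slice_deriv:
  assumes "(f has_derivative f') (at Z)" "\<And>c U. f' (cscale c U) = c * f' U"
  shows "((\<lambda>w. f (Z + cscale w V)) has_field_derivative f' V) (at 0)"
proof -
  have commute: "(\<lambda>h. h * f' V) = (*) (f' V)"
    by (simp add: fun_eq_iff mult.commute)
  have aff: "((\<lambda>w. Z + cscale w V) has_derivative (\<lambda>h. cscale h V)) (at 0)"
    using has_derivative_add[OF has_derivative_const bounded_linear_imp_has_derivative[OF bounded_linear_cscale_left]]
    by simp
  have "((\<lambda>w. f (Z + cscale w V)) has_derivative (\<lambda>h. f' (cscale h V))) (at 0)"
    using assms(1) by (intro has_derivative_compose[OF aff]) simp
  then show ?thesis
    unfolding has_field_derivative_def assms(2) commute .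
qed

lemma matrix_holomorphic_imp_continuous_on:
  assumes "matrix_holomorphic_on f S" shows "continuous_on S f"
  using assms unfolding matrix_holomorphic_on_def
  by (meson continuous_at_imp_continuous_on has_derivative_continuous)

lemma circle_mean_value:
  assumes "open S" "cball 0 1 \<subseteq> S" "\<phi> holomorphic_on S"
  shows "((\<lambda>t. \<phi> (exp (2 * of_real pi * \<i> * of_real t))) has_integral \<phi> 0) {0..1}"
proof -
  have "((\<lambda>u. \<phi> u / (u - 0)) has_contour_integral (2 * of_real pi * \<i> * \<phi> 0)) (circlepath 0 1)"
    using assms(2,3) by (intro Cauchy_integral_circlepath_simple holomorphic_on_subset[OF assms(3)]) auto
  then have "((\<lambda>t. \<phi> (exp (2 * of_real pi * \<i> * of_real t)) / exp (2 * of_real pi * \<i> * of_real t)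
      * (2 * of_real pi * \<i> * exp (2 * of_real pi * \<i> * of_real t))) has_integral (2 * of_real pi * \<i> * \<phi> 0)) {0..1}"
    unfolding has_contour_integral_def
    by (rule has_integral_eq[rotated]) (simp add: vector_derivative_circlepath01, simp add: circlepath mult_ac)
  then have "((\<lambda>t. (2 * of_real pi * \<i>) * \<phi> (exp (2 * of_real pi * \<i> * of_real t))) has_integral (2 * of_real pi * \<i> * \<phi> 0)) {0..1}"
    by (rule has_integral_eq[rotated]) simp
  then have "((\<lambda>t. inverse (2 * of_real pi * \<i>) * ((2 * of_real pi * \<i>) * \<phi> (exp (2 * of_real pi * \<i> * of_real t))))
     has_integral (inverse (2 * of_real pi * \<i>) * (2 * of_real pi * \<i> * \<phi> 0))) {0..1}"
    by (rule has_integral_mult_right)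
  then show ?thesis by (simp add: field_simps)
qed

lemma continuous_scalings:
  fixes u :: "real \<Rightarrow> 'n::finite \<Rightarrow> complex"
  assumes "\<And>k. continuous_on UNIV (\<lambda>t. u t k)"
  shows "continuous_on UNIV (\<lambda>(t, Z). row_scale (u t) (Z :: complex^'n^'n))"
    and "continuous_on UNIV (\<lambda>(t, Z). col_scale (u t) (Z :: complex^'n^'n))"
proof -
  have *: "continuous_on UNIV (\<lambda>x :: real \<times> (complex^'n^'n). u (fst x) k)" for k
    using continuous_on_compose2[OF assms continuous_on_fst[OF continuous_on_id]] by auto
  show "continuous_on UNIV (\<lambda>(t, Z). row_scale (u t) (Z :: complex^'n^'n))"
    unfolding split_beta' row_scale_def by (intro continuous_intros *)
  show "continuous_on UNIV (\<lambda>(t, Z). col_scale (u t) (Z :: complex^'n^'n))"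
    unfolding split_beta' col_scale_def by (intro continuous_intros *)
qed

text \<open>
  A ball around the centre is invariant under multiplication of the displacement by phases, and on each
  of these circles the mean value property in one variable holds.
\<close>

lemma matrix_mean_value:
  fixes f :: "complex^'n^'n \<Rightarrow> complex"
  assumes S: "open S" and f: "matrix_holomorphic_on f S" and r: "0 < r" "cball Z r \<subseteq> S"
  shows "integrable lborel (\<lambda>V. indicator (ball 0 r) V *\<^sub>R f (Z + V))"
    and "(\<integral>V. indicator (ball 0 r) V *\<^sub>R f (Z + V) \<partial>lborel) = measure lborel (ball (0 :: complex^'n^'n) r) * f Z"
proof -
  let ?F = "\<lambda>V. indicator (ball 0 r) V *\<^sub>R f (Z + V)"
  let ?e = "\<lambda>t::real. exp (2 * of_real pi * \<i> * of_real t)"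
  have shift: "Z + V \<in> cball Z r \<longleftrightarrow> V \<in> cball 0 r" for V by (simp add: dist_norm)
  have cont: "continuous_on (cball 0 r) (\<lambda>V. f (Z + V))"
    using r(2) by (intro continuous_on_compose2[OF matrix_holomorphic_imp_continuous_on[OF f]] continuous_intros)
      (auto simp: shift[symmetric] subset_eq)
  have meas: "?F \<in> borel_measurable borel"
    by (rule borel_measurable_continuous_on_indicator) (auto intro: continuous_on_subset[OF cont])
  have "bounded ((\<lambda>V. f (Z + V)) ` cball 0 r)"
    by (intro compact_imp_bounded compact_continuous_image cont) simp
  then obtain B where B: "\<And>V. V \<in> cball 0 r \<Longrightarrow> norm (f (Z + V)) \<le> B"
    unfolding bounded_iff by blast
  show int: "integrable lborel ?F"
  proof (rule Bochner_Integration.integrable_bound)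
    show "integrable lborel (\<lambda>V :: complex^'n^'n. B * indicator (ball 0 r) V)"
      using emeasure_lborel_ball_finite[of "0 :: complex^'n^'n" r]
      by (intro integrable_mult_right integrable_real_indicator) auto
    show "?F \<in> borel_measurable lborel" using meas by simp
    show "AE V in lborel. norm (?F V) \<le> norm (B * indicator (ball 0 r) V)"
      using B by (intro AE_I2) (force simp: indicator_def intro: order_trans[OF _ abs_ge_self])
  qed
  have "(\<integral>V. indicator (ball 0 r) (V :: complex^'n^'n) *\<^sub>R f Z \<partial>lborel) = (\<integral>V. ?F V \<partial>lborel)"
  proof (rule circle_average_integral[OF int, where R="\<lambda>t. cscale (?e t)"])
    show "orthogonal_transformation (cscale (?e t) :: complex^'n^'n \<Rightarrow> _)" for t
      unfolding cscale_row_scale by (rule orthogonal_row_scale) (simp add: norm_exp_eq_Re)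
    show "continuous_on UNIV (\<lambda>(t, x :: complex^'n^'n). cscale (?e t) x)"
      unfolding cscale_row_scale by (intro continuous_scalings continuous_intros)
    show "(\<lambda>V. indicator (ball 0 r) V *\<^sub>R f Z) \<in> borel_measurable borel"
      by (rule borel_measurable_continuous_on_indicator) auto
    fix V :: "complex^'n^'n"
    have ball: "cscale (?e t) V \<in> ball 0 r \<longleftrightarrow> V \<in> ball 0 r" for t
      by (simp add: norm_cscale norm_exp_eq_Re)
    show "((\<lambda>t. ?F (cscale (?e t) V)) has_integral indicator (ball 0 r) V *\<^sub>R f Z) {0..1}"
    proof (cases "V \<in> ball 0 r")
      case True
      let ?S = "{w. Z + cscale w V \<in> S}"
      have op: "open ?S"
        using open_vimage[OF S continuous_cscale] by (simp add: vimage_def)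
      have sub: "cball 0 1 \<subseteq> ?S"
      proof
        fix w :: complex assume "w \<in> cball 0 1"
        then have "norm w * norm V \<le> 1 * r" using True by (intro mult_mono) auto
        then have "cscale w V \<in> cball 0 r" by (simp add: norm_cscale)
        then show "w \<in> ?S" using r(2) shift by blast
      qed
      have "((\<lambda>t. f (Z + cscale (?e t) V)) has_integral f (Z + cscale 0 V)) {0..1}"
        by (rule circle_mean_value[OF op sub matrix_holomorphic_slice[OF f]])
      then show ?thesis using True by (simp only: ball indicator_simps scaleR_one cscale_0 add_0_right)
    next
      case False
      then show ?thesis by (simp only: ball indicator_simps(2) not_False_eq_True scaleR_zero_left has_integral_0)
    qed
  qed
  also have "(\<integral>V. indicator (ball 0 r) (V :: complex^'n^'n) *\<^sub>R f Z \<partial>lborel) = measure lborel (ball (0 :: complex^'n^'n) r) * f Z"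
    by (simp add: emeasure_lborel_ball_finite scaleR_conv_of_real)
  finally show "(\<integral>V. ?F V \<partial>lborel) = measure lborel (ball (0 :: complex^'n^'n) r) * f Z" by simp
qed

text \<open>
  Weierstrass' theorem. Cauchy's inequality on complex lines bounds the derivative of a difference by
  the difference itself, so the derivatives are locally uniformly Cauchy as well.
\<close>

lemma matrix_holomorphic_sequence:
  fixes h :: "nat \<Rightarrow> complex^'n^'n \<Rightarrow> complex"
  assumes S: "open S" and hol: "\<And>k. matrix_holomorphic_on (h k) S"
    and cauchy: "\<And>Z. Z \<in> S \<Longrightarrow> \<exists>r>0. ball Z r \<subseteq> S \<and>
        (\<forall>e>0. \<exists>N. \<forall>m\<ge>N. \<forall>n\<ge>N. \<forall>W\<in>ball Z r. norm (h m W - h n W) \<le> e)"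
    and lim: "\<And>Z. Z \<in> S \<Longrightarrow> (\<lambda>k. h k Z) \<longlonglongrightarrow> g Z"
  shows "matrix_holomorphic_on g S"
  unfolding matrix_holomorphic_on_def
proof
  fix Z0 assume "Z0 \<in> S"
  then obtain r where r: "r > 0" "ball Z0 r \<subseteq> S"
    and uc: "\<And>e. e > 0 \<Longrightarrow> \<exists>N. \<forall>m\<ge>N. \<forall>n\<ge>N. \<forall>W\<in>ball Z0 r. norm (h m W - h n W) \<le> e"
    using cauchy[OF \<open>Z0 \<in> S\<close>] by blast
  define D where "D = (\<lambda>k Z. SOME f'. (h k has_derivative f') (at Z) \<and> (\<forall>c V. f' (cscale c V) = c * f' V))"
  have "(h k has_derivative D k Z) (at Z) \<and> (\<forall>c V. D k Z (cscale c V) = c * D k Z V)" if "Z \<in> S" for k Z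
  proof -
    have "\<exists>f'. (h k has_derivative f') (at Z) \<and> (\<forall>c V. f' (cscale c V) = c * f' V)"
      using hol[of k] that unfolding matrix_holomorphic_on_def cscale_def by (rule bspec)
    then show ?thesis unfolding D_def by (rule someI_ex)
  qed
  then have D: "(h k has_derivative D k Z) (at Z)" and Dlin: "D k Z (cscale c V) = c * D k Z V"
    if "Z \<in> S" for k Z c V using that by blast+
  define T where "T = ball Z0 (r/2)"
  have TS: "T \<subseteq> S" using r subset_ball[of "r/2" r Z0] by (auto simp: T_def)
  have bound: "norm (D m Z V - D n Z V) \<le> 4 * e / r * norm V"
    if e: "\<And>W. W \<in> ball Z0 r \<Longrightarrow> norm (h m W - h n W) \<le> e" and Z: "Z \<in> T" for m n Z V e
  proof (cases "V = 0")
    case True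
    have "D k Z 0 = 0" for k
      using D[of Z k] Z TS has_derivative_bounded_linear linear_simps(3) by blast
    then show ?thesis using True by simp
  next
    case False
    (* Z lies within r / 2 of Z0, and the disc of radius \<rho> moves it by at most r / 4 *)
    define \<rho> where "\<rho> = r / (4 * norm V)"
    have \<rho>: "\<rho> > 0" using r False by (simp add: \<rho>_def)
    define \<phi> where "\<phi> = (\<lambda>w. h m (Z + cscale w V) - h n (Z + cscale w V))"
    have inb: "Z + cscale w V \<in> ball Z0 r" if "norm w \<le> \<rho>" for w
    proof -
      have "norm w * norm V \<le> \<rho> * norm V" using that by (intro mult_right_mono) auto
      also have "\<dots> = r / 4" using False by (simp add: \<rho>_def)
      finally have "dist Z (Z + cscale w V) \<le> r / 4" by (simp add: dist_norm norm_cscale)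
      moreover have "dist Z0 Z < r / 2" using Z by (simp add: T_def)
      ultimately show ?thesis
        using dist_triangle[of Z0 "Z + cscale w V" Z] r(1) by simp
    qed
    have holk: "(\<lambda>w. h k (Z + cscale w V)) holomorphic_on cball 0 \<rho>" for k
      by (rule holomorphic_on_subset[OF matrix_holomorphic_slice[OF hol]]) (use inb r(2) in auto)
    have "norm ((deriv ^^ 1) \<phi> 0) \<le> fact 1 * e / \<rho> ^ 1"
    proof (rule Cauchy_inequality)
      show "\<phi> holomorphic_on ball 0 \<rho>"
        unfolding \<phi>_def by (intro holomorphic_intros holomorphic_on_subset[OF holk]) auto
      show "continuous_on (cball 0 \<rho>) \<phi>"
        unfolding \<phi>_def by (intro holomorphic_on_imp_continuous_on holomorphic_intros holk)
      show "norm (\<phi> w) \<le> e" if "norm (0 - w) = \<rho>" for w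
        unfolding \<phi>_def using that by (intro e inb) simp
    qed (rule \<rho>)
    moreover have "(\<phi> has_field_derivative (D m Z V - D n Z V)) (at 0)"
      unfolding \<phi>_def using Z TS by (intro DERIV_diff matrix_holomorphic_slice_deriv D Dlin) auto
    ultimately have "norm (D m Z V - D n Z V) \<le> e / \<rho>"
      by (simp add: DERIV_imp_deriv)
    also have "\<dots> = 4 * e / r * norm V" by (simp add: \<rho>_def)
    finally show ?thesis .
  qed
  have bound2: "\<exists>N. \<forall>m\<ge>N. \<forall>n\<ge>N. \<forall>Z\<in>T. \<forall>V. norm (D m Z V - D n Z V) \<le> e * norm V" if e: "e > 0" for e
  proof -
    obtain N where N: "\<forall>m\<ge>N. \<forall>n\<ge>N. \<forall>W\<in>ball Z0 r. norm (h m W - h n W) \<le> e * r / 4"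
    proof -
      have "0 < e * r / 4" using e r(1) by simp
      from uc[OF this] show ?thesis using that by blast
    qed
    have "norm (D m Z V - D n Z V) \<le> e * norm V" if "m \<ge> N" "n \<ge> N" "Z \<in> T" for m n Z V
      using bound[of m n "e * r / 4" Z V] N that r(1) by simp
    then show ?thesis by blast
  qed
  define G where "G = (\<lambda>Z V. lim (\<lambda>k. D k Z V))"
  have "\<exists>l. (\<lambda>k. D k Z V) \<longlonglongrightarrow> l" if Z: "Z \<in> T" for Z V
  proof -
    have "Cauchy (\<lambda>k. D k Z V)"
    proof (rule CauchyI)
      fix e :: real assume "e > 0"
      then have en: "e / (norm V + 1) > 0" by (simp add: add_nonneg_pos)
      have "e / (norm V + 1) * norm V < e"
      proof -
        have p: "0 < norm V + 1" by (simp add: add_nonneg_pos)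
        show ?thesis using \<open>e > 0\<close> by (simp add: pos_divide_less_eq[OF p] distrib_left)
      qed
      obtain N where N: "\<forall>m\<ge>N. \<forall>n\<ge>N. \<forall>Z\<in>T. \<forall>V'. norm (D m Z V' - D n Z V') \<le> e / (norm V + 1) * norm V'"
        using bound2[OF en] by blast
      then have "\<forall>m\<ge>N. \<forall>n\<ge>N. norm (D m Z V - D n Z V) < e"
        using Z \<open>e / (norm V + 1) * norm V < e\<close> by (meson le_less_trans)
      then show "\<exists>M. \<forall>m\<ge>M. \<forall>n\<ge>M. norm (D m Z V - D n Z V) < e" by blast
    qed
    then show ?thesis by (simp add: Cauchy_convergent_iff convergent_def)
  qed
  then have G: "(\<lambda>k. D k Z V) \<longlonglongrightarrow> G Z V" if "Z \<in> T" for Z V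
    using that unfolding G_def convergent_LIMSEQ_iff[symmetric] convergent_def by blast
  have unif: "\<forall>\<^sub>F k in sequentially. \<forall>Z\<in>T. \<forall>V. norm (D k Z V - G Z V) \<le> e * norm V" if "e > 0" for e
  proof -
    obtain N where N: "\<forall>m\<ge>N. \<forall>n\<ge>N. \<forall>Z\<in>T. \<forall>V. norm (D m Z V - D n Z V) \<le> e * norm V"
      using bound2[OF \<open>e > 0\<close>] by blast
    have "norm (D m Z V - G Z V) \<le> e * norm V" if "m \<ge> N" "Z \<in> T" for m Z V
    proof (rule LIMSEQ_le_const2)
      show "(\<lambda>k. norm (D m Z V - D k Z V)) \<longlonglongrightarrow> norm (D m Z V - G Z V)"
        by (intro tendsto_intros G that)
      show "\<exists>N. \<forall>n\<ge>N. norm (D m Z V - D n Z V) \<le> e * norm V"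
        using N that by blast
    qed
    then show ?thesis unfolding eventually_sequentially by blast
  qed
  have Z0T: "Z0 \<in> T" using r by (simp add: T_def)
  have "\<exists>g0. \<forall>Z\<in>T. (\<lambda>k. h k Z) \<longlonglongrightarrow> g0 Z \<and> (g0 has_derivative G Z) (at Z within T)"
  proof (rule has_derivative_sequence)
    show "convex T" unfolding T_def by (rule convex_ball)
    show "(h k has_derivative D k Z) (at Z within T)" if "Z \<in> T" for k Z
      using D[of Z k] that TS by (blast intro: has_derivative_at_withinI)
    show "\<forall>\<^sub>F k in sequentially. \<forall>Z\<in>T. \<forall>V. norm (D k Z V - G Z V) \<le> e * norm V" if "e > 0" for e
      using that by (rule unif)
    show "Z0 \<in> T" by (rule Z0T)
    show "(\<lambda>k. h k Z0) \<longlonglongrightarrow> g Z0" using lim \<open>Z0 \<in> S\<close> by blast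
  qed
  then obtain g0 where g0: "\<And>Z. Z \<in> T \<Longrightarrow> (\<lambda>k. h k Z) \<longlonglongrightarrow> g0 Z"
    "\<And>Z. Z \<in> T \<Longrightarrow> (g0 has_derivative G Z) (at Z within T)" by blast
  have eq: "g0 Z = g Z" if "Z \<in> T" for Z
    using g0(1)[OF that] lim[of Z] that TS LIMSEQ_unique by blast
  have opT: "open T" unfolding T_def by (rule open_ball)
  have "(g0 has_derivative G Z0) (at Z0)"
    using g0(2)[OF Z0T] at_within_open[OF Z0T opT] by simp
  then have "(g has_derivative G Z0) (at Z0)"
    by (rule has_derivative_transform_within_open[OF _ opT Z0T]) (rule eq)
  moreover have "G Z0 (cscale c V) = c * G Z0 V" for c V
  proof (rule LIMSEQ_unique)
    show "(\<lambda>k. D k Z0 (cscale c V)) \<longlonglongrightarrow> G Z0 (cscale c V)" by (rule G[OF Z0T])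
    show "(\<lambda>k. D k Z0 (cscale c V)) \<longlonglongrightarrow> c * G Z0 V"
      unfolding Dlin[OF \<open>Z0 \<in> S\<close>] by (intro tendsto_intros G Z0T)
  qed
  ultimately show "\<exists>f'. (g has_derivative f') (at Z0) \<and> (\<forall>c V. f' (\<chi> i j. c * V $ i $ j) = c * f' V)"
    unfolding cscale_def by blast
qed

section \<open>The Bergman space and its projection\<close>

context bergman
begin

abbreviation H :: "(complex^'n^'n \<Rightarrow> complex) set" where "H \<equiv> bergman_space \<nu>"

lemma H_iff: "f \<in> H \<longleftrightarrow> f \<in> L2 \<and> matrix_holomorphic_on f cartan_domain \<and> (\<forall>Z. Z \<notin> cartan_domain \<longrightarrow> f Z = 0)"
  unfolding bergman_space_def by blast

lemma H_L2: "f \<in> H \<Longrightarrow> f \<in> L2"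
  and H_holomorphic: "f \<in> H \<Longrightarrow> matrix_holomorphic_on f cartan_domain"
  and H_outside: "f \<in> H \<Longrightarrow> Z \<notin> cartan_domain \<Longrightarrow> f Z = 0"
  by (auto simp only: H_iff)

lemma holomorphic_borel:
  fixes f :: "complex^'n^'n \<Rightarrow> complex"
  assumes "matrix_holomorphic_on f cartan_domain" "\<And>Z. Z \<notin> cartan_domain \<Longrightarrow> f Z = 0"
  shows "f \<in> borel_measurable borel"
proof -
  have "f = (\<lambda>Z. indicator cartan_domain Z *\<^sub>R f Z)"
    using assms(2) by (auto simp: fun_eq_iff indicator_def)
  also have "\<dots> \<in> borel_measurable borel"
    by (rule borel_measurable_continuous_on_indicator[OF borel_cartan_domain
          matrix_holomorphic_imp_continuous_on[OF assms(1)]])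
  finally show ?thesis .
qed

lemma H_borel: "f \<in> H \<Longrightarrow> f \<in> borel_measurable borel"
  by (rule holomorphic_borel) (auto intro: H_holomorphic H_outside)

lemma H_add:
  assumes f: "f \<in> H" and g: "g \<in> H"
  shows "(\<lambda>Z. f Z + g Z) \<in> H"
  unfolding H_iff
proof (intro conjI allI impI)
  show "(\<lambda>Z. f Z + g Z) \<in> L2" by (intro L2_add H_L2 f g)
  show "matrix_holomorphic_on (\<lambda>Z. f Z + g Z) cartan_domain"
    unfolding matrix_holomorphic_on_def
  proof
    fix Z :: "complex^'n^'n" assume Z: "Z \<in> cartan_domain"
    obtain f' g' where "(f has_derivative f') (at Z)" "\<forall>c V. f' (\<chi> i j. c * V $ i $ j) = c * f' V"
      "(g has_derivative g') (at Z)" "\<forall>c V. g' (\<chi> i j. c * V $ i $ j) = c * g' V"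
      using H_holomorphic[OF f] H_holomorphic[OF g] Z unfolding matrix_holomorphic_on_def by blast
    then show "\<exists>f'. ((\<lambda>Z. f Z + g Z) has_derivative f') (at Z) \<and> (\<forall>c V. f' (\<chi> i j. c * V $ i $ j) = c * f' V)"
      by (intro exI[of _ "\<lambda>V. f' V + g' V"]) (auto intro!: has_derivative_add simp: distrib_left)
  qed
  show "f Z + g Z = 0" if "Z \<notin> cartan_domain" for Z using H_outside[OF f that] H_outside[OF g that] by simp
qed

lemma H_scale:
  assumes f: "f \<in> H"
  shows "(\<lambda>Z. k * f Z) \<in> H"
  unfolding H_iff
proof (intro conjI allI impI)
  show "(\<lambda>Z. k * f Z) \<in> L2" by (intro L2_scale H_L2 f)
  show "matrix_holomorphic_on (\<lambda>Z. k * f Z) cartan_domain"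
    unfolding matrix_holomorphic_on_def
  proof
    fix Z :: "complex^'n^'n" assume Z: "Z \<in> cartan_domain"
    obtain f' where "(f has_derivative f') (at Z)" "\<forall>c V. f' (\<chi> i j. c * V $ i $ j) = c * f' V"
      using H_holomorphic[OF f] Z unfolding matrix_holomorphic_on_def by blast
    then show "\<exists>f'. ((\<lambda>Z. k * f Z) has_derivative f') (at Z) \<and> (\<forall>c V. f' (\<chi> i j. c * V $ i $ j) = c * f' V)"
      by (intro exI[of _ "\<lambda>V. k * f' V"]) (auto intro!: has_derivative_mult_right simp: mult.left_commute)
  qed
  show "k * f Z = 0" if "Z \<notin> cartan_domain" for Z using H_outside[OF f that] by simp
qed

lemma H_diff:
  assumes "f \<in> H" "g \<in> H"
  shows "(\<lambda>Z. f Z - g Z) \<in> H"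
  using H_add[OF assms(1) H_scale[OF assms(2), of "-1"]] by simp

text \<open>The constant is \<open>1\<close> because the measure has total mass \<open>1\<close>.\<close>

lemma L1_le_L2:
  assumes f: "f \<in> L2"
  shows "integrable M f" "(\<integral>Z. norm (f Z) \<partial>M) \<le> nrm f"
proof -
  interpret finite_measure M by (rule finite_measure_M)
  have one: "(\<lambda>Z. 1) \<in> L2" by (simp add: L2_iff)
  have nf: "(\<lambda>Z. complex_of_real (norm (f Z))) \<in> L2"
    by (rule L2_bound[OF f, where C=1]) (use L2_measurable[OF f] in \<open>auto intro: borel_measurable_of_real\<close>)
  show "integrable M f" using L2_integrable_mult[OF f one] by simp
  have "ip (\<lambda>Z. complex_of_real (norm (f Z))) (\<lambda>Z. 1) = complex_of_real (\<integral>Z. norm (f Z) \<partial>M)"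
    by (simp add: L2_inner_M)
  then have "(\<integral>Z. norm (f Z) \<partial>M) \<le> norm (ip (\<lambda>Z. complex_of_real (norm (f Z))) (\<lambda>Z. 1))"
    by simp
  also have "\<dots> \<le> nrm (\<lambda>Z. complex_of_real (norm (f Z))) * nrm (\<lambda>Z. 1)"
    by (rule L2_Cauchy_Schwarz[OF nf one])
  also have "nrm (\<lambda>Z. 1) = 1"
    by (simp add: L2_norm_M space_M measure_def prob)
  also have "nrm (\<lambda>Z. complex_of_real (norm (f Z))) = nrm f" by (simp add: L2_norm_M)
  finally show "(\<integral>Z. norm (f Z) \<partial>M) \<le> nrm f" by simp
qed

text \<open>
  By the mean value property a value of \<open>f\<close> is an average over a small ball; there the density is bounded
  below, so the average is controlled by the integral of \<open>|f|\<close> over the domain.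
\<close>

lemma H_evaluation_bound:
  assumes Z0: "Z0 \<in> cartan_domain"
  obtains r C where "0 < r" "ball Z0 r \<subseteq> cartan_domain" "0 < C"
    "\<And>f Z. f \<in> H \<Longrightarrow> Z \<in> ball Z0 r \<Longrightarrow> norm (f Z) \<le> C * nrm f"
proof -
  obtain R where R: "0 < R" "cball Z0 R \<subseteq> cartan_domain"
    using open_cartan_domain Z0 open_contains_cball by blast
  obtain \<delta> where \<delta>: "\<delta> > 0" "\<And>Z. Z \<in> cball Z0 R \<Longrightarrow> \<delta> \<le> dens Z"
    using dens_bounded_below[OF compact_cball R(2)] by blast
  define r where "r = R / 2"
  have r: "0 < r" using R by (simp add: r_def)
  let ?B = "ball (0 :: complex^'n^'n) r"
  define v where "v = measure lborel ?B"
  have v: "0 < v"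
  proof -
    have "emeasure lborel ?B \<noteq> 0"
      using r by (simp add: emeasure_ball less_imp_neq[OF unit_ball_vol_pos, symmetric])
    moreover have "emeasure lborel ?B < \<infinity>" by (rule emeasure_lborel_ball_finite)
    ultimately show ?thesis unfolding v_def measure_def
      by (simp add: enn2real_positive_iff zero_less_iff_neq_zero)
  qed
  have bound: "norm (f Z) \<le> 1 / (v * \<delta>) * nrm f" if f: "f \<in> H" and Z: "Z \<in> ball Z0 r" for f Z
  proof -
    have ZR: "cball Z r \<subseteq> cball Z0 R"
    proof
      fix W assume "W \<in> cball Z r"
      then show "W \<in> cball Z0 R"
        using Z dist_triangle[of Z0 W Z] by (simp add: r_def)
    qed
    then have ZD: "cball Z r \<subseteq> cartan_domain" using R(2) by blast
    note mv = matrix_mean_value[OF open_cartan_domain H_holomorphic[OF f] r ZD]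
    note fb[measurable] = H_borel[OF f]
    have intM: "integrable lborel (\<lambda>Z. (indicator cartan_domain Z * dens Z) *\<^sub>R f Z)"
      using L1_le_L2(1)[OF H_L2[OF f]] integrable_M[OF fb] by simp
    have "v * norm (f Z) = norm (\<integral>V. indicator ?B V *\<^sub>R f (Z + V) \<partial>lborel)"
      unfolding mv(2) using v by (simp add: v_def norm_mult)
    also have "\<dots> \<le> (\<integral>V. norm (indicator ?B V *\<^sub>R f (Z + V)) \<partial>lborel)"
      by (rule integral_norm_bound)
    also have "\<dots> = (\<integral>V. norm (indicator ?B V *\<^sub>R f (Z + V)) \<partial>distr lborel borel ((+) (- Z)))"
      by (simp add: lborel_distr_plus)
    also have "\<dots> = (\<integral>V. norm (indicator ?B (- Z + V) *\<^sub>R f (Z + (- Z + V))) \<partial>lborel)"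
    proof (rule integral_distr)
      have "(\<lambda>V. indicator ?B V *\<^sub>R f (Z + V)) \<in> borel_measurable borel"
        using borel_measurable_integrable[OF mv(1)] by simp
      then show "(\<lambda>V. norm (indicator ?B V *\<^sub>R f (Z + V))) \<in> borel_measurable borel"
        by (rule measurable_compose) (intro borel_measurable_continuous_onI continuous_intros)
    qed simp
    also have "\<dots> \<le> (\<integral>V. (1 / \<delta>) * norm ((indicator cartan_domain V * dens V) *\<^sub>R f V) \<partial>lborel)"
    proof (rule integral_mono')
      show "integrable lborel (\<lambda>V. (1 / \<delta>) * norm ((indicator cartan_domain V * dens V) *\<^sub>R f V))"
        by (intro integrable_mult_right integrable_norm intM)
      fix V :: "complex^'n^'n"
      show "norm (indicator ?B (- Z + V) *\<^sub>R f (Z + (- Z + V)))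
        \<le> (1 / \<delta>) * norm ((indicator cartan_domain V * dens V) *\<^sub>R f V)"
      proof (cases "- Z + V \<in> ?B")
        case True
        then have "V \<in> cball Z r" by (simp add: dist_norm norm_minus_commute)
        then have V: "V \<in> cartan_domain" "\<delta> \<le> dens V" using ZD ZR \<delta>(2) by blast+
        have "\<delta> * norm (f V) \<le> dens V * norm (f V)" using V(2) by (rule mult_right_mono) simp
        then show ?thesis using True V \<delta>(1) dens_pos[OF V(1)] by (simp add: field_simps)
      qed (use \<delta> in simp)
    qed (use \<delta>(1) in simp)
    also have "\<dots> = (1 / \<delta>) * (\<integral>V. norm (f V) \<partial>M)"
    proof -
      have [measurable]: "(\<lambda>V. complex_of_real (norm (f V))) \<in> borel_measurable borel"
        by (rule measurable_compose[OF fb]) (intro borel_measurable_continuous_onI continuous_intros)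
      have "complex_of_real (\<integral>V. norm (f V) \<partial>M) = (\<integral>V. complex_of_real (norm (f V)) \<partial>M)"
        by (rule integral_complex_of_real[symmetric])
      also have "\<dots> = (\<integral>V. (indicator cartan_domain V * dens V) *\<^sub>R complex_of_real (norm (f V)) \<partial>lborel)"
        by (rule integral_M) measurable
      also have "\<dots> = (\<integral>V. complex_of_real (norm ((indicator cartan_domain V * dens V) *\<^sub>R f V)) \<partial>lborel)"
        by (intro Bochner_Integration.integral_cong refl)
          (simp add: scaleR_conv_of_real norm_mult dens_nonneg)
      also have "\<dots> = complex_of_real (\<integral>V. norm ((indicator cartan_domain V * dens V) *\<^sub>R f V) \<partial>lborel)"
        by (rule integral_complex_of_real)
      finally have "(\<integral>V. norm (f V) \<partial>M) = (\<integral>V. norm ((indicator cartan_domain V * dens V) *\<^sub>R f V) \<partial>lborel)"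
        by (simp only: of_real_eq_iff)
      then show ?thesis by simp
    qed
    also have "\<dots> \<le> (1 / \<delta>) * nrm f"
      using \<delta>(1) L1_le_L2(2)[OF H_L2[OF f]] by (intro mult_left_mono) auto
    finally show ?thesis using v \<delta>(1) by (simp add: field_simps)
  qed
  show ?thesis
    by (rule that[OF r _ _ bound]) (use R v \<delta> in \<open>auto simp: r_def\<close>)
qed

lemma L2_parallelogram:
  assumes f: "f \<in> L2" and g: "g \<in> L2"
  shows "(nrm (\<lambda>Z. f Z + g Z))\<^sup>2 + (nrm (\<lambda>Z. f Z - g Z))\<^sup>2 = 2 * (nrm f)\<^sup>2 + 2 * (nrm g)\<^sup>2"
  using L2_norm_diff_scale_square[OF f g, of 1] L2_norm_diff_scale_square[OF f g, of "-1"] by simp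

lemma zero_in_H: "(\<lambda>Z. 0) \<in> H"
  unfolding H_iff matrix_holomorphic_on_def
  by (auto simp: L2_iff intro!: exI[of _ "\<lambda>_. 0"])

text \<open>
  The explicit rate is the one that the parallelogram identity provides for a minimising sequence.
\<close>

lemma H_Cauchy_limit:
  assumes h: "\<And>k. h k \<in> H"
    and cauchy: "\<And>m n. (nrm (\<lambda>Z. h m Z - h n Z))\<^sup>2 \<le> 2 / real (Suc m) + 2 / real (Suc n)"
  obtains g where "matrix_holomorphic_on g cartan_domain" "\<And>Z. Z \<notin> cartan_domain \<Longrightarrow> g Z = 0"
    "\<And>Z. (\<lambda>k. h k Z) \<longlonglongrightarrow> g Z"
proof -
  have small: "\<exists>N. \<forall>m\<ge>N. \<forall>n\<ge>N. nrm (\<lambda>Z. h m Z - h n Z) \<le> e" if e: "e > 0" for e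
  proof -
    (* both terms of the rate are at most 2 / (N + 1), and their sum has to stay below e^2 *)
    obtain N where N: "4 / e\<^sup>2 < real N" using reals_Archimedean2 by blast
    have Npos: "0 < real (Suc N)" by simp
    have "4 / e\<^sup>2 < real (Suc N)" using N by simp
    then have N4: "4 / real (Suc N) < e\<^sup>2" using e Npos by (simp add: pos_divide_less_eq mult.commute)
    have "nrm (\<lambda>Z. h m Z - h n Z) \<le> e" if "m \<ge> N" "n \<ge> N" for m n
    proof (rule power2_le_imp_le)
      have "2 / real (Suc m) \<le> 2 / real (Suc N)" "2 / real (Suc n) \<le> 2 / real (Suc N)"
        using that by (intro divide_left_mono; simp)+
      then show "(nrm (\<lambda>Z. h m Z - h n Z))\<^sup>2 \<le> e\<^sup>2"
        using cauchy[of m n] N4 by simp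
    qed (use e in simp)
    then show ?thesis by blast
  qed
  have loc: "\<exists>r>0. ball Z r \<subseteq> cartan_domain \<and>
        (\<forall>e>0. \<exists>N. \<forall>m\<ge>N. \<forall>n\<ge>N. \<forall>W\<in>ball Z r. norm (h m W - h n W) \<le> e)"
    if Z: "Z \<in> cartan_domain" for Z
  proof -
    obtain r C where r: "0 < r" "ball Z r \<subseteq> cartan_domain" "0 < C"
      and C: "\<And>f W. f \<in> H \<Longrightarrow> W \<in> ball Z r \<Longrightarrow> norm (f W) \<le> C * nrm f"
      using H_evaluation_bound[OF Z] by metis
    have "\<exists>N. \<forall>m\<ge>N. \<forall>n\<ge>N. \<forall>W\<in>ball Z r. norm (h m W - h n W) \<le> e" if e: "e > 0" for e
    proof -
      have "e / C > 0" using e r by simp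
      then obtain N where N: "\<forall>m\<ge>N. \<forall>n\<ge>N. nrm (\<lambda>Z. h m Z - h n Z) \<le> e / C"
        using small by blast
      have "norm (h m W - h n W) \<le> e" if "m \<ge> N" "n \<ge> N" "W \<in> ball Z r" for m n W
      proof -
        have "norm (h m W - h n W) \<le> C * nrm (\<lambda>Z. h m Z - h n Z)"
          by (rule C[OF H_diff[OF h h] that(3)])
        also have "\<dots> \<le> C * (e / C)" using N that r by (intro mult_left_mono) auto
        finally show ?thesis using r by simp
      qed
      then show ?thesis by blast
    qed
    then show ?thesis using r by blast
  qed
  define g where "g = (\<lambda>Z. lim (\<lambda>k. h k Z))"
  have lim: "(\<lambda>k. h k Z) \<longlonglongrightarrow> g Z" if Z: "Z \<in> cartan_domain" for Z
  proof -
    obtain r where "0 < r" and r: "\<And>e. e > 0 \<Longrightarrow> \<exists>N. \<forall>m\<ge>N. \<forall>n\<ge>N. \<forall>W\<in>ball Z r. norm (h m W - h n W) \<le> e"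
      using loc[OF Z] by blast
    have "Cauchy (\<lambda>k. h k Z)"
    proof (rule CauchyI)
      fix e :: real assume "e > 0"
      then obtain N where N: "\<forall>m\<ge>N. \<forall>n\<ge>N. \<forall>W\<in>ball Z r. norm (h m W - h n W) \<le> e / 2"
        using r[of "e / 2"] by auto
      have "norm (h m Z - h n Z) < e" if "m \<ge> N" "n \<ge> N" for m n
      proof -
        have "norm (h m Z - h n Z) \<le> e / 2" using N that \<open>0 < r\<close> by simp
        then show ?thesis using \<open>e > 0\<close> by simp
      qed
      then show "\<exists>M. \<forall>m\<ge>M. \<forall>n\<ge>M. norm (h m Z - h n Z) < e" by blast
    qed
    then show ?thesis unfolding g_def by (simp add: Cauchy_convergent_iff convergent_LIMSEQ_iff)
  qed
  have out: "(\<lambda>k. h k Z) = (\<lambda>k. 0)" if "Z \<notin> cartan_domain" for Z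
    using H_outside[OF h that] by simp
  show ?thesis
  proof (rule that[of g])
    show "matrix_holomorphic_on g cartan_domain"
      by (rule matrix_holomorphic_sequence[OF open_cartan_domain H_holomorphic[OF h] loc lim])
    show g0: "g Z = 0" if "Z \<notin> cartan_domain" for Z
      unfolding g_def out[OF that] by (rule limI) simp
    show "(\<lambda>k. h k Z) \<longlonglongrightarrow> g Z" for Z
    proof (cases "Z \<in> cartan_domain")
      case False
      show ?thesis unfolding out[OF False] g0[OF False] by simp
    qed (rule lim)
  qed
qed

text \<open>
  Square integrability of a pointwise limit, with the limiting bound on the norm. Together with
  \<open>H_Cauchy_limit\<close> it takes the place of completeness.
\<close>

lemma L2_norm_Fatou:
  assumes u: "\<And>k. u k \<in> L2" and g: "g \<in> borel_measurable M" and lim: "\<And>Z. (\<lambda>k. u k Z) \<longlonglongrightarrow> g Z"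
    and d: "\<And>k. (nrm (u k))\<^sup>2 \<le> d + 1 / real (Suc k)" "0 \<le> d"
  shows "g \<in> L2" "(nrm g)\<^sup>2 \<le> d"
proof -
  have meas: "u k \<in> borel_measurable M" for k using u by (rule L2_measurable)
  have nn: "(\<integral>\<^sup>+Z. ennreal ((norm (u k Z))\<^sup>2) \<partial>M) = ennreal ((nrm (u k))\<^sup>2)" for k
    unfolding L2_norm_square using u[of k] by (intro nn_integral_eq_integral) (auto simp: L2_iff)
  have "(\<integral>\<^sup>+Z. ennreal ((norm (g Z))\<^sup>2) \<partial>M) = (\<integral>\<^sup>+Z. liminf (\<lambda>k. ennreal ((norm (u k Z))\<^sup>2)) \<partial>M)"
  proof (intro nn_integral_cong)
    fix Z
    have "(\<lambda>k. ennreal ((norm (u k Z))\<^sup>2)) \<longlonglongrightarrow> ennreal ((norm (g Z))\<^sup>2)"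
      by (intro tendsto_ennrealI tendsto_intros lim)
    then show "ennreal ((norm (g Z))\<^sup>2) = liminf (\<lambda>k. ennreal ((norm (u k Z))\<^sup>2))"
      using lim_imp_Liminf[OF sequentially_bot] by metis
  qed
  also have "\<dots> \<le> liminf (\<lambda>k. \<integral>\<^sup>+Z. ennreal ((norm (u k Z))\<^sup>2) \<partial>M)"
    using meas by (intro nn_integral_liminf) measurable
  also have "\<dots> \<le> liminf (\<lambda>k. ennreal (d + 1 / real (Suc k)))"
    unfolding nn using d by (intro Liminf_mono always_eventually allI ennreal_leI)
  also have "\<dots> = ennreal d"
  proof (rule lim_imp_Liminf[OF sequentially_bot])
    have "(\<lambda>k. d + 1 / real (Suc k)) \<longlonglongrightarrow> d + 0"
      by (intro tendsto_add tendsto_const LIMSEQ_Suc[OF lim_1_over_n])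
    then show "(\<lambda>k. ennreal (d + 1 / real (Suc k))) \<longlonglongrightarrow> ennreal d" by (intro tendsto_ennrealI) simp
  qed
  finally have le: "(\<integral>\<^sup>+Z. ennreal ((norm (g Z))\<^sup>2) \<partial>M) \<le> ennreal d" .
  have "integrable M (\<lambda>Z. (norm (g Z))\<^sup>2)"
    using g le_less_trans[OF le ennreal_less_top] by (intro integrableI_nonneg) auto
  then show "g \<in> L2" using g by (simp add: L2_iff)
  have "(\<integral>\<^sup>+Z. ennreal ((norm (g Z))\<^sup>2) \<partial>M) = ennreal ((nrm g)\<^sup>2)"
    unfolding L2_norm_square using \<open>integrable M (\<lambda>Z. (norm (g Z))\<^sup>2)\<close> by (intro nn_integral_eq_integral) auto
  then show "(nrm g)\<^sup>2 \<le> d" using le d(2) by (simp add: ennreal_le_iff)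
qed

text \<open>
  The point of \<open>H\<close> nearest to \<open>f\<close> is the limit of a minimising sequence, and the difference is
  orthogonal to \<open>H\<close> because the distance cannot be decreased.
\<close>

lemma projection_exists:
  assumes f: "f \<in> L2"
  shows "\<exists>h\<in>H. \<forall>g\<in>H. ip (\<lambda>Z. f Z - h Z) g = 0"
proof -
  define A where "A = (\<lambda>h. (nrm (\<lambda>Z. f Z - h Z))\<^sup>2) ` H"
  define d where "d = Inf A"
  have Ane: "A \<noteq> {}" using zero_in_H by (auto simp: A_def)
  have Abd: "bdd_below A" unfolding A_def by (rule bdd_belowI[of _ 0]) auto
  have d0: "0 \<le> d" unfolding d_def by (rule cInf_greatest[OF Ane]) (auto simp: A_def)
  have dle: "d \<le> (nrm (\<lambda>Z. f Z - h Z))\<^sup>2" if "h \<in> H" for h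
    unfolding d_def by (rule cInf_lower[OF _ Abd]) (use that in \<open>auto simp: A_def\<close>)
  have "\<exists>h. h \<in> H \<and> (nrm (\<lambda>Z. f Z - h Z))\<^sup>2 < d + 1 / real (Suc k)" for k
  proof -
    have "Inf A < d + 1 / real (Suc k)" by (simp add: d_def)
    from cInf_lessD[OF Ane this] show ?thesis by (auto simp: A_def)
  qed
  then obtain h where h: "\<And>k. h k \<in> H" and hd: "\<And>k. (nrm (\<lambda>Z. f Z - h k Z))\<^sup>2 < d + 1 / real (Suc k)"
    by metis
  have fh: "(\<lambda>Z. f Z - h k Z) \<in> L2" for k by (intro L2_diff f H_L2 h)
  have cau: "(nrm (\<lambda>Z. h m Z - h n Z))\<^sup>2 \<le> 2 / real (Suc m) + 2 / real (Suc n)" for m n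
  proof -
    let ?g = "\<lambda>Z. (1/2) * (h m Z + h n Z)"
    have "(nrm (\<lambda>Z. (f Z - h n Z) + (f Z - h m Z)))\<^sup>2 + (nrm (\<lambda>Z. (f Z - h n Z) - (f Z - h m Z)))\<^sup>2
       = 2 * (nrm (\<lambda>Z. f Z - h n Z))\<^sup>2 + 2 * (nrm (\<lambda>Z. f Z - h m Z))\<^sup>2"
      by (rule L2_parallelogram[OF fh fh])
    moreover have "(\<lambda>Z. (f Z - h n Z) - (f Z - h m Z)) = (\<lambda>Z. h m Z - h n Z)" by (simp add: fun_eq_iff)
    moreover have "(\<lambda>Z. (f Z - h n Z) + (f Z - h m Z)) = (\<lambda>Z. 2 * (f Z - ?g Z))" by (rule ext) (simp add: field_simps)
    moreover have "(nrm (\<lambda>Z. 2 * (f Z - ?g Z)))\<^sup>2 = 4 * (nrm (\<lambda>Z. f Z - ?g Z))\<^sup>2"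
      by (simp only: L2_norm_scale power_mult_distrib) simp
    moreover have "d \<le> (nrm (\<lambda>Z. f Z - ?g Z))\<^sup>2"
      by (rule dle) (intro H_scale H_add h)
    ultimately have "(nrm (\<lambda>Z. h m Z - h n Z))\<^sup>2
      \<le> 2 * (nrm (\<lambda>Z. f Z - h n Z))\<^sup>2 + 2 * (nrm (\<lambda>Z. f Z - h m Z))\<^sup>2 - 4 * d" by simp
    then show ?thesis using hd[of m] hd[of n] by simp
  qed
  obtain h0 where hol: "matrix_holomorphic_on h0 cartan_domain" and out: "\<And>Z. Z \<notin> cartan_domain \<Longrightarrow> h0 Z = 0"
    and lim: "\<And>Z. (\<lambda>k. h k Z) \<longlonglongrightarrow> h0 Z"
    using H_Cauchy_limit[of h, OF h cau] by blast
  have m0: "h0 \<in> borel_measurable M"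
    by (rule borel_imp_M[OF holomorphic_borel[OF hol out]])
  have mF: "(\<lambda>Z. f Z - h0 Z) \<in> borel_measurable M"
    by (intro borel_measurable_diff L2_measurable[OF f] m0)
  have limF: "(\<lambda>k. f Z - h k Z) \<longlonglongrightarrow> f Z - h0 Z" for Z
    by (intro tendsto_intros lim)
  note F = L2_norm_Fatou[of "\<lambda>k Z. f Z - h k Z", OF fh mF limF less_imp_le[OF hd] d0]
  have h0: "h0 \<in> H"
    using L2_diff[OF f F(1)] hol out by (simp add: H_iff)
  have "ip (\<lambda>Z. f Z - h0 Z) g = 0" if g: "g \<in> H" for g
  proof (rule ccontr)
    define a where "a = ip (\<lambda>Z. f Z - h0 Z) g"
    assume "ip (\<lambda>Z. f Z - h0 Z) g \<noteq> 0"
    then have a: "0 < (norm a)\<^sup>2" by (simp add: a_def)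
    define G where "G = (nrm g)\<^sup>2"
    (* this step size makes the linear term dominate, so f - h0 - ?k * g would be shorter than f - h0 *)
    define t where "t = 1 / (G + 1)"
    have G: "0 \<le> G" by (simp add: G_def)
    have t: "0 < t" "t * G < 1" using G by (simp_all add: t_def)
    let ?k = "complex_of_real t * a"
    have "(\<lambda>Z. h0 Z + ?k * g Z) \<in> H" by (intro H_add h0 H_scale g)
    from dle[OF this] have "d \<le> (nrm (\<lambda>Z. (f Z - h0 Z) - ?k * g Z))\<^sup>2"
      by (simp add: diff_diff_eq)
    also have "\<dots> = (nrm (\<lambda>Z. f Z - h0 Z))\<^sup>2 - 2 * Re (cnj ?k * a) + (norm ?k)\<^sup>2 * G"
      unfolding a_def G_def by (rule L2_norm_diff_scale_square[OF F(1) H_L2[OF g]])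
    also have "Re (cnj ?k * a) = t * (norm a)\<^sup>2"
    proof -
      have "Re (cnj ?k * a) = t * ((Re a)\<^sup>2 + (Im a)\<^sup>2)"
        by (simp add: power2_eq_square algebra_simps)
      then show ?thesis by (simp only: cmod_power2)
    qed
    also have "(norm ?k)\<^sup>2 = t\<^sup>2 * (norm a)\<^sup>2" by (simp add: norm_mult power_mult_distrib)
    finally have "0 \<le> - 2 * (t * (norm a)\<^sup>2) + t\<^sup>2 * (norm a)\<^sup>2 * G" using F(2) by linarith
    also have "\<dots> = (t * (norm a)\<^sup>2) * (t * G - 2)" by (simp add: power2_eq_square algebra_simps)
    finally have "0 \<le> (t * (norm a)\<^sup>2) * (t * G - 2)" .
    moreover have "(t * (norm a)\<^sup>2) * (t * G - 2) < 0"
      using t a by (intro mult_pos_neg mult_pos_pos) auto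
    ultimately show False by simp
  qed
  then show ?thesis using h0 by blast
qed

lemma H_norm_zero:
  assumes f: "f \<in> H" and "nrm f = 0"
  shows "f = (\<lambda>Z. 0)"
proof
  fix Z
  show "f Z = 0"
  proof (cases "Z \<in> cartan_domain")
    case True
    obtain r C where "0 < r" "\<And>f W. f \<in> H \<Longrightarrow> W \<in> ball Z r \<Longrightarrow> norm (f W) \<le> C * nrm f"
      using H_evaluation_bound[OF True] by metis
    then have "norm (f Z) \<le> C * nrm f" using f by simp
    then show ?thesis using assms(2) by simp
  qed (rule H_outside[OF f])
qed

lemma H_eqI:
  assumes h: "h1 \<in> H" "h2 \<in> H" and eq: "\<And>g. g \<in> H \<Longrightarrow> ip h1 g = ip h2 g"
  shows "h1 = h2"
proof -
  let ?e = "\<lambda>Z. h1 Z - h2 Z"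
  have e: "?e \<in> H" by (intro H_diff h)
  have "ip ?e ?e = 0"
    unfolding L2_inner_diff_left[OF H_L2[OF h(1)] H_L2[OF h(2)] H_L2[OF e]] using eq[OF e] by simp
  then have "nrm ?e = 0" by (simp add: L2_inner_self)
  from H_norm_zero[OF e this] show ?thesis by (simp add: fun_eq_iff)
qed

lemma projection_iff:
  assumes f: "f \<in> L2" and h: "h \<in> H"
  shows "(\<forall>g\<in>H. ip (\<lambda>Z. f Z - h Z) g = 0) \<longleftrightarrow> (\<forall>g\<in>H. ip h g = ip f g)"
  by (rule ball_cong[OF refl]) (auto simp: L2_inner_diff_left[OF f H_L2[OF h] H_L2])

lemma
  assumes f: "f \<in> L2"
  shows projection_in_H: "bergman_projection \<nu> f \<in> H"
    and projection_inner: "g \<in> H \<Longrightarrow> ip (bergman_projection \<nu> f) g = ip f g"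
proof -
  obtain h where h: "h \<in> H" "\<forall>g\<in>H. ip (\<lambda>Z. f Z - h Z) g = 0"
    using projection_exists[OF f] by blast
  have "bergman_projection \<nu> f = h"
    unfolding bergman_projection_def
  proof (rule the_equality)
    fix h' assume h': "h' \<in> H \<and> (\<forall>g\<in>H. ip (\<lambda>Z. f Z - h' Z) g = 0)"
    then have 1: "\<forall>g\<in>H. ip h' g = ip f g" using projection_iff[OF f, of h'] by blast
    have 2: "\<forall>g\<in>H. ip h g = ip f g" using h projection_iff[OF f h(1)] by blast
    show "h' = h" by (rule H_eqI) (use 1 2 h h' in auto)
  qed (use h in blast)
  then show "bergman_projection \<nu> f \<in> H" "g \<in> H \<Longrightarrow> ip (bergman_projection \<nu> f) g = ip f g"
    using h projection_iff[OF f h(1)] by auto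
qed

end

section \<open>Toeplitz operators and generated algebras\<close>

context bergman
begin

abbreviation B :: "'n bergman_op set" where "B \<equiv> bounded_ops \<nu>"

lemma
  assumes "T \<in> B"
  shows op_closed: "f \<in> H \<Longrightarrow> T f \<in> H"
    and op_additive: "f \<in> H \<Longrightarrow> g \<in> H \<Longrightarrow> T (\<lambda>Z. f Z + g Z) = (\<lambda>Z. T f Z + T g Z)"
    and op_homogeneous: "f \<in> H \<Longrightarrow> T (\<lambda>Z. k * f Z) = (\<lambda>Z. k * T f Z)"
    and op_bounded: "\<exists>K. \<forall>f\<in>H. nrm (T f) \<le> K * nrm f"
  using assms unfolding bounded_ops_def by (auto simp: PiE_def)

lemma op_zero: "T \<in> B \<Longrightarrow> T (\<lambda>Z. 0) = (\<lambda>Z. 0)"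
  using op_homogeneous[OF _ zero_in_H, of T 0] by simp

lemma op_bounded_nonneg:
  assumes "T \<in> B"
  obtains K where "0 \<le> K" "\<And>f. f \<in> H \<Longrightarrow> nrm (T f) \<le> K * nrm f"
proof -
  obtain K where K: "\<forall>f\<in>H. nrm (T f) \<le> K * nrm f" using op_bounded[OF assms] by blast
  show ?thesis
  proof (rule that[of "\<bar>K\<bar>"])
    fix f assume "f \<in> H"
    then have "nrm (T f) \<le> K * nrm f" using K by blast
    also have "\<dots> \<le> \<bar>K\<bar> * nrm f" by (intro mult_right_mono L2_norm_nonneg) simp
    finally show "nrm (T f) \<le> \<bar>K\<bar> * nrm f" .
  qed simp
qed

lemma compose_eq_iff: "compose H S T = compose H T S \<longleftrightarrow> (\<forall>f\<in>H. S (T f) = T (S f))"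
proof
  assume eq: "compose H S T = compose H T S"
  show "\<forall>f\<in>H. S (T f) = T (S f)"
  proof
    fix f assume "f \<in> H"
    then show "S (T f) = T (S f)" using fun_cong[OF eq, of f] by (simp add: compose_def)
  qed
next
  assume "\<forall>f\<in>H. S (T f) = T (S f)"
  then show "compose H S T = compose H T S" by (auto simp: compose_def restrict_def fun_eq_iff)
qed

lemma bounded_opsI:
  assumes "\<And>f. f \<in> H \<Longrightarrow> T f \<in> H" "T \<in> extensional H"
    and "\<And>f g. f \<in> H \<Longrightarrow> g \<in> H \<Longrightarrow> T (\<lambda>Z. f Z + g Z) = (\<lambda>Z. T f Z + T g Z)"
    and "\<And>k f. f \<in> H \<Longrightarrow> T (\<lambda>Z. k * f Z) = (\<lambda>Z. k * T f Z)"
    and "\<And>f. f \<in> H \<Longrightarrow> nrm (T f) \<le> K * nrm f"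
  shows "T \<in> B"
  unfolding bounded_ops_def using assms by (auto simp: PiE_def intro!: exI[of _ K])

lemma op_id_bounded: "op_id \<nu> \<in> B"
  by (rule bounded_opsI[where K=1]) (auto simp: op_id_def H_add H_scale)

lemma op_add_bounded:
  assumes S: "S \<in> B" and T: "T \<in> B"
  shows "op_add \<nu> S T \<in> B"
proof -
  obtain K where K: "\<And>f. f \<in> H \<Longrightarrow> nrm (S f) \<le> K * nrm f" using op_bounded[OF S] by blast
  obtain L where L: "\<And>f. f \<in> H \<Longrightarrow> nrm (T f) \<le> L * nrm f" using op_bounded[OF T] by blast
  show ?thesis
  proof (rule bounded_opsI[where K="K + L"])
    show "op_add \<nu> S T \<in> extensional H" by (simp add: op_add_def)
    show "op_add \<nu> S T f \<in> H" if "f \<in> H" for f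
      using that by (simp add: op_add_def H_add op_closed S T)
    show "op_add \<nu> S T (\<lambda>Z. f Z + g Z) = (\<lambda>Z. op_add \<nu> S T f Z + op_add \<nu> S T g Z)"
      if "f \<in> H" "g \<in> H" for f g
      using that by (simp add: op_add_def H_add op_additive[OF S] op_additive[OF T] algebra_simps)
    show "op_add \<nu> S T (\<lambda>Z. k * f Z) = (\<lambda>Z. k * op_add \<nu> S T f Z)" if "f \<in> H" for k f
      using that by (simp add: op_add_def H_scale op_homogeneous[OF S] op_homogeneous[OF T] algebra_simps)
    show "nrm (op_add \<nu> S T f) \<le> (K + L) * nrm f" if f: "f \<in> H" for f
    proof -
      have "nrm (op_add \<nu> S T f) \<le> nrm (S f) + nrm (T f)"
        using f L2_norm_triangle[OF H_L2[OF op_closed[OF S f]] H_L2[OF op_closed[OF T f]]]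
        by (simp add: op_add_def)
      also have "\<dots> \<le> (K + L) * nrm f" using K[OF f] L[OF f] by (simp add: distrib_right)
      finally show ?thesis .
    qed
  qed
qed

lemma op_scale_bounded:
  assumes T: "T \<in> B"
  shows "op_scale \<nu> k T \<in> B"
proof -
  obtain L where L: "\<And>f. f \<in> H \<Longrightarrow> nrm (T f) \<le> L * nrm f" using op_bounded[OF T] by blast
  show ?thesis
  proof (rule bounded_opsI[where K="norm k * L"])
    show "op_scale \<nu> k T \<in> extensional H" by (simp add: op_scale_def)
    show "op_scale \<nu> k T f \<in> H" if "f \<in> H" for f
      using that by (simp add: op_scale_def H_scale op_closed T)
    show "op_scale \<nu> k T (\<lambda>Z. f Z + g Z) = (\<lambda>Z. op_scale \<nu> k T f Z + op_scale \<nu> k T g Z)"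
      if "f \<in> H" "g \<in> H" for f g
      using that by (simp add: op_scale_def H_add op_additive[OF T] algebra_simps)
    show "op_scale \<nu> k T (\<lambda>Z. c * f Z) = (\<lambda>Z. c * op_scale \<nu> k T f Z)" if "f \<in> H" for c f
      using that by (simp add: op_scale_def H_scale op_homogeneous[OF T] algebra_simps)
    show "nrm (op_scale \<nu> k T f) \<le> norm k * L * nrm f" if f: "f \<in> H" for f
      using mult_left_mono[OF L[OF f] norm_ge_zero[of k]] f
      by (simp add: op_scale_def L2_norm_scale mult.assoc)
  qed
qed

lemma compose_bounded:
  assumes S: "S \<in> B" and T: "T \<in> B"
  shows "compose H S T \<in> B"
proof -
  obtain K where K0: "0 \<le> K" and K: "\<And>f. f \<in> H \<Longrightarrow> nrm (S f) \<le> K * nrm f"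
    using op_bounded_nonneg[OF S] by blast
  obtain L where L: "\<And>f. f \<in> H \<Longrightarrow> nrm (T f) \<le> L * nrm f" using op_bounded[OF T] by blast
  show ?thesis
  proof (rule bounded_opsI[where K="K * L"])
    show "compose H S T \<in> extensional H" by (simp add: compose_def)
    show "compose H S T f \<in> H" if "f \<in> H" for f
      using that by (simp add: compose_def op_closed S T)
    show "compose H S T (\<lambda>Z. f Z + g Z) = (\<lambda>Z. compose H S T f Z + compose H S T g Z)"
      if "f \<in> H" "g \<in> H" for f g
      using that by (simp add: compose_def H_add op_additive[OF S] op_additive[OF T] op_closed[OF T])
    show "compose H S T (\<lambda>Z. c * f Z) = (\<lambda>Z. c * compose H S T f Z)" if "f \<in> H" for c f
      using that by (simp add: compose_def H_scale op_homogeneous[OF S] op_homogeneous[OF T] op_closed[OF T])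
    show "nrm (compose H S T f) \<le> K * L * nrm f" if f: "f \<in> H" for f
      using order_trans[OF K[OF op_closed[OF T f]] mult_left_mono[OF L[OF f] K0]] f
      by (simp add: compose_def mult.assoc)
  qed
qed

text \<open>
  A function of norm \<open>0\<close> in \<open>H\<close> is \<open>0\<close>, so the case that cannot be rescaled to norm \<open>1\<close> is trivial.
\<close>

lemma op_norm_bound:
  assumes T: "T \<in> B" and f: "f \<in> H"
  shows "nrm (T f) \<le> op_norm \<nu> T * nrm f"
proof (cases "nrm f = 0")
  case True
  have "T f = (\<lambda>Z. 0)"
    using H_norm_zero[OF f True] op_zero[OF T] by simp
  moreover have "nrm (\<lambda>Z. 0) = 0" by (simp add: L2_norm_M)
  ultimately show ?thesis using True by simp
next
  case False
  then have pos: "0 < nrm f" using L2_norm_nonneg[of f] by simp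
  (* rescaling f to norm 1 brings it into the set over which op_norm takes the supremum *)
  let ?s = "complex_of_real (1 / nrm f)"
  let ?g = "\<lambda>Z. ?s * f Z"
  obtain K where K0: "0 \<le> K" and K: "\<And>f. f \<in> H \<Longrightarrow> nrm (T f) \<le> K * nrm f"
    using op_bounded_nonneg[OF T] by blast
  have bdd: "bdd_above ((\<lambda>f. nrm (T f)) ` {f \<in> H. nrm f \<le> 1})"
  proof (rule bdd_aboveI2)
    fix f assume "f \<in> {f \<in> H. nrm f \<le> 1}"
    then show "nrm (T f) \<le> K"
      using K[of f] mult_left_mono[of "nrm f" 1 K] K0 by simp
  qed
  have ns: "norm ?s = 1 / nrm f" using pos by (simp add: norm_divide)
  have "?g \<in> {f \<in> H. nrm f \<le> 1}"
  proof (intro CollectI conjI)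
    show "?g \<in> H" by (rule H_scale[OF f])
    show "nrm ?g \<le> 1" unfolding L2_norm_scale ns using pos by simp
  qed
  then have "nrm (T ?g) \<le> op_norm \<nu> T"
    unfolding op_norm_def by (rule cSUP_upper[OF _ bdd])
  then have "1 / nrm f * nrm (T f) \<le> op_norm \<nu> T"
    unfolding op_homogeneous[OF T f] L2_norm_scale ns .
  then show ?thesis using pos by (simp add: field_simps)
qed

definition commutant :: "'n bergman_op set \<Rightarrow> 'n bergman_op set" where
  "commutant G = {S \<in> B. \<forall>R\<in>G. \<forall>f\<in>H. S (R f) = R (S f)}"

lemma unital_subalgebra_commutant:
  assumes G: "G \<subseteq> B"
  shows "unital_subalgebra \<nu> (commutant G)"
  unfolding unital_subalgebra_def
proof (intro conjI ballI allI)
  show "commutant G \<subseteq> B" by (auto simp: commutant_def)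
  show "op_id \<nu> \<in> commutant G"
  proof -
    have "op_id \<nu> (R f) = R (op_id \<nu> f)" if "R \<in> G" "f \<in> H" for R f
    proof -
      have "R f \<in> H" using that G op_closed[of R f] by blast
      then show ?thesis using that by (simp add: op_id_def)
    qed
    then show ?thesis unfolding commutant_def using op_id_bounded by blast
  qed
  fix S T assume S: "S \<in> commutant G" and T: "T \<in> commutant G"
  then have SB: "S \<in> B" and TB: "T \<in> B" by (auto simp: commutant_def)
  have com: "S (R f) = R (S f)" "T (R f) = R (T f)" if "R \<in> G" "f \<in> H" for R f
    using S T that by (auto simp: commutant_def)
  show "op_add \<nu> S T \<in> commutant G"
    unfolding commutant_def
  proof (intro CollectI conjI ballI op_add_bounded SB TB)
    fix R f assume R: "R \<in> G" and f: "f \<in> H"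
    then have RB: "R \<in> B" using G by blast
    show "op_add \<nu> S T (R f) = R (op_add \<nu> S T f)"
      using com[OF R f] f op_closed[OF RB f]
        op_additive[OF RB op_closed[OF SB f] op_closed[OF TB f]] by (simp add: op_add_def)
  qed
  show "compose H S T \<in> commutant G"
    unfolding commutant_def
  proof (intro CollectI conjI ballI compose_bounded SB TB)
    fix R f assume R: "R \<in> G" and f: "f \<in> H"
    then have RB: "R \<in> B" using G by blast
    have "S (T (R f)) = R (S (T f))"
      using com(2)[OF R f] com(1)[OF R op_closed[OF TB f]] by simp
    then show "compose H S T (R f) = R (compose H S T f)"
      using f op_closed[OF RB f] by (simp add: compose_def)
  qed
next
  fix k T assume T: "T \<in> commutant G"
  then have TB: "T \<in> B" by (auto simp: commutant_def)
  show "op_scale \<nu> k T \<in> commutant G"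
    unfolding commutant_def
  proof (intro CollectI conjI ballI op_scale_bounded TB)
    fix R f assume R: "R \<in> G" and f: "f \<in> H"
    then have RB: "R \<in> B" using G by blast
    have "T (R f) = R (T f)" using T R f by (auto simp: commutant_def)
    then show "op_scale \<nu> k T (R f) = R (op_scale \<nu> k T f)"
      using f op_closed[OF RB f] op_homogeneous[OF RB op_closed[OF TB f]] by (simp add: op_scale_def)
  qed
qed

text \<open>
  If \<open>X\<^sub>k\<close> commutes with \<open>R\<close> and \<open>D\<^sub>k = X\<^sub>k - T\<close>, then \<open>T R - R T = R D\<^sub>k - D\<^sub>k R\<close>, which tends to \<open>0\<close>.
\<close>

lemma norm_closed_commutant:
  assumes G: "G \<subseteq> B"
  shows "norm_closed \<nu> (commutant G)"
  unfolding norm_closed_def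
proof (intro allI impI, elim conjE)
  fix X :: "nat \<Rightarrow> 'n bergman_op" and T :: "'n bergman_op"
  assume X: "\<forall>k. X k \<in> commutant G" and T: "T \<in> B"
    and lim: "(\<lambda>k. op_norm \<nu> (op_add \<nu> (X k) (op_scale \<nu> (-1) T))) \<longlonglongrightarrow> 0"
  have XB: "X k \<in> B" for k using X by (auto simp: commutant_def)
  define D where "D = (\<lambda>k. op_add \<nu> (X k) (op_scale \<nu> (-1) T))"
  have DB: "D k \<in> B" for k unfolding D_def by (intro op_add_bounded op_scale_bounded XB T)
  have Df: "D k f = (\<lambda>Z. X k f Z - T f Z)" if "f \<in> H" for k f
    using that by (simp add: D_def op_add_def op_scale_def)
  show "T \<in> commutant G"
    unfolding commutant_def
  proof (intro CollectI conjI ballI T)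
    fix R f assume R: "R \<in> G" and f: "f \<in> H"
    then have RB: "R \<in> B" using G by blast
    obtain K where K0: "0 \<le> K" and K: "\<And>f. f \<in> H \<Longrightarrow> nrm (R f) \<le> K * nrm f"
      using op_bounded_nonneg[OF RB] by blast
    let ?e = "\<lambda>Z. T (R f) Z - R (T f) Z"
    have eH: "?e \<in> H"
      by (rule H_diff[OF op_closed[OF T op_closed[OF RB f]] op_closed[OF RB op_closed[OF T f]]])
    have bound: "nrm ?e \<le> op_norm \<nu> (D k) * (nrm (R f) + K * nrm f)" for k
    proof -
      have com: "X k (R f) = R (X k f)" using X R f by (auto simp: commutant_def)
      have "R (D k f) = R (\<lambda>Z. X k f Z + (-1) * T f Z)" unfolding Df[OF f] by simp
      also have "\<dots> = (\<lambda>Z. R (X k f) Z + R (\<lambda>Z. (-1) * T f Z) Z)"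
        by (rule op_additive[OF RB op_closed[OF XB f] H_scale[OF op_closed[OF T f]]])
      also have "R (\<lambda>Z. (-1) * T f Z) = (\<lambda>Z. (-1) * R (T f) Z)"
        by (rule op_homogeneous[OF RB op_closed[OF T f]])
      finally have RD: "R (D k f) = (\<lambda>Z. R (X k f) Z - R (T f) Z)" by simp
      have "?e = (\<lambda>Z. R (D k f) Z + (-1) * D k (R f) Z)"
        unfolding RD Df[OF op_closed[OF RB f]] com by simp
      then have "nrm ?e \<le> nrm (R (D k f)) + nrm (\<lambda>Z. (-1) * D k (R f) Z)"
        using L2_norm_triangle[OF H_L2[OF op_closed[OF RB op_closed[OF DB f]]]
            H_L2[OF H_scale[OF op_closed[OF DB op_closed[OF RB f]], of "-1"]]]
        by (simp only:)
      also have "nrm (\<lambda>Z. (-1) * D k (R f) Z) = nrm (D k (R f))"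
        by (simp only: L2_norm_scale) simp
      also have "nrm (R (D k f)) \<le> K * (op_norm \<nu> (D k) * nrm f)"
        using K[OF op_closed[OF DB f]] mult_left_mono[OF op_norm_bound[OF DB f] K0] by (rule order_trans)
      also have "nrm (D k (R f)) \<le> op_norm \<nu> (D k) * nrm (R f)"
        by (rule op_norm_bound[OF DB op_closed[OF RB f]])
      finally show ?thesis by (simp add: algebra_simps)
    qed
    have "(\<lambda>k. op_norm \<nu> (D k) * (nrm (R f) + K * nrm f)) \<longlonglongrightarrow> 0 * (nrm (R f) + K * nrm f)"
      unfolding D_def by (intro tendsto_mult tendsto_const lim)
    then have "nrm ?e \<le> 0 * (nrm (R f) + K * nrm f)"
      by (rule LIMSEQ_le_const) (use bound in blast)
    then have "nrm ?e = 0" using L2_norm_nonneg[of ?e] by simp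
    from H_norm_zero[OF eH this] show "T (R f) = R (T f)" by (simp add: fun_eq_iff)
  qed
qed

lemma banach_algebra_generated_subset_commutant:
  assumes "G \<subseteq> B" "T \<in> commutant G"
  shows "banach_algebra_generated \<nu> {T} \<subseteq> commutant G"
  unfolding banach_algebra_generated_def
  by (rule hull_minimal) (use assms unital_subalgebra_commutant norm_closed_commutant in auto)

text \<open>
  The generated algebra lies in the commutant of \<open>T\<close> and also in the commutant of that commutant, since
  both are norm-closed unital subalgebras containing \<open>T\<close>.
\<close>

lemma banach_algebra_generated_commutative:
  assumes T: "T \<in> B"
  shows "commutative \<nu> (banach_algebra_generated \<nu> {T})"
proof -
  let ?A = "banach_algebra_generated \<nu> {T}"
  have "T \<in> commutant {T}" using T by (simp add: commutant_def)
  then have 1: "?A \<subseteq> commutant {T}" using T by (intro banach_algebra_generated_subset_commutant) auto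
  have "T \<in> commutant (commutant {T})" using T by (auto simp: commutant_def)
  then have 2: "?A \<subseteq> commutant (commutant {T})"
    by (intro banach_algebra_generated_subset_commutant) (auto simp: commutant_def)
  show ?thesis
    unfolding commutative_def compose_eq_iff
  proof (intro ballI)
    fix S R f assume "S \<in> ?A" "R \<in> ?A" "f \<in> H"
    then have "S \<in> commutant (commutant {T})" "R \<in> commutant {T}" using 1 2 by auto
    then show "S (R f) = R (S f)" using \<open>f \<in> H\<close> by (auto simp: commutant_def[of "commutant {T}"])
  qed
qed

text \<open>
  An algebra that contains \<open>T\<close> and is closed under adjoints contains \<open>S\<close>, and \<open>T\<close> and \<open>S\<close> do not commute.
\<close>

lemma nonnormal_generates:
  assumes T: "T \<in> B" and S: "S \<in> B" and adj: "is_adjoint \<nu> T S"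
    and f: "f \<in> H" and ne: "T (S f) \<noteq> S (T f)"
  shows "commutative \<nu> (banach_algebra_generated \<nu> {T})"
    and "\<not> adjoint_closed \<nu> (banach_algebra_generated \<nu> {T})"
    and "\<not> commutative \<nu> (cstar_algebra_generated \<nu> {T})"
proof -
  let ?A = "banach_algebra_generated \<nu> {T}"
  let ?C = "cstar_algebra_generated \<nu> {T}"
  show com: "commutative \<nu> ?A" by (rule banach_algebra_generated_commutative[OF T])
  have noncom: "\<not> commutative \<nu> \<A>" if "T \<in> \<A>" "S \<in> \<A>" for \<A>
  proof
    assume "commutative \<nu> \<A>"
    then have "compose H T S = compose H S T" using that unfolding commutative_def by blast
    then show False using f ne unfolding compose_eq_iff by blast
  qed
  have TA: "T \<in> ?A" unfolding banach_algebra_generated_def by (rule hull_inc) simp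
  show "\<not> adjoint_closed \<nu> ?A"
  proof
    assume "adjoint_closed \<nu> ?A"
    then have "S \<in> ?A" using TA S adj unfolding adjoint_closed_def by blast
    then show False using noncom[OF TA] com by blast
  qed
  have "T \<in> ?C" unfolding cstar_algebra_generated_def by (rule hull_inc) simp
  moreover have "S \<in> ?C"
    unfolding cstar_algebra_generated_def hull_def
  proof (rule InterI)
    fix \<A> assume "\<A> \<in> {t. (unital_subalgebra \<nu> t \<and> norm_closed \<nu> t \<and> adjoint_closed \<nu> t) \<and> {T} \<subseteq> t}"
    then have "adjoint_closed \<nu> \<A>" "T \<in> \<A>" by auto
    then show "S \<in> \<A>" using S adj unfolding adjoint_closed_def by blast
  qed
  ultimately show "\<not> commutative \<nu> ?C" by (rule noncom)
qed

lemma
  assumes a: "a \<in> borel_measurable M" "\<And>Z. Z \<in> cartan_domain \<Longrightarrow> norm (a Z) \<le> C"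
  shows toeplitz_in_H: "f \<in> H \<Longrightarrow> toeplitz \<nu> a f \<in> H"
    and toeplitz_inner: "f \<in> H \<Longrightarrow> g \<in> H \<Longrightarrow> ip (toeplitz \<nu> a f) g = ip (\<lambda>Z. a Z * f Z) g"
    and toeplitz_bounded: "toeplitz \<nu> a \<in> B"
proof -
  have af: "(\<lambda>Z. a Z * f Z) \<in> L2" if "f \<in> H" for f
    by (rule L2_mult_bounded[OF H_L2[OF that] a])
  have app: "toeplitz \<nu> a f = bergman_projection \<nu> (\<lambda>Z. a Z * f Z)" if "f \<in> H" for f
    using that by (simp add: toeplitz_def)
  show tH: "toeplitz \<nu> a f \<in> H" if "f \<in> H" for f
    unfolding app[OF that] by (rule projection_in_H[OF af[OF that]])
  show tip: "ip (toeplitz \<nu> a f) g = ip (\<lambda>Z. a Z * f Z) g" if "f \<in> H" "g \<in> H" for f g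
    unfolding app[OF that(1)] by (rule projection_inner[OF af[OF that(1)] that(2)])
  show "toeplitz \<nu> a \<in> B"
  proof (rule bounded_opsI[where K="\<bar>C\<bar>"])
    show "toeplitz \<nu> a \<in> extensional H" by (simp add: toeplitz_def)
    show "toeplitz \<nu> a f \<in> H" if "f \<in> H" for f using that by (rule tH)
    show "toeplitz \<nu> a (\<lambda>Z. f Z + g Z) = (\<lambda>Z. toeplitz \<nu> a f Z + toeplitz \<nu> a g Z)"
      if f: "f \<in> H" and g: "g \<in> H" for f g
    proof (rule H_eqI)
      fix u assume u: "u \<in> H"
      have "ip (toeplitz \<nu> a (\<lambda>Z. f Z + g Z)) u = ip (\<lambda>Z. a Z * f Z + a Z * g Z) u"
        using tip[OF H_add[OF f g] u] by (simp add: distrib_left)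
      also have "\<dots> = ip (\<lambda>Z. toeplitz \<nu> a f Z + toeplitz \<nu> a g Z) u"
        using f g u by (simp add: L2_inner_add_left af H_L2 tH tip)
      finally show "ip (toeplitz \<nu> a (\<lambda>Z. f Z + g Z)) u = ip (\<lambda>Z. toeplitz \<nu> a f Z + toeplitz \<nu> a g Z) u" .
    qed (intro tH H_add f g)+
    show "toeplitz \<nu> a (\<lambda>Z. k * f Z) = (\<lambda>Z. k * toeplitz \<nu> a f Z)" if f: "f \<in> H" for k f
    proof (rule H_eqI)
      fix u assume u: "u \<in> H"
      have "ip (toeplitz \<nu> a (\<lambda>Z. k * f Z)) u = ip (\<lambda>Z. k * (a Z * f Z)) u"
        using tip[OF H_scale[OF f] u, of k] by (simp add: mult.left_commute)
      then show "ip (toeplitz \<nu> a (\<lambda>Z. k * f Z)) u = ip (\<lambda>Z. k * toeplitz \<nu> a f Z) u"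
        using tip[OF f u] by (simp add: L2_inner_scale_left)
    qed (intro tH H_scale f)+
    show "nrm (toeplitz \<nu> a f) \<le> \<bar>C\<bar> * nrm f" if f: "f \<in> H" for f
    proof -
      let ?t = "toeplitz \<nu> a f"
      have "complex_of_real ((nrm ?t)\<^sup>2) = ip (\<lambda>Z. a Z * f Z) ?t"
        using tip[OF f tH[OF f]] by (simp only: L2_inner_self)
      then have "(nrm ?t)\<^sup>2 = norm (ip (\<lambda>Z. a Z * f Z) ?t)"
        by (metis norm_of_real abs_of_nonneg zero_le_power2)
      also have "\<dots> \<le> nrm (\<lambda>Z. a Z * f Z) * nrm ?t"
        by (rule L2_Cauchy_Schwarz[OF af[OF f] H_L2[OF tH[OF f]]])
      finally have "nrm ?t * nrm ?t \<le> nrm (\<lambda>Z. a Z * f Z) * nrm ?t" by (simp add: power2_eq_square)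
      then have "nrm ?t \<le> nrm (\<lambda>Z. a Z * f Z)"
        using L2_norm_nonneg[of ?t] L2_norm_nonneg[of "\<lambda>Z. a Z * f Z"]
        by (cases "nrm ?t = 0") (auto simp: mult_le_cancel_right)
      also have "\<dots> \<le> \<bar>C\<bar> * nrm f"
      proof (rule power2_le_imp_le)
        have "(nrm (\<lambda>Z. a Z * f Z))\<^sup>2 = (\<integral>Z. (norm (a Z * f Z))\<^sup>2 \<partial>M)" by (rule L2_norm_square)
        also have "\<dots> \<le> (\<integral>Z. \<bar>C\<bar>\<^sup>2 * (norm (f Z))\<^sup>2 \<partial>M)"
        proof (rule integral_mono_AE)
          show "integrable M (\<lambda>Z. (norm (a Z * f Z))\<^sup>2)" using af[OF f] by (simp only: L2_iff)
          show "integrable M (\<lambda>Z. \<bar>C\<bar>\<^sup>2 * (norm (f Z))\<^sup>2)"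
            using H_L2[OF f] by (intro integrable_mult_right) (simp only: L2_iff)
          show "AE Z in M. (norm (a Z * f Z))\<^sup>2 \<le> \<bar>C\<bar>\<^sup>2 * (norm (f Z))\<^sup>2"
          proof (rule AE_M_domain)
            fix Z :: "complex^'n^'n" assume "Z \<in> cartan_domain"
            then have "norm (a Z) \<le> \<bar>C\<bar>" using a(2)[of Z] by simp
            then have "(norm (a Z) * norm (f Z))\<^sup>2 \<le> (\<bar>C\<bar> * norm (f Z))\<^sup>2"
              by (intro power_mono mult_right_mono) auto
            then show "(norm (a Z * f Z))\<^sup>2 \<le> \<bar>C\<bar>\<^sup>2 * (norm (f Z))\<^sup>2"
              by (simp add: norm_mult power_mult_distrib)
          qed
        qed
        also have "\<dots> = (\<bar>C\<bar> * nrm f)\<^sup>2"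
          by (simp add: power_mult_distrib L2_norm_square)
        finally show "(nrm (\<lambda>Z. a Z * f Z))\<^sup>2 \<le> (\<bar>C\<bar> * nrm f)\<^sup>2" .
      qed (simp add: L2_norm_nonneg)
      finally show ?thesis .
    qed
  qed
qed

lemma toeplitz_adjoint:
  assumes a: "a \<in> borel_measurable M" "\<And>Z. Z \<in> cartan_domain \<Longrightarrow> norm (a Z) \<le> C"
    and a': "(\<lambda>Z. cnj (a Z)) \<in> borel_measurable M"
  shows "is_adjoint \<nu> (toeplitz \<nu> a) (toeplitz \<nu> (\<lambda>Z. cnj (a Z)))"
  unfolding is_adjoint_def
proof (intro ballI)
  fix f g assume f: "f \<in> H" and g: "g \<in> H"
  have b: "norm (cnj (a Z)) \<le> C" if "Z \<in> cartan_domain" for Z using a(2)[OF that] by simp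
  have "ip (toeplitz \<nu> a f) g = ip (\<lambda>Z. a Z * f Z) g" by (rule toeplitz_inner[OF a f g])
  also have "\<dots> = ip f (\<lambda>Z. cnj (a Z) * g Z)" by (simp add: L2_inner_M mult_ac)
  also have "\<dots> = cnj (ip (\<lambda>Z. cnj (a Z) * g Z) f)" by (rule L2_inner_cnj)
  also have "\<dots> = cnj (ip (toeplitz \<nu> (\<lambda>Z. cnj (a Z)) g) f)"
    by (simp only: toeplitz_inner[OF a' b g f])
  also have "\<dots> = ip f (toeplitz \<nu> (\<lambda>Z. cnj (a Z)) g)" by (rule L2_inner_cnj[symmetric])
  finally show "ip (toeplitz \<nu> a f) g = ip f (toeplitz \<nu> (\<lambda>Z. cnj (a Z)) g)" .
qed

end

section \<open>Symbols that rotate with one row or column\<close>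

context bergman
begin

text \<open>
  The function \<open>cnj a * f\<close> is multiplied by \<open>cnj w\<close> under the action of a phase \<open>w\<close>. Averaging the integrand
  over the action thus produces, up to conjugation, the circle average of \<open>w * g (\<sigma> w Z)\<close>. This is
  holomorphic on the closed disc, because \<open>\<sigma> w\<close> maps the domain to itself also for \<open>|w| < 1\<close>, and it
  vanishes at \<open>w = 0\<close>.
\<close>

lemma phase_action_orthogonal:
  fixes \<sigma> :: "complex \<Rightarrow> complex^'n^'n \<Rightarrow> complex^'n^'n" and a f g :: "complex^'n^'n \<Rightarrow> complex"
  assumes affine: "\<And>Z. \<exists>A V. \<forall>w. \<sigma> w Z = A + cscale w V"
    and contr: "\<And>w Z. norm w \<le> 1 \<Longrightarrow> Z \<in> cartan_domain \<Longrightarrow> \<sigma> w Z \<in> cartan_domain"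
    and inv: "\<And>w Z. norm w = 1 \<Longrightarrow> \<sigma> (cnj w) (\<sigma> w Z) = Z"
    and orth: "\<And>w. norm w = 1 \<Longrightarrow> orthogonal_transformation (\<sigma> w)"
    and cont: "continuous_on UNIV (\<lambda>(t, Z). \<sigma> (exp (2 * of_real pi * \<i> * of_real t)) Z)"
    and weight: "\<And>w Z. norm w = 1 \<Longrightarrow> weight (\<sigma> w Z) = weight Z"
    and a: "a \<in> borel_measurable borel" "\<And>Z. Z \<in> cartan_domain \<Longrightarrow> norm (a Z) \<le> C"
    and aw: "\<And>w Z. norm w = 1 \<Longrightarrow> a (\<sigma> w Z) = w * a Z"
    and f: "f \<in> H" and fw: "\<And>w Z. norm w = 1 \<Longrightarrow> f (\<sigma> w Z) = f Z"
    and g: "g \<in> H"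
  shows "ip (\<lambda>Z. cnj (a Z) * f Z) g = 0"
proof -
  let ?e = "\<lambda>t::real. exp (2 * of_real pi * \<i> * of_real t)"
  have e1: "norm (?e t) = 1" for t by (simp add: norm_exp_eq_Re)
  let ?h = "\<lambda>Z. cnj (a Z) * f Z * cnj (g Z)"
  let ?F = "\<lambda>Z. (indicator cartan_domain Z * dens Z) *\<^sub>R ?h Z"
  have cm: "cnj \<in> borel_measurable borel"
    by (intro borel_measurable_continuous_onI continuous_intros)
  have am: "(\<lambda>Z. cnj (a Z)) \<in> borel_measurable borel" by (rule measurable_compose[OF a(1) cm])
  have gm: "(\<lambda>Z. cnj (g Z)) \<in> borel_measurable borel" by (rule measurable_compose[OF H_borel[OF g] cm])
  have hm: "?h \<in> borel_measurable borel"
    by (intro borel_measurable_times am gm H_borel[OF f])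
  have "(\<lambda>Z. cnj (a Z) * f Z) \<in> L2"
    by (rule L2_mult_bounded[OF H_L2[OF f] borel_imp_M[OF am], of C]) (use a(2) in simp)
  then have "integrable M ?h"
    using L2_integrable_mult[OF _ H_L2[OF g]] by blast
  then have int: "integrable lborel ?F" unfolding integrable_M[OF hm] .
  have dom: "\<sigma> w Z \<in> cartan_domain \<longleftrightarrow> Z \<in> cartan_domain" if w: "norm w = 1" for w Z
    using contr[of w Z] contr[of "cnj w" "\<sigma> w Z"] inv[OF w, of Z] w by auto
  have "(\<integral>Z. (0::complex) \<partial>(lborel :: (complex^'n^'n) measure)) = (\<integral>Z. ?F Z \<partial>lborel)"
  proof (rule circle_average_integral[OF int, where R="\<lambda>t. \<sigma> (?e t)"])
    show "orthogonal_transformation (\<sigma> (?e t))" for t by (rule orth[OF e1])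
    show "continuous_on UNIV (\<lambda>(t, Z). \<sigma> (?e t) Z)" by (rule cont)
    show "(\<lambda>Z. 0) \<in> borel_measurable borel" by simp
    fix Z :: "complex^'n^'n"
    show "((\<lambda>t. ?F (\<sigma> (?e t) Z)) has_integral 0) {0..1}"
    proof (cases "Z \<in> cartan_domain")
      case False
      then have "(\<lambda>t. ?F (\<sigma> (?e t) Z)) = (\<lambda>t. 0)"
        by (simp add: dom[OF e1] fun_eq_iff)
      then show ?thesis by simp
    next
      case True
      obtain A V where AV: "\<And>w. \<sigma> w Z = A + cscale w V" using affine[of Z] by blast
      let ?S = "{w. A + cscale w V \<in> cartan_domain}"
      have op: "open ?S"
        using open_vimage[OF open_cartan_domain continuous_cscale] by (simp add: vimage_def)
      have sub: "cball 0 1 \<subseteq> ?S"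
        using contr[OF _ True] unfolding AV by (auto simp: dist_norm)
      have hol: "(\<lambda>w. w * g (A + cscale w V)) holomorphic_on ?S"
        by (intro holomorphic_intros matrix_holomorphic_slice H_holomorphic g)
      have "((\<lambda>t. ?e t * g (A + cscale (?e t) V)) has_integral 0 * g (A + cscale 0 V)) {0..1}"
        by (rule circle_mean_value[OF op sub hol])
      then have "((\<lambda>t. ?e t * g (\<sigma> (?e t) Z)) has_integral 0) {0..1}"
        by (simp only: AV mult_zero_left)
      then have "((\<lambda>t. cnj (?e t * g (\<sigma> (?e t) Z))) has_integral cnj 0) {0..1}"
        by (rule has_integral_linear[OF _ bounded_linear_cnj, unfolded o_def])
      then have "((\<lambda>t. (dens Z * cnj (a Z) * f Z) * cnj (?e t * g (\<sigma> (?e t) Z))) has_integral (dens Z * cnj (a Z) * f Z) * cnj 0) {0..1}"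
        by (rule has_integral_mult_right)
      moreover have "?F (\<sigma> w Z) = (dens Z * cnj (a Z) * f Z) * cnj (w * g (\<sigma> w Z))" if w: "norm w = 1" for w
      proof -
        have "dens (\<sigma> w Z) = dens Z" by (simp only: dens_def weight[OF w])
        moreover have "\<sigma> w Z \<in> cartan_domain" using True dom[OF w] by blast
        ultimately show ?thesis
          by (simp only: aw[OF w] fw[OF w] indicator_simps scaleR_conv_of_real mult_1 complex_cnj_mult mult_ac)
      qed
      ultimately show ?thesis by (simp only: e1 complex_cnj_zero mult_zero_right)
    qed
  qed
  then have "(\<integral>Z. ?F Z \<partial>lborel) = 0" by simp
  then show ?thesis
    unfolding L2_inner_M integral_M[OF hm] .
qed

text \<open>The set where \<open>a\<close> does not vanish is open and nonempty, so it has positive measure.\<close>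

lemma nonvanishing_L2_norm:
  assumes a: "continuous_on UNIV a" "a \<in> L2" and Z0: "Z0 \<in> cartan_domain" "a Z0 \<noteq> (0::complex)"
  shows "nrm a \<noteq> 0"
proof
  assume "nrm a = 0"
  then have "(\<integral>Z. (norm (a Z))\<^sup>2 \<partial>M) = 0" using L2_norm_square[of a] by simp
  moreover have "integrable M (\<lambda>Z. (norm (a Z))\<^sup>2)" using a(2) by (simp add: L2_iff)
  ultimately have "AE Z in M. (norm (a Z))\<^sup>2 = 0"
    by (subst (asm) integral_nonneg_eq_0_iff_AE) auto
  then have "AE Z in lebesgue_on cartan_domain. a Z = 0" unfolding AE_M_iff by simp
  then have "AE Z in lebesgue. Z \<in> cartan_domain \<longrightarrow> a Z = 0"
    by (subst (asm) AE_restrict_space_iff) auto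
  then have ae: "AE Z in lborel. Z \<in> cartan_domain \<longrightarrow> a Z = 0"
    unfolding AE_completion_iff .
  let ?U = "cartan_domain \<inter> (a -` (- {0}))"
  have U: "open ?U"
    by (intro open_Int open_cartan_domain open_vimage a) auto
  have "Z0 \<in> ?U" using Z0 by simp
  with U obtain e where e: "e > 0" "ball Z0 e \<subseteq> ?U" by (rule openE)
  from ae have "AE Z in lborel. Z \<notin> ?U" by eventually_elim auto
  then have "emeasure lborel ?U = 0"
    using U by (subst (asm) AE_iff_measurable[of ?U]) auto
  moreover have "emeasure lborel (ball Z0 e) \<le> emeasure lborel ?U"
    using e U by (intro emeasure_mono) auto
  moreover have "emeasure lborel (ball Z0 e) \<noteq> 0"
    using e by (simp add: emeasure_ball less_imp_neq[OF unit_ball_vol_pos, symmetric])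
  ultimately show False by simp
qed

lemma entry_in_H: "(\<lambda>Z. if Z \<in> cartan_domain then Z $ i $ j else 0) \<in> H" (is "?f \<in> H")
  unfolding H_iff
proof (intro conjI allI impI)
  interpret finite_measure M by (rule finite_measure_M)
  show hol: "matrix_holomorphic_on ?f cartan_domain"
    unfolding matrix_holomorphic_on_def
  proof
    fix Z :: "complex^'n^'n" assume Z: "Z \<in> cartan_domain"
    have "((\<lambda>Z. Z $ i $ j) has_derivative (\<lambda>V. V $ i $ j)) (at Z)"
      by (intro bounded_linear_imp_has_derivative bounded_linear_compose[OF bounded_linear_vec_nth bounded_linear_vec_nth])
    then have "(?f has_derivative (\<lambda>V. V $ i $ j)) (at Z)"
      by (rule has_derivative_transform_within_open[OF _ open_cartan_domain Z]) simp
    then show "\<exists>f'. (?f has_derivative f') (at Z) \<and> (\<forall>c V. f' (\<chi> i j. c * V $ i $ j) = c * f' V)"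
      by (intro exI[of _ "\<lambda>V. V $ i $ j"]) simp
  qed
  have one: "(\<lambda>Z. 1) \<in> L2" by (simp add: L2_iff)
  have "?f \<in> borel_measurable M"
    by (rule borel_imp_M[OF holomorphic_borel[OF hol]]) simp
  then show "?f \<in> L2"
    by (rule L2_bound[OF one, where C=1]) (auto intro: less_imp_le cartan_domain_entry)
qed simp

text \<open>
  The conjugate symbol annihilates every \<open>f i\<close>. By the assumption \<open>gram\<close>, the inner products of \<open>a * f i\<close> with
  \<open>g i\<close> add up to the squared norm of \<open>a\<close>, so \<open>a\<close> cannot annihilate them all.
\<close>

lemma phase_symbol_nonnormal:
  fixes \<sigma> :: "complex \<Rightarrow> complex^'n^'n \<Rightarrow> complex^'n^'n" and a :: "complex^'n^'n \<Rightarrow> complex"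
    and f g :: "'n \<Rightarrow> complex^'n^'n \<Rightarrow> complex"
  assumes affine: "\<And>Z. \<exists>A V. \<forall>w. \<sigma> w Z = A + cscale w V"
    and contr: "\<And>w Z. norm w \<le> 1 \<Longrightarrow> Z \<in> cartan_domain \<Longrightarrow> \<sigma> w Z \<in> cartan_domain"
    and inv: "\<And>w Z. norm w = 1 \<Longrightarrow> \<sigma> (cnj w) (\<sigma> w Z) = Z"
    and orth: "\<And>w. norm w = 1 \<Longrightarrow> orthogonal_transformation (\<sigma> w)"
    and cont: "continuous_on UNIV (\<lambda>(t, Z). \<sigma> (exp (2 * of_real pi * \<i> * of_real t)) Z)"
    and weight: "\<And>w Z. norm w = 1 \<Longrightarrow> weight (\<sigma> w Z) = weight Z"
    and a: "continuous_on UNIV a" "\<And>Z. Z \<in> cartan_domain \<Longrightarrow> norm (a Z) \<le> C"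
    and Z0: "Z0 \<in> cartan_domain" "a Z0 \<noteq> 0"
    and aw: "\<And>w Z. norm w = 1 \<Longrightarrow> a (\<sigma> w Z) = w * a Z"
    and f: "\<And>i. f i \<in> H" and fw: "\<And>i w Z. norm w = 1 \<Longrightarrow> f i (\<sigma> w Z) = f i Z"
    and g: "\<And>i. g i \<in> H"
    and gram: "\<And>Z. Z \<in> cartan_domain \<Longrightarrow> (\<Sum>i\<in>UNIV. f i Z * cnj (g i Z)) = cnj (a Z)"
  shows "commutative \<nu> (banach_algebra_generated \<nu> {toeplitz \<nu> a})"
    and "\<not> adjoint_closed \<nu> (banach_algebra_generated \<nu> {toeplitz \<nu> a})"
    and "\<not> commutative \<nu> (cstar_algebra_generated \<nu> {toeplitz \<nu> a})"
proof -
  interpret finite_measure M by (rule finite_measure_M)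
  have ab: "a \<in> borel_measurable borel" using a(1) by (rule borel_measurable_continuous_onI)
  have am: "a \<in> borel_measurable M" using ab by (rule borel_imp_M)
  have cm: "cnj \<in> borel_measurable borel"
    by (intro borel_measurable_continuous_onI continuous_intros)
  have am': "(\<lambda>Z. cnj (a Z)) \<in> borel_measurable M" by (rule measurable_compose[OF am cm])
  have a2': "norm (cnj (a Z)) \<le> C" if "Z \<in> cartan_domain" for Z using a(2)[OF that] by simp
  let ?T = "toeplitz \<nu> a" and ?S = "toeplitz \<nu> (\<lambda>Z. cnj (a Z))"
  have T: "?T \<in> B" by (rule toeplitz_bounded[OF am a(2)])
  have S: "?S \<in> B" by (rule toeplitz_bounded[OF am' a2'])
  have adj: "is_adjoint \<nu> ?T ?S" by (rule toeplitz_adjoint[OF am a(2) am'])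
  have Sf: "?S (f i) = (\<lambda>Z. 0)" for i
  proof (rule H_eqI[OF toeplitz_in_H[OF am' a2' f[of i]] zero_in_H])
    fix u assume u: "u \<in> H"
    have "ip (?S (f i)) u = ip (\<lambda>Z. cnj (a Z) * f i Z) u"
      by (rule toeplitz_inner[OF am' a2' f[of i] u])
    also have "\<dots> = 0"
      by (rule phase_action_orthogonal[where \<sigma>=\<sigma> and a=a and C=C and f="f i" and g=u])
        (fact affine contr inv orth cont weight ab a(2) aw f fw u)+
    finally show "ip (?S (f i)) u = ip (\<lambda>Z. 0) u" by (simp add: L2_inner_M)
  qed
  have aL2: "a \<in> L2"
  proof (rule L2_bound[OF _ am, where g="\<lambda>Z. 1" and C=C])
    show "(\<lambda>Z. 1) \<in> L2" by (simp add: L2_iff)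
  qed (use a(2) in simp)
  have "\<exists>i. ?T (f i) \<noteq> (\<lambda>Z. 0)"
  proof (rule ccontr)
    assume "\<nexists>i. ?T (f i) \<noteq> (\<lambda>Z. 0)"
    then have zero: "?T (f i) = (\<lambda>Z. 0)" for i by blast
    have ipz: "ip (\<lambda>Z. a Z * f i Z) (g i) = 0" for i
      using toeplitz_inner[OF am a(2) f[of i] g[of i]] unfolding zero by (simp add: L2_inner_M)
    have afL2: "(\<lambda>Z. a Z * f i Z) \<in> L2" for i
      by (rule L2_mult_bounded[OF H_L2[OF f] am a(2)])
    have "ip a a = (\<integral>Z. (\<Sum>i\<in>UNIV. a Z * f i Z * cnj (g i Z)) \<partial>M)"
      unfolding L2_inner_M
    proof (rule Bochner_Integration.integral_cong[OF refl])
      fix Z assume "Z \<in> space M"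
      then have "Z \<in> cartan_domain" by (simp add: space_M)
      then show "a Z * cnj (a Z) = (\<Sum>i\<in>UNIV. a Z * f i Z * cnj (g i Z))"
        unfolding gram[OF \<open>Z \<in> cartan_domain\<close>, symmetric] by (simp only: sum_distrib_left mult.assoc)
    qed
    also have "\<dots> = (\<Sum>i\<in>UNIV. \<integral>Z. a Z * f i Z * cnj (g i Z) \<partial>M)"
      by (rule Bochner_Integration.integral_sum) (rule L2_integrable_mult[OF afL2 H_L2[OF g]])
    also have "\<dots> = 0" using ipz by (simp add: L2_inner_M)
    finally have "nrm a = 0" by (simp add: L2_inner_self)
    then show False using nonvanishing_L2_norm[OF a(1) aL2 Z0] by blast
  qed
  then obtain i where i: "?T (f i) \<noteq> (\<lambda>Z. 0)" by blast
  have TfH: "?T (f i) \<in> H" by (rule toeplitz_in_H[OF am a(2) f])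
  have "?S (?T (f i)) \<noteq> (\<lambda>Z. 0)"
  proof
    assume z: "?S (?T (f i)) = (\<lambda>Z. 0)"
    have "ip (?T (f i)) (?T (f i)) = ip (f i) (?S (?T (f i)))"
      by (rule adj[unfolded is_adjoint_def, rule_format, OF f TfH])
    also have "\<dots> = 0" unfolding z by (simp add: L2_inner_M)
    finally have "nrm (?T (f i)) = 0" by (simp add: L2_inner_self)
    then show False using H_norm_zero[OF TfH] i by blast
  qed
  then have ne: "?T (?S (f i)) \<noteq> ?S (?T (f i))"
    unfolding Sf op_zero[OF T] by (rule not_sym)
  show "commutative \<nu> (banach_algebra_generated \<nu> {?T})"
    "\<not> adjoint_closed \<nu> (banach_algebra_generated \<nu> {?T})"
    "\<not> commutative \<nu> (cstar_algebra_generated \<nu> {?T})"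
    by (rule nonnormal_generates[OF T S adj f ne])+
qed

end

definition entry :: "'n \<times> 'n \<Rightarrow> complex^'n^'n \<Rightarrow> complex" where
  "entry x Z = Z $ fst x $ snd x"

definition entry_symbol ::
    "('n \<Rightarrow> 'n \<times> 'n) \<Rightarrow> ('n \<Rightarrow> 'n \<times> 'n) \<Rightarrow> complex^'n^'n \<Rightarrow> complex" where
  "entry_symbol P Q Z = (\<Sum>k\<in>UNIV. cnj (entry (P k) Z) * entry (Q k) Z)"

abbreviation col_symbol :: "'n::finite \<Rightarrow> 'n \<Rightarrow> complex^'n^'n \<Rightarrow> complex" where
  "col_symbol p q \<equiv> entry_symbol (\<lambda>k. (k, p)) (\<lambda>k. (k, q))"

abbreviation row_symbol :: "'n::finite \<Rightarrow> 'n \<Rightarrow> complex^'n^'n \<Rightarrow> complex" where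
  "row_symbol p q \<equiv> entry_symbol (\<lambda>k. (p, k)) (\<lambda>k. (q, k))"

lemma col_symbol_gram: "col_symbol p q Z = (conj_transpose Z ** Z) $ p $ q"
  by (simp add: entry_symbol_def entry_def matrix_matrix_mult_def conj_transpose_def)

lemma row_symbol_gram: "row_symbol p q Z = (Z ** conj_transpose Z) $ q $ p"
  by (simp add: entry_symbol_def entry_def matrix_matrix_mult_def conj_transpose_def mult.commute)

lemma continuous_entry_symbol: "continuous_on UNIV (entry_symbol P Q)"
  unfolding entry_symbol_def entry_def by (intro continuous_intros)

lemma entry_symbol_bounded:
  fixes Z :: "complex^'n^'n"
  assumes "Z \<in> cartan_domain"
  shows "norm (entry_symbol P Q Z) \<le> real CARD('n)"
proof -
  have "norm (cnj (entry x Z) * entry y Z) \<le> 1" for x y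
    using mult_mono[of "norm (entry x Z)" 1 "norm (entry y Z)" 1]
      cartan_domain_entry[OF assms, of "fst x" "snd x"] cartan_domain_entry[OF assms, of "fst y" "snd y"]
    by (simp add: norm_mult entry_def)
  then have "norm (entry_symbol P Q Z) \<le> (\<Sum>k\<in>(UNIV :: 'n set). 1)"
    unfolding entry_symbol_def by (intro order_trans[OF norm_sum sum_mono])
  then show ?thesis by simp
qed

lemma entry_symbol_L_infinity:
  fixes P Q :: "'n::finite \<Rightarrow> 'n \<times> 'n"
  shows "entry_symbol P Q \<in> L_infinity"
  unfolding L_infinity_def
proof (intro CollectI conjI exI)
  show "entry_symbol P Q \<in> borel_measurable (lebesgue_on cartan_domain)"
    by (intro borel_imp_lebesgue_on borel_measurable_continuous_onI continuous_entry_symbol)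
  show "AE Z in lebesgue_on cartan_domain. norm (entry_symbol P Q Z) \<le> real CARD('n)"
    by (rule AE_I2) (simp add: entry_symbol_bounded)
qed

lemma entry_symbol_nonzero:
  obtains Z :: "complex^'n^'n" where "Z \<in> cartan_domain" "entry_symbol P Q Z \<noteq> 0"
proof -
  obtain e where e: "e > 0" "ball 0 e \<subseteq> (cartan_domain :: (complex^'n^'n) set)"
    using open_cartan_domain zero_in_cartan_domain open_contains_ball by blast
  define J :: "complex^'n^'n" where "J = (\<chi> i j. 1)"
  define r where "r = e / (2 * (norm J + 1))"
  have r: "r > 0" using e by (simp add: r_def add_nonneg_pos)
  define Z where "Z = cscale (complex_of_real r) J"
  have "norm Z = r * norm J" using r by (simp add: Z_def norm_cscale)
  also have "\<dots> \<le> r * (norm J + 1)" using r by simp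
  also have "\<dots> = e / 2"
  proof -
    have "e / (2 * m) * m = e / 2" if "m \<noteq> 0" for m :: real using that by simp
    moreover have "norm J + 1 \<noteq> 0" using norm_ge_zero[of J] by linarith
    ultimately show ?thesis unfolding r_def by blast
  qed
  also have "\<dots> < e" using e by simp
  finally have "Z \<in> cartan_domain" using e(2) by (auto simp: dist_norm)
  moreover have "entry_symbol P Q Z \<noteq> 0"
    using r by (simp add: entry_symbol_def entry_def Z_def cscale_def J_def)
  ultimately show ?thesis by (rule that)
qed

lemma col_symbol_psd_sqrt:
  assumes "Z \<in> cartan_domain"
  shows "col_symbol p q Z = col_symbol p q (psd_sqrt (conj_transpose Z ** Z))"
proof -
  have "norm (Z *v v) \<le> norm v" for v
    using assms by (cases "v = 0") (auto simp: cartan_domain_iff intro: less_imp_le)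
  note R = psd_sqrt_gram[OF this]
  have "conj_transpose (psd_sqrt (conj_transpose Z ** Z)) = psd_sqrt (conj_transpose Z ** Z)"
    using R(1) by (simp add: pos_semidef_iff)
  then show ?thesis unfolding col_symbol_gram using R(2) by simp
qed

text \<open>
  This is \<open>|Z\<^sup>* v|\<^sup>2 = \<langle>v, Z Z\<^sup>* v\<rangle> \<le> |v| |Z\<^sup>* v|\<close>.
\<close>

lemma cartan_domain_conj_transpose_norm:
  assumes "Z \<in> cartan_domain"
  shows "norm (conj_transpose Z *v v) \<le> norm v"
proof -
  have Z: "norm (Z *v v) \<le> norm v" for v
    using assms by (cases "v = 0") (auto simp: cartan_domain_iff intro: less_imp_le)
  let ?w = "conj_transpose Z *v v"
  have "norm ?w * norm ?w = v \<bullet> (Z *v ?w)"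
    using inner_matrix_left[of "conj_transpose Z" v ?w]
    by (simp add: power2_norm_eq_inner[symmetric] power2_eq_square)
  also have "\<dots> \<le> norm v * norm (Z *v ?w)" by (rule norm_cauchy_schwarz)
  also have "\<dots> \<le> norm v * norm ?w" by (intro mult_left_mono Z) simp
  finally show ?thesis by (cases "?w = 0") (auto simp: mult_le_cancel_right)
qed

lemma row_symbol_psd_sqrt:
  assumes "Z \<in> cartan_domain"
  shows "row_symbol p q Z = row_symbol p q (psd_sqrt (Z ** conj_transpose Z))"
proof -
  note R = psd_sqrt_gram[OF cartan_domain_conj_transpose_norm[OF assms], unfolded conj_transpose_conj_transpose]
  have "conj_transpose (psd_sqrt (Z ** conj_transpose Z)) = psd_sqrt (Z ** conj_transpose Z)"
    using R(1) by (simp add: pos_semidef_iff)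
  then show ?thesis unfolding row_symbol_gram using R(2) by simp
qed

definition phase_at :: "'n \<Rightarrow> complex \<Rightarrow> 'n \<Rightarrow> complex" where
  "phase_at q w l = (if l = q then w else 1)"

lemma norm_phase_at: "norm w = 1 \<Longrightarrow> norm (phase_at q w l) = 1"
  "norm w \<le> 1 \<Longrightarrow> norm (phase_at q w l) \<le> 1"
  by (auto simp: phase_at_def)

lemma continuous_phase_at:
  "continuous_on UNIV (\<lambda>t. phase_at q (exp (2 * of_real pi * \<i> * of_real t)) k)"
  unfolding phase_at_def by (cases "k = q") (auto intro!: continuous_intros)

lemma unimodular_cnj: "norm w = 1 \<Longrightarrow> cnj w * w = 1"
  by (metis complex_norm_square mult.commute of_real_1 power_one)

text \<open>
  The abstract argument for \<open>\<Sum>\<^sub>k cnj (Z at P k) * (Z at Q k)\<close>, an entry of the Gram matrix of the columns or of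
  the rows. The action fixes the entries at \<open>P\<close> and scales those at \<open>Q\<close>.
\<close>

lemma entry_symbol_nonnormal:
  fixes \<sigma> :: "complex \<Rightarrow> complex^'n^'n \<Rightarrow> complex^'n^'n" and P Q :: "'n::finite \<Rightarrow> 'n \<times> 'n"
  assumes "bergman \<nu> c (M :: (complex^'n^'n) measure)"
  defines "a \<equiv> entry_symbol P Q"
  assumes affine: "\<And>Z. \<exists>A V. \<forall>w. \<sigma> w Z = A + cscale w V"
    and contr: "\<And>w Z. norm w \<le> 1 \<Longrightarrow> Z \<in> cartan_domain \<Longrightarrow> \<sigma> w Z \<in> cartan_domain"
    and inv: "\<And>w Z. norm w = 1 \<Longrightarrow> \<sigma> (cnj w) (\<sigma> w Z) = Z"
    and orth: "\<And>w. norm w = 1 \<Longrightarrow> orthogonal_transformation (\<sigma> w)"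
    and cont: "continuous_on UNIV (\<lambda>(t, Z). \<sigma> (exp (2 * of_real pi * \<i> * of_real t)) Z)"
    and weight: "\<And>w Z. norm w = 1 \<Longrightarrow> weight (\<sigma> w Z) = weight Z"
    and P: "\<And>k w Z. entry (P k) (\<sigma> w Z) = entry (P k) Z"
    and Q: "\<And>k w Z. entry (Q k) (\<sigma> w Z) = w * entry (Q k) Z"
  shows "commutative \<nu> (banach_algebra_generated \<nu> {toeplitz \<nu> a})"
    and "\<not> adjoint_closed \<nu> (banach_algebra_generated \<nu> {toeplitz \<nu> a})"
    and "\<not> commutative \<nu> (cstar_algebra_generated \<nu> {toeplitz \<nu> a})"
proof -
  interpret bergman \<nu> c M by fact
  let ?f = "\<lambda>i Z. if Z \<in> cartan_domain then entry (P i) Z else 0"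
  let ?g = "\<lambda>i Z. if Z \<in> cartan_domain then entry (Q i) Z else 0"
  obtain Z0 :: "complex^'n^'n" where Z0: "Z0 \<in> cartan_domain" "a Z0 \<noteq> 0"
    using entry_symbol_nonzero unfolding a_def by blast
  have aw: "a (\<sigma> w Z) = w * a Z" if "norm w = 1" for w Z
    by (simp add: a_def entry_symbol_def P Q sum_distrib_left mult.left_commute)
  have dom: "\<sigma> w Z \<in> cartan_domain \<longleftrightarrow> Z \<in> cartan_domain" if w: "norm w = 1" for w Z
    using contr[of w Z] contr[of "cnj w" "\<sigma> w Z"] inv[OF w, of Z] w by auto
  have fw: "?f i (\<sigma> w Z) = ?f i Z" if "norm w = 1" for i w Z
    by (simp add: dom[OF that] P)
  have gram: "(\<Sum>i\<in>UNIV. ?f i Z * cnj (?g i Z)) = cnj (a Z)" if "Z \<in> cartan_domain" for Z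
    using that by (simp add: a_def entry_symbol_def)
  have a: "continuous_on UNIV a" "\<And>Z. Z \<in> cartan_domain \<Longrightarrow> norm (a Z) \<le> real CARD('n)"
    unfolding a_def by (rule continuous_entry_symbol) (rule entry_symbol_bounded)
  have fH: "?f i \<in> bergman_space \<nu>" and gH: "?g i \<in> bergman_space \<nu>" for i
    unfolding entry_def by (rule entry_in_H)+
  show "commutative \<nu> (banach_algebra_generated \<nu> {toeplitz \<nu> a})"
    "\<not> adjoint_closed \<nu> (banach_algebra_generated \<nu> {toeplitz \<nu> a})"
    "\<not> commutative \<nu> (cstar_algebra_generated \<nu> {toeplitz \<nu> a})"
    by (rule phase_symbol_nonnormal[where \<sigma>=\<sigma> and a=a and C="real CARD('n)" and f="?f" and g="?g" and ?Z0.0=Z0];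
        fact affine contr inv orth cont weight a Z0 aw fH gH fw gram)+
qed

lemma col_symbol_nonnormal:
  fixes p q :: "'n::finite"
  assumes M: "bergman \<nu> c (M :: (complex^'n^'n) measure)" and pq: "p \<noteq> q"
  shows "commutative \<nu> (banach_algebra_generated \<nu> {toeplitz \<nu> (col_symbol p q)})"
    and "\<not> adjoint_closed \<nu> (banach_algebra_generated \<nu> {toeplitz \<nu> (col_symbol p q)})"
    and "\<not> commutative \<nu> (cstar_algebra_generated \<nu> {toeplitz \<nu> (col_symbol p q)})"
proof -
  define \<sigma> :: "complex \<Rightarrow> complex^'n^'n \<Rightarrow> complex^'n^'n" where "\<sigma> = (\<lambda>w. col_scale (phase_at q w))"
  have affine: "\<exists>A V. \<forall>w. \<sigma> w Z = A + cscale w V" for Z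
    by (intro exI[of _ "\<chi> i j. if j = q then 0 else Z $ i $ j"] exI[of _ "\<chi> i j. if j = q then Z $ i $ j else 0"])
       (auto simp: \<sigma>_def col_scale_def phase_at_def cscale_def vec_eq_iff)
  have contr: "\<sigma> w Z \<in> cartan_domain" if "norm w \<le> 1" "Z \<in> cartan_domain" for w Z
    unfolding \<sigma>_def using that by (intro col_scale_cartan_domain norm_phase_at)
  have inv: "\<sigma> (cnj w) (\<sigma> w Z) = Z" if "norm w = 1" for w Z
    using unimodular_cnj[OF that] by (auto simp: \<sigma>_def col_scale_def phase_at_def vec_eq_iff mult.assoc[symmetric])
  have orth: "orthogonal_transformation (\<sigma> w)" if "norm w = 1" for w
    unfolding \<sigma>_def using that by (intro orthogonal_col_scale norm_phase_at)
  have cont: "continuous_on UNIV (\<lambda>(t, Z). \<sigma> (exp (2 * of_real pi * \<i> * of_real t)) Z)"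
    unfolding \<sigma>_def by (intro continuous_scalings continuous_phase_at)
  have weight: "weight (\<sigma> w Z) = weight Z" if "norm w = 1" for w Z
    unfolding \<sigma>_def using that by (intro weight_col_scale norm_phase_at)
  have P: "entry (k, p) (\<sigma> w Z) = entry (k, p) Z" and Q: "entry (k, q) (\<sigma> w Z) = w * entry (k, q) Z" for k w Z
    using pq by (simp_all add: \<sigma>_def col_scale_def phase_at_def entry_def)
  show "commutative \<nu> (banach_algebra_generated \<nu> {toeplitz \<nu> (col_symbol p q)})"
    "\<not> adjoint_closed \<nu> (banach_algebra_generated \<nu> {toeplitz \<nu> (col_symbol p q)})"
    "\<not> commutative \<nu> (cstar_algebra_generated \<nu> {toeplitz \<nu> (col_symbol p q)})"
    by (rule entry_symbol_nonnormal[where \<sigma>=\<sigma>, OF M]; fact affine contr inv orth cont weight P Q)+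
qed

lemma row_symbol_nonnormal:
  fixes p q :: "'n::finite"
  assumes M: "bergman \<nu> c (M :: (complex^'n^'n) measure)" and pq: "p \<noteq> q"
  shows "commutative \<nu> (banach_algebra_generated \<nu> {toeplitz \<nu> (row_symbol p q)})"
    and "\<not> adjoint_closed \<nu> (banach_algebra_generated \<nu> {toeplitz \<nu> (row_symbol p q)})"
    and "\<not> commutative \<nu> (cstar_algebra_generated \<nu> {toeplitz \<nu> (row_symbol p q)})"
proof -
  define \<sigma> :: "complex \<Rightarrow> complex^'n^'n \<Rightarrow> complex^'n^'n" where "\<sigma> = (\<lambda>w. row_scale (phase_at q w))"
  have affine: "\<exists>A V. \<forall>w. \<sigma> w Z = A + cscale w V" for Z
    by (intro exI[of _ "\<chi> i j. if i = q then 0 else Z $ i $ j"] exI[of _ "\<chi> i j. if i = q then Z $ i $ j else 0"])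
       (auto simp: \<sigma>_def row_scale_def phase_at_def cscale_def vec_eq_iff)
  have contr: "\<sigma> w Z \<in> cartan_domain" if "norm w \<le> 1" "Z \<in> cartan_domain" for w Z
    unfolding \<sigma>_def using that by (intro row_scale_cartan_domain norm_phase_at)
  have inv: "\<sigma> (cnj w) (\<sigma> w Z) = Z" if "norm w = 1" for w Z
    using unimodular_cnj[OF that] by (auto simp: \<sigma>_def row_scale_def phase_at_def vec_eq_iff mult.assoc[symmetric])
  have orth: "orthogonal_transformation (\<sigma> w)" if "norm w = 1" for w
    unfolding \<sigma>_def using that by (intro orthogonal_row_scale norm_phase_at)
  have cont: "continuous_on UNIV (\<lambda>(t, Z). \<sigma> (exp (2 * of_real pi * \<i> * of_real t)) Z)"
    unfolding \<sigma>_def by (intro continuous_scalings continuous_phase_at)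
  have weight: "weight (\<sigma> w Z) = weight Z" if "norm w = 1" for w Z
    unfolding \<sigma>_def using that by (intro weight_row_scale norm_phase_at)
  have P: "entry (p, k) (\<sigma> w Z) = entry (p, k) Z" and Q: "entry (q, k) (\<sigma> w Z) = w * entry (q, k) Z" for k w Z
    using pq by (simp_all add: \<sigma>_def row_scale_def phase_at_def entry_def)
  show "commutative \<nu> (banach_algebra_generated \<nu> {toeplitz \<nu> (row_symbol p q)})"
    "\<not> adjoint_closed \<nu> (banach_algebra_generated \<nu> {toeplitz \<nu> (row_symbol p q)})"
    "\<not> commutative \<nu> (cstar_algebra_generated \<nu> {toeplitz \<nu> (row_symbol p q)})"
    by (rule entry_symbol_nonnormal[where \<sigma>=\<sigma>, OF M]; fact affine contr inv orth cont weight P Q)+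
qed

theorem theorem4p17:
  fixes \<nu> :: real
  assumes "CARD('n::finite) \<ge> 2"
    and "\<nu> > 2 * real CARD('n) - 1"
  shows
    "(\<exists>a :: complex^'n^'n \<Rightarrow> complex. a \<in> L_infinity \<and>
        (AE Z in lebesgue_on cartan_domain. a Z = a (psd_sqrt (conj_transpose Z ** Z))) \<and>
        commutative \<nu> (banach_algebra_generated \<nu> {toeplitz \<nu> a}) \<and>
        \<not> adjoint_closed \<nu> (banach_algebra_generated \<nu> {toeplitz \<nu> a}) \<and>
        \<not> commutative \<nu> (cstar_algebra_generated \<nu> {toeplitz \<nu> a})) \<and>
     (\<exists>a :: complex^'n^'n \<Rightarrow> complex. a \<in> L_infinity \<and>
        (AE Z in lebesgue_on cartan_domain. a Z = a (psd_sqrt (Z ** conj_transpose Z))) \<and>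
        commutative \<nu> (banach_algebra_generated \<nu> {toeplitz \<nu> a}) \<and>
        \<not> adjoint_closed \<nu> (banach_algebra_generated \<nu> {toeplitz \<nu> a}) \<and>
        \<not> commutative \<nu> (cstar_algebra_generated \<nu> {toeplitz \<nu> a}))"
proof -
  obtain p q :: 'n where pq: "p \<noteq> q"
  proof -
    have "\<not> (\<forall>p q :: 'n. p = q)"
    proof
      assume "\<forall>p q :: 'n. p = q"
      then have "(UNIV :: 'n set) = {undefined}" by auto
      then have "CARD('n) = 1" by (metis card_1_singleton_iff One_nat_def)
      with assms(1) show False by simp
    qed
    then show ?thesis using that by blast
  qed
  obtain c where c: "bergman \<nu> c (bergman_measure \<nu> :: (complex^'n^'n) measure)"
    using bergman_exists[OF assms(2)] by blast
  have "AE Z in lebesgue_on cartan_domain.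
      col_symbol p q Z = col_symbol p q (psd_sqrt (conj_transpose Z ** Z))"
    by (rule AE_I2) (simp add: col_symbol_psd_sqrt[symmetric])
  moreover have "AE Z in lebesgue_on cartan_domain.
      row_symbol p q Z = row_symbol p q (psd_sqrt (Z ** conj_transpose Z))"
    by (rule AE_I2) (simp add: row_symbol_psd_sqrt[symmetric])
  ultimately show ?thesis
    using col_symbol_nonnormal[OF c pq] row_symbol_nonnormal[OF c pq] entry_symbol_L_infinity
    by (intro conjI exI[of _ "col_symbol p q"] exI[of _ "row_symbol p q"])
qed

end
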